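(* $U_{\mathbf q}(\mathfrak g_A)$ has a triangular decomposition $$U_{\mathbf q}(\mathfrak g_A)\simeq U_{\mathbf q}^-\otimes U_{\mathbf q}^0\otimes U_{\mathbf q}^+ ,$$ i.e. the multiplication map $U_{\mathbf q}^-\otimes U_{\mathbf q}^0\otimes U_{\mathbf q}^+\to U_{\mathbf q}(\mathfrak g_A)$ is an isomorphism of $\mathbb K$-vector spaces.
   Context: Let $A=(a_{ij})_{i,j\in I}$ be a symmetrizable generalized Cartan matrix ($I$ finite). Let $q_{ij}$ ($i,j\in I$) be indeterminates over $\mathbb Q$ subject to $q_{ij}q_{ji}=q_{ii}^{a_{ij}}$, and $\mathbb K\supset\mathbb Q(q_{ij}\mid i,j\in I)$ a field containing $q_{ii}^{1/m}$ for all positive integers $m$. The $q_{ii}$ are not roots of unity. Notation: $(n)_v=\frac{v^n-1}{v-1}$, $(n)_v!=(n)_v\cdots(1)_v$, $(0)_v!=1$, $\binom nk_v=\frac{(n)_v!}{(k)_v!(n-k)_v!}$. $U_{\mathbf q}(\mathfrak g_A)$ is the associative unital $\mathbb K$-algebra generated by $e_i,f_i,\omega_i^{\pm1},\omega_i'^{\pm1}$ ($i\in I$) with relations: all $\omega_i^{\pm1},\omega_j'^{\pm1}$ commute with each other, $\omega_i\omega_i^{-1}=\omega_i'\omega_i'^{-1}=1$; $\omega_ie_j\omega_i^{-1}=q_{ij}e_j$, $\omega_i'e_j\omega_i'^{-1}=q_{ji}^{-1}e_j$; $\omega_if_j\omega_i^{-1}=q_{ij}^{-1}f_j$, $\omega_i'f_j\omega_i'^{-1}=q_{ji}f_j$;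 $e_if_j-f_je_i=\delta_{ij}\frac{q_{ii}}{q_{ii}-1}(\omega_i-\omega_i')$; and for $i\neq j$ $$\sum_{k=0}^{1-a_{ij}}(-1)^k\tbinom{1-a_{ij}}{k}_{q_{ii}}q_{ii}^{k(k-1)/2}q_{ij}^k e_i^{1-a_{ij}-k}e_je_i^k=0,\qquad \sum_{k=0}^{1-a_{ij}}(-1)^k\tbinom{1-a_{ij}}{k}_{q_{ii}}q_{ii}^{k(k-1)/2}q_{ij}^k f_i^kf_jf_i^{1-a_{ij}-k}=0.$$ $U_{\mathbf q}^+$, $U_{\mathbf q}^-$, $U_{\mathbf q}^0$ are the subalgebras generated by all $e_i$, by all $f_i$, and by all $\omega_i^{\pm1},\omega_i'^{\pm1}$, respectively. *)

theory Defs
  imports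
    "HOL-Library.Poly_Mapping"
    "HOL-Algebra.Subrings"
    "HOL-Algebra.Module"
    "HOL-Algebra.QuotRing"
    "HOL-Algebra.Algebraic_Closure_Type"
begin

section \<open>Symmetrizable generalized Cartan matrices\<close>

definition gen_cartan_matrix :: "('i \<Rightarrow> 'i \<Rightarrow> int) \<Rightarrow> bool" where
  "gen_cartan_matrix a \<longleftrightarrow>
     (\<forall>i. a i i = 2) \<and>
     (\<forall>i j. i \<noteq> j \<longrightarrow> a i j \<le> 0) \<and>
     (\<forall>i j. a i j = 0 \<longrightarrow> a j i = 0)"

definition symmetrizable :: "('i \<Rightarrow> 'i \<Rightarrow> int) \<Rightarrow> bool" where
  "symmetrizable a \<longleftrightarrow> (\<exists>d :: 'i \<Rightarrow> int. (\<forall>i. d i > 0) \<and> (\<forall>i j. d i * a i j = d j * a j i))"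


section \<open>Indeterminates subject to the Cartan constraints\<close>

text \<open>
  Laurent polynomials over the rationals in variables indexed by \<open>'v\<close>: a monomial is a finitely
  supported family of integer exponents, so the coefficient map has type \<open>('v \<Rightarrow>\<^sub>0 int) \<Rightarrow>\<^sub>0 rat\<close>
  and the multiplication of \<open>poly_mapping\<close> is the one of the Laurent polynomial ring.
\<close>

type_synonym 'v laurent_poly = "('v \<Rightarrow>\<^sub>0 int) \<Rightarrow>\<^sub>0 rat"

definition laurent_var_power :: "'v \<Rightarrow> int \<Rightarrow> 'v laurent_poly" where
  "laurent_var_power v n = Poly_Mapping.single (Poly_Mapping.single v n) 1"

definition laurent_eval :: "('v \<Rightarrow> 'k::field_char_0) \<Rightarrow> 'v laurent_poly \<Rightarrow> 'k" where
  "laurent_eval x p =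
     (\<Sum>m\<in>Poly_Mapping.keys p.
        of_rat (Poly_Mapping.lookup p m) * (\<Prod>v\<in>Poly_Mapping.keys m. x v powi Poly_Mapping.lookup m v))"

definition cartan_constraints :: "('i \<Rightarrow> 'i \<Rightarrow> int) \<Rightarrow> ('i \<times> 'i) laurent_poly set" where
  "cartan_constraints a =
     {laurent_var_power (i, j) 1 * laurent_var_power (j, i) 1 - laurent_var_power (i, i) (a i j) | i j. True}"

definition vanishing_ideal :: "('i \<Rightarrow> 'i \<Rightarrow> 'k::field_char_0) \<Rightarrow> ('i \<times> 'i) laurent_poly set" where
  "vanishing_ideal q = {p. laurent_eval (\<lambda>(i, j). q i j) p = 0}"

text \<open>
  The \<open>q i j\<close> are indeterminates over the rationals subject (only) to
  \<open>q i j * q j i = q i i powi a i j\<close>: they satisfy these equations, and the prime ideal of all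
  algebraic relations among them is minimal among the prime ideals containing the constraints.
  If the constraints generate a prime ideal, this says that the algebraic relations among the
  \<open>q i j\<close> are exactly the consequences of the constraints, i.e. that the subfield generated by
  the \<open>q i j\<close> is the fraction field of the Laurent polynomial ring modulo the constraints.
  For some Cartan matrices that ideal is not prime (the constraints entail
  \<open>q i i powi a i j = q j j powi a j i\<close>, which factors e.g. when both exponents are \<open>-2\<close>); the
  family \<open>q\<close> is then a generic point of any one of the irreducible components.
\<close>

definition indeterminates_subject_to_cartan ::
  "('i \<Rightarrow> 'i \<Rightarrow> int) \<Rightarrow> ('i \<Rightarrow> 'i \<Rightarrow> 'k::field_char_0) \<Rightarrow> bool" where
  "indeterminates_subject_to_cartan a q \<longleftrightarrow>
     (\<forall>i j. q i j \<noteq> 0) \<and>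
     (\<forall>i j. q i j * q j i = q i i powi a i j) \<and>
     (\<forall>P. primeideal P ring_of_type_algebra \<and> cartan_constraints a \<subseteq> P \<and> P \<subseteq> vanishing_ideal q
        \<longrightarrow> P = vanishing_ideal q)"


section \<open>Quantum integers\<close>

text \<open>Only used for \<open>v \<noteq> 1\<close> (not a root of unity).\<close>

definition qint :: "'k::field \<Rightarrow> nat \<Rightarrow> 'k" where
  "qint v n = (v ^ n - 1) / (v - 1)"

definition qfact :: "'k::field \<Rightarrow> nat \<Rightarrow> 'k" where
  "qfact v n = (\<Prod>m = 1..n. qint v m)"

definition qbinom :: "'k::field \<Rightarrow> nat \<Rightarrow> nat \<Rightarrow> 'k" where
  "qbinom v n k = qfact v n / (qfact v k * qfact v (n - k))"


section \<open>Free associative algebras\<close>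

text \<open>
  The free monoid, written additively: with exponents in this monoid, \<open>poly_mapping\<close> is the
  monoid algebra of the free monoid, i.e. the free associative unital algebra.
\<close>

datatype 'g word = Word "'g list"

instantiation word :: (type) monoid_add
begin

definition zero_word :: "'a word" where
  "0 = Word []"

fun plus_word :: "'a word \<Rightarrow> 'a word \<Rightarrow> 'a word" where
  "Word xs + Word ys = Word (xs @ ys)"

instance
proof
  fix x y z :: "'a word"
  show "x + y + z = x + (y + z)" by (cases x; cases y; cases z) simp
  show "0 + x = x" by (cases x) (simp add: zero_word_def)
  show "x + 0 = x" by (cases x) (simp add: zero_word_def)
qed

end

type_synonym ('g, 'k) free_alg = "'g word \<Rightarrow>\<^sub>0 'k"

definition gen :: "'g \<Rightarrow> ('g, 'k::ring_1) free_alg" where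
  "gen x = Poly_Mapping.single (Word [x]) 1"

definition scalar :: "'k::ring_1 \<Rightarrow> ('g, 'k) free_alg" where
  "scalar c = Poly_Mapping.single 0 c"


section \<open>The multi-parameter quantum group\<close>

datatype 'i generator = E 'i | F 'i | \<Omega> 'i | \<Omega>inv 'i | \<Omega>' 'i | \<Omega>'inv 'i

abbreviation "ee i \<equiv> gen (E i)"
abbreviation "ff i \<equiv> gen (F i)"
abbreviation "\<omega> i \<equiv> gen (\<Omega> i)"
abbreviation "\<omega>inv i \<equiv> gen (\<Omega>inv i)"
abbreviation "\<omega>' i \<equiv> gen (\<Omega>' i)"
abbreviation "\<omega>'inv i \<equiv> gen (\<Omega>'inv i)"

definition torus_generators :: "'i generator set" where
  "torus_generators = range \<Omega> \<union> range \<Omega>inv \<union> range \<Omega>' \<union> range \<Omega>'inv"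

definition serre_coeff :: "('i \<Rightarrow> 'i \<Rightarrow> int) \<Rightarrow> ('i \<Rightarrow> 'i \<Rightarrow> 'k::field) \<Rightarrow> 'i \<Rightarrow> 'i \<Rightarrow> nat \<Rightarrow> 'k" where
  "serre_coeff a q i j k =
     (-1) ^ k * qbinom (q i i) (nat (1 - a i j)) k * q i i ^ (k * (k - 1) div 2) * q i j ^ k"

definition serre_e ::
  "('i \<Rightarrow> 'i \<Rightarrow> int) \<Rightarrow> ('i \<Rightarrow> 'i \<Rightarrow> 'k::field) \<Rightarrow> 'i \<Rightarrow> 'i \<Rightarrow> ('i generator, 'k) free_alg" where
  "serre_e a q i j =
     (\<Sum>k = 0..nat (1 - a i j).
        scalar (serre_coeff a q i j k) * ee i ^ (nat (1 - a i j) - k) * ee j * ee i ^ k)"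

definition serre_f ::
  "('i \<Rightarrow> 'i \<Rightarrow> int) \<Rightarrow> ('i \<Rightarrow> 'i \<Rightarrow> 'k::field) \<Rightarrow> 'i \<Rightarrow> 'i \<Rightarrow> ('i generator, 'k) free_alg" where
  "serre_f a q i j =
     (\<Sum>k = 0..nat (1 - a i j).
        scalar (serre_coeff a q i j k) * ff i ^ k * ff j * ff i ^ (nat (1 - a i j) - k))"

text \<open>Each defining relation \<open>l = r\<close> is recorded as the element \<open>l - r\<close> of the free algebra.\<close>

definition Uq_relators ::
  "('i \<Rightarrow> 'i \<Rightarrow> int) \<Rightarrow> ('i \<Rightarrow> 'i \<Rightarrow> 'k::field) \<Rightarrow> ('i generator, 'k) free_alg set" where
  "Uq_relators a q =
     {gen x * gen y - gen y * gen x | x y. x \<in> torus_generators \<and> y \<in> torus_generators} \<union>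
     {\<omega> i * \<omega>inv i - 1 | i. True} \<union>
     {\<omega>' i * \<omega>'inv i - 1 | i. True} \<union>
     {\<omega> i * ee j * \<omega>inv i - scalar (q i j) * ee j | i j. True} \<union>
     {\<omega>' i * ee j * \<omega>'inv i - scalar (inverse (q j i)) * ee j | i j. True} \<union>
     {\<omega> i * ff j * \<omega>inv i - scalar (inverse (q i j)) * ff j | i j. True} \<union>
     {\<omega>' i * ff j * \<omega>'inv i - scalar (q j i) * ff j | i j. True} \<union>
     {ee i * ff j - ff j * ee i
        - (if i = j then scalar (q i i / (q i i - 1)) * (\<omega> i - \<omega>' i) else 0) | i j. True} \<union>
     {serre_e a q i j | i j. i \<noteq> j} \<union>
     {serre_f a q i j | i j. i \<noteq> j}"

definition Uq_ideal ::
  "('i \<Rightarrow> 'i \<Rightarrow> int) \<Rightarrow> ('i \<Rightarrow> 'i \<Rightarrow> 'k::field) \<Rightarrow> ('i generator, 'k) free_alg set" where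
  "Uq_ideal a q = Idl\<^bsub>ring_of_type_algebra\<^esub> (Uq_relators a q)"

definition Uq_class ::
  "('i \<Rightarrow> 'i \<Rightarrow> int) \<Rightarrow> ('i \<Rightarrow> 'i \<Rightarrow> 'k::field) \<Rightarrow> ('i generator, 'k) free_alg \<Rightarrow> ('i generator, 'k) free_alg set"
  where "Uq_class a q x = Uq_ideal a q +>\<^bsub>ring_of_type_algebra\<^esub> x"

text \<open>
  The record type \<open>('k, 'a) module\<close> carries both a ring structure and a scalar multiplication, so
  it serves for (noncommutative) algebras over the field \<open>'k\<close>.
\<close>

definition Uq ::
  "('i \<Rightarrow> 'i \<Rightarrow> int) \<Rightarrow> ('i \<Rightarrow> 'i \<Rightarrow> 'k::field) \<Rightarrow> ('k, ('i generator, 'k) free_alg set) module" where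
  "Uq a q =
     (let Q = ring_of_type_algebra Quot Uq_ideal a q
      in ring.extend Q (module.fields (\<lambda>c u. Uq_class a q (scalar c) \<otimes>\<^bsub>Q\<^esub> u)))"

definition generated_subalgebra :: "('k, 'a, 'm) module_scheme \<Rightarrow> 'a set \<Rightarrow> 'a set" where
  "generated_subalgebra A S =
     \<Inter> {V. subring V A \<and> (\<forall>c. \<forall>x\<in>V. c \<odot>\<^bsub>A\<^esub> x \<in> V) \<and> S \<subseteq> V}"

definition Uq_subalgebra ::
  "('i \<Rightarrow> 'i \<Rightarrow> int) \<Rightarrow> ('i \<Rightarrow> 'i \<Rightarrow> 'k::field) \<Rightarrow> 'i generator set \<Rightarrow> ('k, ('i generator, 'k) free_alg set) module"
  where
  "Uq_subalgebra a q G =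
     (Uq a q)\<lparr>carrier := generated_subalgebra (Uq a q) ((\<lambda>x. Uq_class a q (gen x)) ` G)\<rparr>"

definition "Uq_plus a q = Uq_subalgebra a q (range E)"
definition "Uq_minus a q = Uq_subalgebra a q (range F)"
definition "Uq_zero a q = Uq_subalgebra a q torus_generators"


section \<open>Tensor products of vector spaces\<close>

text \<open>
  The tensor product is the free vector space on \<open>carrier M \<times> carrier N\<close> modulo the subspace
  spanned by the bilinearity relators; its elements are cosets of that subspace.
  The ring multiplication fields of the resulting record are irrelevant and left unspecified.
\<close>

definition fscale :: "'k::field \<Rightarrow> ('x \<Rightarrow>\<^sub>0 'k) \<Rightarrow> ('x \<Rightarrow>\<^sub>0 'k)" where
  "fscale c = Poly_Mapping.map ((*) c)"

definition tensor_relators ::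
  "('k::field, 'a, 'm) module_scheme \<Rightarrow> ('k, 'b, 'n) module_scheme \<Rightarrow> ('a \<times> 'b \<Rightarrow>\<^sub>0 'k) set" where
  "tensor_relators M N =
     (let t = (\<lambda>x y. Poly_Mapping.single (x, y) (1::'k)) in
     {t (x \<oplus>\<^bsub>M\<^esub> x') y - (t x y + t x' y) | x x' y. x \<in> carrier M \<and> x' \<in> carrier M \<and> y \<in> carrier N} \<union>
     {t x (y \<oplus>\<^bsub>N\<^esub> y') - (t x y + t x y') | x y y'. x \<in> carrier M \<and> y \<in> carrier N \<and> y' \<in> carrier N} \<union>
     {t (c \<odot>\<^bsub>M\<^esub> x) y - fscale c (t x y) | c x y. x \<in> carrier M \<and> y \<in> carrier N} \<union>
     {t x (c \<odot>\<^bsub>N\<^esub> y) - fscale c (t x y) | c x y. x \<in> carrier M \<and> y \<in> carrier N})"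

definition tensor_class ::
  "('k::field, 'a, 'm) module_scheme \<Rightarrow> ('k, 'b, 'n) module_scheme \<Rightarrow> ('a \<times> 'b \<Rightarrow>\<^sub>0 'k) \<Rightarrow> ('a \<times> 'b \<Rightarrow>\<^sub>0 'k) set"
  where "tensor_class M N p = (+) p ` module.span fscale (tensor_relators M N)"

definition tensor_product ::
  "('k::field, 'a, 'm) module_scheme \<Rightarrow> ('k, 'b, 'n) module_scheme \<Rightarrow> ('k, ('a \<times> 'b \<Rightarrow>\<^sub>0 'k) set) module"
  where
  "tensor_product M N =
     \<lparr>carrier = tensor_class M N ` {p. Poly_Mapping.keys p \<subseteq> carrier M \<times> carrier N},
      monoid.mult = undefined, one = undefined,
      zero = tensor_class M N 0,
      add = (\<lambda>u v. \<Union>x\<in>u. \<Union>y\<in>v. tensor_class M N (x + y)),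
      module.smult = (\<lambda>c u. \<Union>x\<in>u. tensor_class M N (fscale c x))\<rparr>"

definition pure_tensor ::
  "('k::field, 'a, 'm) module_scheme \<Rightarrow> ('k, 'b, 'n) module_scheme \<Rightarrow> 'a \<Rightarrow> 'b \<Rightarrow> ('a \<times> 'b \<Rightarrow>\<^sub>0 'k) set" where
  "pure_tensor M N x y = tensor_class M N (Poly_Mapping.single (x, y) 1)"

definition linear_maps ::
  "('k, 'a, 'm) module_scheme \<Rightarrow> ('k, 'b, 'n) module_scheme \<Rightarrow> ('a \<Rightarrow> 'b) set" where
  "linear_maps M N =
     {\<phi> \<in> carrier M \<rightarrow> carrier N.
        (\<forall>x\<in>carrier M. \<forall>y\<in>carrier M. \<phi> (x \<oplus>\<^bsub>M\<^esub> y) = \<phi> x \<oplus>\<^bsub>N\<^esub> \<phi> y) \<and>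
        (\<forall>c. \<forall>x\<in>carrier M. \<phi> (c \<odot>\<^bsub>M\<^esub> x) = c \<odot>\<^bsub>N\<^esub> \<phi> x)}"

definition vector_space_isos ::
  "('k, 'a, 'm) module_scheme \<Rightarrow> ('k, 'b, 'n) module_scheme \<Rightarrow> ('a \<Rightarrow> 'b) set" where
  "vector_space_isos M N = {\<phi> \<in> linear_maps M N. bij_betw \<phi> (carrier M) (carrier N)}"

text \<open>
  As the pure tensors span, this determines \<open>\<phi>\<close> on the carrier of \<open>(L \<otimes> M) \<otimes> N\<close>.
\<close>

definition is_multiplication_map ::
  "('k::field, 'a, 'm) module_scheme \<Rightarrow> ('k, 'a, 'x) module_scheme \<Rightarrow> ('k, 'a, 'y) module_scheme
     \<Rightarrow> ('k, 'a, 'z) module_scheme \<Rightarrow> ((('a \<times> 'a \<Rightarrow>\<^sub>0 'k) set \<times> 'a \<Rightarrow>\<^sub>0 'k) set \<Rightarrow> 'a) \<Rightarrow> bool" where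
  "is_multiplication_map A L M N \<phi> \<longleftrightarrow>
     \<phi> \<in> linear_maps (tensor_product (tensor_product L M) N) A \<and>
     (\<forall>x\<in>carrier L. \<forall>y\<in>carrier M. \<forall>z\<in>carrier N.
        \<phi> (pure_tensor (tensor_product L M) N (pure_tensor L M x y) z) = x \<otimes>\<^bsub>A\<^esub> y \<otimes>\<^bsub>A\<^esub> z)"

end

theory Submission
  imports Defs
begin

text \<open>
  Normally ordered words \<open>f\<^sub>x t e\<^sub>z\<close> span the algebra, so multiplication is surjective. For injectivity, let
  the algebra without Serre relations act on the free vector space on symbols \<open>f\<^sub>x t e\<^sub>z\<close>, by the formulas
  that express left multiplication by a generator in normally ordered form. The Serre elements in the
  \<open>e\<^sub>i\<close> commute with every \<open>f\<^sub>l\<close>, and those in the \<open>f\<^sub>i\<close> with every \<open>e\<^sub>l\<close>, so the subspace spanned by all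
  \<open>f\<^sub>u S f\<^sub>x t e\<^sub>z\<close> and \<open>f\<^sub>x t e\<^sub>u S e\<^sub>z\<close> with \<open>S\<close> a Serre element is stable, and the defining ideal maps
  the whole space into it. A normally ordered element of the ideal, applied to \<open>1\<close>, therefore lies
  in this subspace, which is zero in the tensor product.
\<close>

section \<open>Linear extension and the free algebra\<close>

text \<open>The two halves come without explicit bases, so linear independence of normally ordered
  elements cannot be checked directly. Nothing is therefore divided out on the side of the action:
  keys carry free words \<open>x\<close> and \<open>z\<close>, the Serre relations enter only
  through the subspace \<open>serre_sub\<close>, and all comparisons are made modulo
  \<open>J\<close> or modulo the tensor relators. Injectivity becomes a statement about one
  coefficient family \<open>w\<close>: if the normal words combine under \<open>w\<close> to an
  element of \<open>J\<close>, then the matching triples combine under \<open>w\<close> to a tensor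
  relation (\<open>triple_word_kernel\<close>).

  The weights \<open>c\<close> are stored beside the exponents \<open>d\<close> because
  \<open>d\<close> ranges over all functions; a torus generator multiplies \<open>c\<close> by its
  own weight, and no product has to be extracted from \<open>d\<close>.

  The Serre coefficients matter at one point only, the commutation with the opposite half. With N =
  -a_ij a Serre element is an (N+1)-fold skew commutator, and q_ij q_ji q_ii^N = 1 makes the
  decisive coefficient of its commutator with a generator of the other half vanish.\<close>

lemma lookup_fscale [simp]: "Poly_Mapping.lookup (fscale c p) x = c * Poly_Mapping.lookup p x"
  unfolding fscale_def by (simp add: Poly_Mapping.map.rep_eq when_def)

interpretation pm: vector_space fscale
  by unfold_locales (auto intro!: poly_mapping_eqI simp: lookup_add algebra_simps)

lemma fscale_single [simp]: "fscale c (Poly_Mapping.single x d) = Poly_Mapping.single x (c * d)"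
  by (rule poly_mapping_eqI) (auto simp: lookup_single when_def)

abbreviation lin :: "(('x \<Rightarrow>\<^sub>0 'k::field) \<Rightarrow> ('y \<Rightarrow>\<^sub>0 'k)) \<Rightarrow> bool" where
  "lin \<equiv> Vector_Spaces.linear fscale fscale"

interpretation pp: vector_space_pair fscale fscale ..

lemma linI:
  assumes "\<And>x y. f (x + y) = f x + f y" "\<And>c x. f (fscale c x) = fscale c (f x)"
  shows "lin f"
  using assms by (auto simp: Vector_Spaces.linear_iff pm.vector_space_axioms)

definition pm_ext :: "('x \<Rightarrow> ('y \<Rightarrow>\<^sub>0 'k)) \<Rightarrow> ('x \<Rightarrow>\<^sub>0 'k::field) \<Rightarrow> ('y \<Rightarrow>\<^sub>0 'k)" where
  "pm_ext g p = (\<Sum>m\<in>Poly_Mapping.keys p. fscale (Poly_Mapping.lookup p m) (g m))"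

text \<open>Additivity of \<open>pm_ext\<close> needs a common finite index set, since cancellation
  can make \<open>keys (p + r)\<close> smaller than the union of the supports.\<close>

lemma pm_ext_superset:
  assumes "finite A" "Poly_Mapping.keys p \<subseteq> A"
  shows "pm_ext g p = (\<Sum>m\<in>A. fscale (Poly_Mapping.lookup p m) (g m))"
  unfolding pm_ext_def
  by (rule sum.mono_neutral_left) (use assms in \<open>auto simp: in_keys_iff\<close>)

lemma lin_pm_ext: "lin (pm_ext (g :: 'x \<Rightarrow> ('y \<Rightarrow>\<^sub>0 'k::field)))"
proof (rule linI)
  fix p r :: "'x \<Rightarrow>\<^sub>0 'k" and c :: 'k
  let ?A = "Poly_Mapping.keys p \<union> Poly_Mapping.keys r"
  show "pm_ext g (p + r) = pm_ext g p + pm_ext g r"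
    using pm_ext_superset[of ?A "p + r" g] pm_ext_superset[of ?A p g] pm_ext_superset[of ?A r g]
      Poly_Mapping.keys_add[of p r]
    by (simp add: lookup_add pm.scale_left_distrib sum.distrib)
  have "Poly_Mapping.keys (fscale c p) \<subseteq> Poly_Mapping.keys p"
    by (auto simp: in_keys_iff)
  then show "pm_ext g (fscale c p) = fscale c (pm_ext g p)"
    using pm_ext_superset[of "Poly_Mapping.keys p" "fscale c p" g]
    by (simp add: pm_ext_def pm.scale_sum_right)
qed

lemma pm_ext_single [simp]: "pm_ext g (Poly_Mapping.single x c) = fscale c (g x)"
  using pm_ext_superset[of "{x}" "Poly_Mapping.single x c" g] by simp

lemmas pm_ext_simps [simp] = pp.linear_add[OF lin_pm_ext] pp.linear_scale[OF lin_pm_ext]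
  pp.linear_0[OF lin_pm_ext] pp.linear_diff[OF lin_pm_ext] pp.linear_sum[OF lin_pm_ext]

lemma pm_expand: "p = (\<Sum>m\<in>Poly_Mapping.keys p. Poly_Mapping.single m (Poly_Mapping.lookup p m))"
  by (rule poly_mapping_eqI) (simp add: lookup_sum lookup_single when_def in_keys_iff)

lemma pm_subspace_mem:
  assumes "pm.subspace S" "\<And>x. x \<in> Poly_Mapping.keys p \<Longrightarrow> Poly_Mapping.single x 1 \<in> S"
  shows "p \<in> S"
proof -
  have "Poly_Mapping.single m (Poly_Mapping.lookup p m) \<in> S" if "m \<in> Poly_Mapping.keys p" for m
    using pm.subspace_scale[OF assms(1) assms(2)[OF that], of "Poly_Mapping.lookup p m"] by simp
  then show ?thesis
    using pm.subspace_sum[OF assms(1), of "Poly_Mapping.keys p"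
        "\<lambda>m. Poly_Mapping.single m (Poly_Mapping.lookup p m)"] pm_expand[of p] by simp
qed

lemma lin_preimage_subspace: "lin f \<Longrightarrow> pm.subspace S \<Longrightarrow> pm.subspace {x. f x \<in> S}"
  by (auto simp: pm.subspace_def pp.linear_add pp.linear_scale pp.linear_0)

lemma lin_mem:
  assumes "lin f" "pm.subspace S"
    and "\<And>x. x \<in> Poly_Mapping.keys p \<Longrightarrow> f (Poly_Mapping.single x 1) \<in> S"
  shows "f p \<in> S"
  using pm_subspace_mem[OF lin_preimage_subspace[OF assms(1,2)], of p] assms(3) by auto

lemma lin_span_mem:
  assumes "lin f" "pm.subspace S" "\<And>x. x \<in> G \<Longrightarrow> f x \<in> S" "p \<in> pm.span G"
  shows "f p \<in> S"
  using pm.span_minimal[OF _ lin_preimage_subspace[OF assms(1,2)], of G] assms(3,4) by auto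

lemma lin_diff: "lin f \<Longrightarrow> lin g \<Longrightarrow> lin (\<lambda>x. f x - g x)"
  by (intro linI) (simp_all add: pp.linear_add pp.linear_scale pm.scale_right_diff_distrib)

lemma lin_id: "lin (\<lambda>x. x)"
  by (intro linI) simp_all

text \<open>Agreement is asked for on the support of \<open>p\<close> only;
  \<open>triple_word_kernel\<close> relies on this, its identity being proved on normal
  keys.\<close>

lemma lin_eqI:
  assumes "lin f" "lin g" 
    and "\<And>x. x \<in> Poly_Mapping.keys p \<Longrightarrow> f (Poly_Mapping.single x 1) = g (Poly_Mapping.single x 1)"
  shows "f p = g p"
  using lin_mem[OF lin_diff[OF assms(1,2)] pm.subspace_single_0, of p] assms(3) by simp

lemma lin_comp: "lin f \<Longrightarrow> lin g \<Longrightarrow> lin (\<lambda>x. f (g x))"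
  by (intro linI) (simp_all add: pp.linear_add pp.linear_scale)

section \<open>Words and scalars in the free algebra\<close>

definition wd :: "'g list \<Rightarrow> ('g, 'k::ring_1) free_alg" where
  "wd xs = Poly_Mapping.single (Word xs) 1"

lemma wd_mult: "wd xs * wd ys = wd (xs @ ys)"
  by (simp add: wd_def mult_single)

lemma wd_Nil: "wd [] = 1"
  by (simp add: wd_def single_one flip: zero_word_def)

lemma gen_eq_wd: "gen x = wd [x]"
  by (simp add: gen_def wd_def)

lemma wd_Cons: "wd (x # xs) = gen x * wd xs"
  by (simp add: gen_eq_wd wd_mult)

lemma gen_power: "gen x ^ n = wd (replicate n x)"
  by (induction n) (simp_all add: wd_Nil wd_Cons)

lemma scalar_mult_single: "scalar c * Poly_Mapping.single x d = Poly_Mapping.single x (c * d)"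
  by (simp add: scalar_def mult_single)

lemma single_mult_scalar: "Poly_Mapping.single x d * scalar c = Poly_Mapping.single x (d * c)"
  by (simp add: scalar_def mult_single)

lemma scalar_mult: "scalar (c::'k::field) * p = fscale c p"
proof -
  have "scalar c * p
      = (\<Sum>m\<in>Poly_Mapping.keys p. scalar c * Poly_Mapping.single m (Poly_Mapping.lookup p m))"
    by (subst (1) pm_expand[of p]) (simp only: sum_distrib_left)
  also have "\<dots> = fscale c (\<Sum>m\<in>Poly_Mapping.keys p. Poly_Mapping.single m (Poly_Mapping.lookup p m))"
    by (simp only: scalar_mult_single pm.scale_sum_right fscale_single)
  finally show ?thesis by (simp only: pm_expand[symmetric])
qed

lemma mult_scalar: "p * scalar (c::'k::field) = fscale c p"
proof -
  have "p * scalar c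
      = (\<Sum>m\<in>Poly_Mapping.keys p. Poly_Mapping.single m (Poly_Mapping.lookup p m) * scalar c)"
    by (subst (1) pm_expand[of p]) (simp only: sum_distrib_right)
  also have "\<dots> = fscale c (\<Sum>m\<in>Poly_Mapping.keys p. Poly_Mapping.single m (Poly_Mapping.lookup p m))"
    by (simp only: single_mult_scalar pm.scale_sum_right fscale_single mult.commute)
  finally show ?thesis by (simp only: pm_expand[symmetric])
qed

lemma fscale_mult:
  "fscale c p * r = fscale c (p * r)" "p * fscale c r = fscale c (p * r)"
  for p r :: "('g, 'k::field) free_alg"
  by (metis scalar_mult mult.assoc, metis mult_scalar mult.assoc)

lemma lin_times_left: "lin (\<lambda>p. r * p :: ('g, 'k::field) free_alg)"
  by (intro linI) (simp_all add: distrib_left fscale_mult)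

lemma lin_times_right: "lin (\<lambda>p. p * r :: ('g, 'k::field) free_alg)"
  by (intro linI) (simp_all add: distrib_right fscale_mult)

definition words_span :: "'g set \<Rightarrow> ('g, 'k::field) free_alg set" where
  "words_span G = pm.span (wd ` lists G)"

lemma words_span_subspace: "pm.subspace (words_span G)"
  by (simp add: words_span_def)

lemma wd_in_words_span: "set xs \<subseteq> G \<Longrightarrow> wd xs \<in> words_span G"
  by (auto simp: words_span_def in_lists_conv_set intro!: pm.span_base)

lemma words_span_mult:
  assumes "p \<in> words_span G" "r \<in> words_span G"
  shows "p * r \<in> words_span G"
proof -
  have "wd xs * r \<in> words_span G" if "xs \<in> lists G" for xs
    by (rule lin_span_mem[OF lin_times_left words_span_subspace _ assms(2)[unfolded words_span_def]])
      (use that in \<open>auto simp: wd_mult in_lists_conv_set intro!: wd_in_words_span\<close>)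
  then show ?thesis
    by (intro lin_span_mem[OF lin_times_right words_span_subspace _ assms(1)[unfolded words_span_def]]) auto
qed

section \<open>The algebra of linear endomorphisms\<close>

text \<open>A type instead of a set of functions: with its \<open>ring_1\<close> instance, operator
  identities become ring identities, and the skew commutator lemmas for abstract rings apply to
  operators.\<close>

typedef (overloaded) ('x, 'k::field) lin_end = "{f :: ('x \<Rightarrow>\<^sub>0 'k) \<Rightarrow> ('x \<Rightarrow>\<^sub>0 'k). lin f}"
  morphisms app Lin_end
  using lin_id by auto

setup_lifting type_definition_lin_end

lemma lin_app: "lin (app A)"
  using app by auto

instantiation lin_end :: (type, field) ring_1
begin

lift_definition zero_lin_end :: "('a, 'b) lin_end" is "\<lambda>x. 0"
  by (rule linI) simp_all
lift_definition one_lin_end :: "('a, 'b) lin_end" is "\<lambda>x. x"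
  by (rule lin_id)
lift_definition plus_lin_end :: "('a, 'b) lin_end \<Rightarrow> ('a, 'b) lin_end \<Rightarrow> ('a, 'b) lin_end"
  is "\<lambda>f g x. f x + g x"
  by (rule linI) (simp_all add: pp.linear_add pp.linear_scale pm.scale_right_distrib)
lift_definition minus_lin_end :: "('a, 'b) lin_end \<Rightarrow> ('a, 'b) lin_end \<Rightarrow> ('a, 'b) lin_end"
  is "\<lambda>f g x. f x - g x"
  by (rule lin_diff)
lift_definition uminus_lin_end :: "('a, 'b) lin_end \<Rightarrow> ('a, 'b) lin_end"
  is "\<lambda>f x. - f x"
  by (rule linI) (simp_all add: pp.linear_add pp.linear_scale)
lift_definition times_lin_end :: "('a, 'b) lin_end \<Rightarrow> ('a, 'b) lin_end \<Rightarrow> ('a, 'b) lin_end"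
  is "\<lambda>f g x. f (g x)"
  by (rule lin_comp)

instance
proof
  show "(0 :: ('a, 'b) lin_end) \<noteq> 1"
  proof
    assume "(0 :: ('a, 'b) lin_end) = 1"
    then have "app (0 :: ('a, 'b) lin_end) (Poly_Mapping.single undefined 1)
      = app 1 (Poly_Mapping.single undefined 1)" by simp
    then have "Poly_Mapping.single undefined (1::'b) = (0 :: 'a \<Rightarrow>\<^sub>0 'b)"
      by (simp add: zero_lin_end.rep_eq one_lin_end.rep_eq)
    then have "Poly_Mapping.lookup (Poly_Mapping.single undefined (1::'b)) (undefined::'a) = 0"
      by (simp only: lookup_zero)
    then show False by simp
  qed
qed (transfer; simp add: pp.linear_add fun_eq_iff algebra_simps; fail)+

end

lift_definition sc :: "'k::field \<Rightarrow> ('x, 'k) lin_end" is "\<lambda>c. fscale c"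
  by (rule pm.linear_scale_self)

lift_definition lin_ext :: "('x \<Rightarrow> ('x \<Rightarrow>\<^sub>0 'k::field)) \<Rightarrow> ('x, 'k) lin_end" is "\<lambda>g. pm_ext g"
  by (rule lin_pm_ext)

lemmas app_simps [simp] = zero_lin_end.rep_eq one_lin_end.rep_eq plus_lin_end.rep_eq
  minus_lin_end.rep_eq uminus_lin_end.rep_eq times_lin_end.rep_eq sc.rep_eq lin_ext.rep_eq
  pp.linear_add[OF lin_app] pp.linear_scale[OF lin_app]
  pp.linear_0[OF lin_app] pp.linear_diff[OF lin_app] pp.linear_sum[OF lin_app]

lemma lin_end_eqI:
  assumes "\<And>x. app A (Poly_Mapping.single x 1) = app B (Poly_Mapping.single x 1)"
  shows "A = B"
  by (rule app_inject[THEN iffD1], rule ext, rule lin_eqI[OF lin_app lin_app assms])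

lemma app_sum: "app (sum A I) w = (\<Sum>i\<in>I. app (A i) w)"
  by (induction I rule: infinite_finite_induct) simp_all

lemma sc_hom: "sc 0 = 0" "sc 1 = 1" "sc (c + d) = sc c + sc d" "sc (c * d) = sc c * sc d"
  by (rule lin_end_eqI, simp add: single_add)+

lemma sc_central: "sc c * A = A * sc c"
  by (rule lin_end_eqI) simp

section \<open>Homomorphisms from the free algebra to endomorphisms\<close>

definition word_op :: "('g \<Rightarrow> ('x, 'k::field) lin_end) \<Rightarrow> 'g word \<Rightarrow> ('x, 'k) lin_end" where
  "word_op \<phi> u = (case u of Word xs \<Rightarrow> prod_list (map \<phi> xs))"

lemma word_op_add: "word_op \<phi> (u + v) = word_op \<phi> u * word_op \<phi> v"
  by (cases u; cases v) (simp add: word_op_def)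

text \<open>The universal property of the free algebra. It is defined vector by vector because
  \<open>pm_ext\<close> takes values in free vector spaces, not in \<open>lin_end\<close>.\<close>

definition alg_ext :: "('g \<Rightarrow> ('x, 'k::field) lin_end) \<Rightarrow> ('g, 'k) free_alg \<Rightarrow> ('x, 'k) lin_end" where
  "alg_ext \<phi> p = Lin_end (\<lambda>w. pm_ext (\<lambda>u. app (word_op \<phi> u) w) p)"

lemma app_alg_ext: "app (alg_ext \<phi> p) w = pm_ext (\<lambda>u. app (word_op \<phi> u) w) p"
proof -
  have "lin (\<lambda>w. pm_ext (\<lambda>u. app (word_op \<phi> u) w) p)"
    by (rule linI) (simp_all add: pm_ext_def pm.scale_right_distrib sum.distrib pm.scale_sum_right
        mult.commute)
  then show ?thesis by (simp add: alg_ext_def Lin_end_inverse)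
qed

lemma lin_alg_ext: "lin (\<lambda>p. app (alg_ext \<phi> p) w)"
  by (simp add: app_alg_ext lin_pm_ext)

lemma alg_ext_wd: "alg_ext \<phi> (wd xs) = prod_list (map \<phi> xs)"
  by (rule lin_end_eqI) (simp add: app_alg_ext wd_def word_op_def)

lemma alg_ext_add: "alg_ext \<phi> (p + r) = alg_ext \<phi> p + alg_ext \<phi> r"
  by (rule lin_end_eqI) (simp add: app_alg_ext)

lemma alg_ext_diff: "alg_ext \<phi> (p - r) = alg_ext \<phi> p - alg_ext \<phi> r"
  by (rule lin_end_eqI) (simp add: app_alg_ext)

lemma alg_ext_0: "alg_ext \<phi> 0 = 0"
  by (rule lin_end_eqI) (simp add: app_alg_ext)

lemma alg_ext_sum: "alg_ext \<phi> (sum p I) = (\<Sum>i\<in>I. alg_ext \<phi> (p i))"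
  by (induction I rule: infinite_finite_induct) (simp_all add: alg_ext_0 alg_ext_add)

lemma alg_ext_fscale: "alg_ext \<phi> (fscale c p) = sc c * alg_ext \<phi> p"
  by (rule lin_end_eqI) (simp add: app_alg_ext)

lemma alg_ext_mult:
  fixes \<phi> :: "'g \<Rightarrow> ('x, 'k::field) lin_end"
  shows "alg_ext \<phi> (p * r) = alg_ext \<phi> p * alg_ext \<phi> r"
proof (rule lin_end_eqI)
  fix x :: 'x
  let ?w = "Poly_Mapping.single x 1 :: 'x \<Rightarrow>\<^sub>0 'k"
  have 1: "app (alg_ext \<phi> (Poly_Mapping.single u 1 * r)) ?w
    = app (alg_ext \<phi> (Poly_Mapping.single u 1)) (app (alg_ext \<phi> r) ?w)" for u
  proof (rule lin_eqI[where p = r])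
    show "lin (\<lambda>r. app (alg_ext \<phi> (Poly_Mapping.single u 1 * r)) ?w)"
      by (rule lin_comp[OF lin_alg_ext lin_times_left])
    show "lin (\<lambda>r. app (alg_ext \<phi> (Poly_Mapping.single u 1)) (app (alg_ext \<phi> r) ?w))"
      by (rule lin_comp[OF lin_app lin_alg_ext])
  qed (simp add: app_alg_ext mult_single word_op_add)
  show "app (alg_ext \<phi> (p * r)) ?w = app (alg_ext \<phi> p * alg_ext \<phi> r) ?w"
    unfolding app_simps
  proof (rule lin_eqI[where p = p])
    show "lin (\<lambda>p. app (alg_ext \<phi> (p * r)) ?w)"
      by (rule lin_comp[OF lin_alg_ext lin_times_right])
  qed (simp_all add: 1 lin_alg_ext)
qed

lemma alg_ext_1: "alg_ext \<phi> 1 = 1"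
  using alg_ext_wd[of \<phi> "[]"] by (simp add: wd_Nil)

lemma alg_ext_gen: "alg_ext \<phi> (gen x) = \<phi> x"
  using alg_ext_wd[of \<phi> "[x]"] by (simp add: gen_eq_wd)

lemma alg_ext_scalar: "alg_ext \<phi> (scalar c) = sc c"
  using alg_ext_fscale[of \<phi> c 1] by (metis alg_ext_1 mult.right_neutral scalar_mult)

lemma alg_ext_power: "alg_ext \<phi> (p ^ n) = alg_ext \<phi> p ^ n"
  by (induction n) (simp_all add: alg_ext_1 alg_ext_mult)

section \<open>Serre elements as iterated skew commutators\<close>

lemma qint_nonzero: "(\<And>n. n > 0 \<Longrightarrow> v ^ n \<noteq> 1) \<Longrightarrow> n > 0 \<Longrightarrow> qint v n \<noteq> (0::'k::field)"
  using power_one_right[of v] by (force simp: qint_def)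

lemma qfact_nonzero: "(\<And>n. n > 0 \<Longrightarrow> v ^ n \<noteq> 1) \<Longrightarrow> qfact v n \<noteq> (0::'k::field)"
  by (auto simp: qfact_def qint_nonzero)

lemma qfact_Suc: "qfact v (Suc n) = qint v (Suc n) * qfact v n"
  by (simp add: qfact_def prod.nat_ivl_Suc' mult.commute)

lemma qbinom_0 [simp]: "(\<And>n. n > 0 \<Longrightarrow> v ^ n \<noteq> 1) \<Longrightarrow> qbinom v n 0 = (1::'k::field)"
  and qbinom_self [simp]: "(\<And>n. n > 0 \<Longrightarrow> v ^ n \<noteq> 1) \<Longrightarrow> qbinom v n n = (1::'k::field)"
  using qfact_nonzero[of v n] by (auto simp: qbinom_def) (simp_all add: qfact_def)

text \<open>The q-Pascal rule, from \<open>[n+1] = [n-k] + v^(n-k) [k+1]\<close> for q-integers. The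
  case \<open>k = n\<close> is excluded because truncated subtraction gives
  \<open>qbinom v n (Suc n)\<close> the value \<open>1 / qint v (Suc n)\<close> instead of
  0.\<close>

lemma qbinom_Suc:
  fixes v :: "'k::field"
  assumes v: "\<And>n. n > 0 \<Longrightarrow> v ^ n \<noteq> 1" and k: "k < n"
  shows "qbinom v (Suc n) (Suc k) = qbinom v n (Suc k) + v ^ (n - k) * qbinom v n k"
proof -
  obtain d where d: "n = Suc (k + d)" using k less_imp_Suc_add by blast
  have nz: "qfact v m \<noteq> 0" "qint v (Suc m) \<noteq> 0" for m
    using qfact_nonzero[OF v] qint_nonzero[OF v] by auto
  have "v - 1 \<noteq> 0" using v[of 1] by simp
  then have split: "qint v (Suc n) = qint v (Suc d) + v ^ Suc d * qint v (Suc k)"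
    unfolding qint_def times_divide_eq_right add_divide_distrib[symmetric]
    by (simp add: d algebra_simps power_add)
  have "qbinom v (Suc n) (Suc k)
      = (qint v (Suc d) + v ^ Suc d * qint v (Suc k)) * qfact v n / (qfact v (Suc k) * qfact v (Suc d))"
    unfolding split[symmetric] by (simp add: qbinom_def d qfact_Suc)
  also have "\<dots> = qbinom v n (Suc k) + v ^ (n - k) * qbinom v n k"
    using nz by (simp add: qbinom_def d qfact_Suc[of v d] qfact_Suc[of v k] Suc_diff_le field_simps)
  finally show ?thesis .
qed

text \<open>The coefficient of the Serre relation with its degree \<open>n\<close> freed for
  induction. The explicit 0 beyond \<open>n\<close> replaces the wrong value of
  \<open>qbinom\<close> there, so that the recursion holds for every \<open>k\<close>.\<close>

definition qserre_coeff :: "'k::field \<Rightarrow> 'k \<Rightarrow> nat \<Rightarrow> nat \<Rightarrow> 'k" where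
  "qserre_coeff v p n k =
     (if k \<le> n then (-1) ^ k * qbinom v n k * v ^ (k * (k - 1) div 2) * p ^ k else 0)"

lemma triangle_Suc: "Suc k * (Suc k - 1) div 2 = k + k * (k - 1) div 2"
  by (induction k) (auto simp: algebra_simps)

text \<open>Raising \<open>l\<close> to \<open>Suc l\<close> in the triangular exponent contributes
  \<open>v ^ l\<close>, which completes the Pascal factor \<open>v ^ (n - l)\<close> to
  \<open>v ^ n\<close>. That factor no longer depends on \<open>l\<close>, so one step of the
  recursion is a single skew commutator.\<close>

lemma qserre_coeff_Suc:
  fixes v :: "'k::field"
  assumes v: "\<And>n. n > 0 \<Longrightarrow> v ^ n \<noteq> 1"
  shows "qserre_coeff v p (Suc n) k = qserre_coeff v p n k
    - (case k of 0 \<Rightarrow> 0 | Suc l \<Rightarrow> v ^ n * p * qserre_coeff v p n l)"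
proof (cases k)
  case 0
  then show ?thesis using v by (simp add: qserre_coeff_def)
next
  case (Suc l)
  consider "l < n" | "l = n" | "l > n" by linarith
  then show ?thesis
  proof cases
    case 1
    have "v ^ l * v ^ (n - l) = v ^ n" using 1 by (simp flip: power_add)
    then show ?thesis
      using 1 v qbinom_Suc[OF v 1] unfolding Suc qserre_coeff_def triangle_Suc
      by (simp add: power_add algebra_simps)
  next
    case 2
    then show ?thesis using v
      unfolding Suc qserre_coeff_def triangle_Suc by (simp add: power_add algebra_simps)
  qed (simp add: Suc qserre_coeff_def)
qed

text \<open>The sums in the Serre relations are \<open>n\<close>-fold skew commutators, by the q-Pascal rule.\<close>

lemma qserre_recursion:
  fixes v :: "'k::field" and s :: "'k \<Rightarrow> 'r::ring_1"
  assumes v: "\<And>n. n > 0 \<Longrightarrow> v ^ n \<noteq> 1"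
    and add: "\<And>c d. s (c - d) = s c - s d" and mult: "\<And>c d. s (c * d) = s c * s d"
    and zero: "s 0 = 0"
    and M: "\<And>n k. k \<le> n \<Longrightarrow> M (Suc n) k = L (M n k)" "\<And>n k. k \<le> n \<Longrightarrow> M (Suc n) (Suc k) = R (M n k)"
    and L: "\<And>f. L (\<Sum>k\<le>n. f k) = (\<Sum>k\<le>n. L (f k))" "\<And>c x. L (s c * x) = s c * L x"
    and R: "\<And>f. R (\<Sum>k\<le>n. f k) = (\<Sum>k\<le>n. R (f k))" "\<And>c x. R (s c * x) = s c * R x"
  shows "(\<Sum>k\<le>Suc n. s (qserre_coeff v p (Suc n) k) * M (Suc n) k) =
    L (\<Sum>k\<le>n. s (qserre_coeff v p n k) * M n k)
    - s (v ^ n * p) * R (\<Sum>k\<le>n. s (qserre_coeff v p n k) * M n k)"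
proof -
  have "(\<Sum>k\<le>Suc n. s (qserre_coeff v p (Suc n) k) * M (Suc n) k)
      = (\<Sum>k\<le>Suc n. s (qserre_coeff v p n k) * M (Suc n) k)
      - (\<Sum>k\<le>Suc n. s (case k of 0 \<Rightarrow> 0 | Suc l \<Rightarrow> v ^ n * p * qserre_coeff v p n l) * M (Suc n) k)"
    by (simp only: qserre_coeff_Suc[OF v] add left_diff_distrib sum_subtractf)
  \<comment> \<open>The summand \<open>k = Suc n\<close> vanishes by the convention in
    \<open>qserre_coeff\<close>; in all others \<open>M (Suc n) k\<close> arises by
    \<open>L\<close>.\<close>
  also have "(\<Sum>k\<le>Suc n. s (qserre_coeff v p n k) * M (Suc n) k)
      = L (\<Sum>k\<le>n. s (qserre_coeff v p n k) * M n k)"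
    by (simp add: qserre_coeff_def zero L M cong: sum.cong_simp)
  \<comment> \<open>After the shift from \<open>k\<close> to \<open>Suc l\<close> the monomials
    arise by \<open>R\<close>, and the constant \<open>v ^ n * p\<close> comes out of the
    sum.\<close>
  also have "(\<Sum>k\<le>Suc n. s (case k of 0 \<Rightarrow> 0 | Suc l \<Rightarrow> v ^ n * p * qserre_coeff v p n l) * M (Suc n) k)
      = s (v ^ n * p) * R (\<Sum>k\<le>n. s (qserre_coeff v p n k) * M n k)"
    by (simp add: sum.atMost_Suc_shift zero R M sum_distrib_left mult mult.assoc del: sum.atMost_Suc
        cong: sum.cong_simp)
  finally show ?thesis .
qed

context ring_1 begin

text \<open>
  The terms in \<open>w\<close> cancel in every step, so \<open>[Y (m + 1), f]\<close> is a scalar multiple of \<open>Y m * w'\<close>;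
  the accumulated scalar vanishes for \<open>m = N\<close> because \<open>p * p' * v ^ N = 1\<close>.
\<close>

lemma skew_commutator_e:
  fixes s :: "'k::field \<Rightarrow> 'a" and Y :: "nat \<Rightarrow> 'a"
  assumes s: "\<And>c d. s (c + d) = s c + s d" "\<And>c d. s (c * d) = s c * s d" "s 0 = 0"
      "\<And>c x. x * s c = s c * x"
    and Y: "Y 0 = y" "\<And>m. Y (Suc m) = e * Y m - s (v ^ m * p) * (Y m * e)"
    and ef: "e * f - f * e = s c * (w - w')" and yf: "y * f = f * y"
    and w: "w * e = s v * (e * w)" "w * y = s p * (y * w)"
    and w': "w' * e = s (inverse v) * (e * w')" "w' * y = s (inverse p') * (y * w')"
    and v: "v \<noteq> 0" "v \<noteq> 1" and p': "p' \<noteq> 0" and N: "p * p' * v ^ N = 1"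
  shows "Y (Suc N) * f = f * Y (Suc N)"
proof -
  have slc: "x * (s d * z) = s d * (x * z)" for d x z
    by (simp only: mult_assoc[symmetric] s(4))
  have ss: "s d * (s d' * x) = s (d * d') * x" for d d' x
    by (simp only: mult_assoc s(2))
  have sd: "s (d - d') = s d - s d'" for d d'
    using s(1)[of "d - d'" d'] by (simp add: algebra_simps)
  \<comment> \<open>This is the very scalar used in forming \<open>Y (Suc m)\<close> from
    \<open>Y m\<close>; hence the cancellation of the \<open>w\<close> terms below.\<close>
  have wY: "w * Y m = s (v ^ m * p) * (Y m * w)" for m
  proof (induction m)
    case (Suc m)
    let ?P = "v ^ m * p"
    have we: "w * (e * x) = s v * (e * (w * x))" for x
      by (simp only: mult_assoc[symmetric] w(1))
    have wYx: "w * (Y m * x) = s ?P * (Y m * (w * x))" for x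
      by (simp only: mult_assoc[symmetric] Suc)
    have "w * Y (Suc m) = s (v * ?P) * (e * (Y m * w)) - s (?P * (?P * v)) * (Y m * (e * w))"
      by (simp only: Y(2) right_diff_distrib we wYx Suc w(1) slc[of w] slc[of e] slc[of "Y m"] ss)
    also have "v * ?P = v ^ Suc m * p" by simp
    also have "?P * (?P * v) = (v ^ Suc m * p) * ?P" by simp
    also have "s (v ^ Suc m * p) * (e * (Y m * w)) - s ((v ^ Suc m * p) * ?P) * (Y m * (e * w))
        = s (v ^ Suc m * p) * (Y (Suc m) * w)"
      by (simp only: Y(2) left_diff_distrib right_diff_distrib ss mult_assoc)
    finally show ?case .
  qed (use Y w in simp)
  have w'Y: "w' * Y m = s (inverse (v ^ m * p')) * (Y m * w')" for m
  proof (induction m)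
    case (Suc m)
    let ?P = "v ^ m * p" and ?d = "inverse (v ^ m * p')"
    have we: "w' * (e * x) = s (inverse v) * (e * (w' * x))" for x
      by (simp only: mult_assoc[symmetric] w'(1))
    have wYx: "w' * (Y m * x) = s ?d * (Y m * (w' * x))" for x
      by (simp only: mult_assoc[symmetric] Suc)
    have "w' * Y (Suc m)
        = s (inverse v * ?d) * (e * (Y m * w')) - s (?P * (?d * inverse v)) * (Y m * (e * w'))"
      by (simp only: Y(2) right_diff_distrib we wYx Suc w'(1) slc[of w'] slc[of e] slc[of "Y m"] ss)
    also have "inverse v * ?d = inverse (v ^ Suc m * p')" by simp
    also have "?P * (?d * inverse v) = inverse (v ^ Suc m * p') * ?P" by simp
    also have "s (inverse (v ^ Suc m * p')) * (e * (Y m * w'))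
          - s (inverse (v ^ Suc m * p') * ?P) * (Y m * (e * w'))
        = s (inverse (v ^ Suc m * p')) * (Y (Suc m) * w')"
      by (simp only: Y(2) left_diff_distrib right_diff_distrib ss mult_assoc)
    finally show ?case .
  qed (use Y w' in simp)
  \<comment> \<open>The closed form of the sum of \<open>c * (v^l * p - inverse (v^l * p'))\<close>
    over \<open>l < m\<close>: two geometric sums with a common factor. Its last factor is what
    vanishes at \<open>m = Suc N\<close>; only positive \<open>m\<close> occur, so the truncated
    \<open>m - 1\<close> is harmless.\<close>
  define b where "b m = c * ((v ^ m - 1) / (v - 1)) * (p - inverse (p' * v ^ (m - 1)))" for m
  have bSuc: "b (Suc (Suc m)) = b (Suc m) + c * (v ^ Suc m * p - inverse (v ^ Suc m * p'))" for m
    using v p' by (simp add: b_def field_simps)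
  have "Y (Suc m) * f - f * Y (Suc m) = s (b (Suc m)) * (Y m * w')" for m
  proof (induction m)
    case 0
    have "Y (Suc 0) * f = (e * f) * y - s p * (y * (e * f))"
      by (simp add: Y left_diff_distrib mult_assoc yf)
    moreover have "f * Y (Suc 0) = (f * e) * y - s p * (y * (f * e))"
      by (simp add: Y right_diff_distrib slc[of f] mult_assoc) (simp add: yf flip: mult_assoc)
    ultimately have "Y (Suc 0) * f - f * Y (Suc 0) = (e * f - f * e) * y - s p * (y * (e * f - f * e))"
      by (simp add: algebra_simps)
    also have "\<dots> = s (c * p) * (y * w) - s (c * inverse p') * (y * w') - (s (p * c) * (y * w) - s (p * c) * (y * w'))"
      by (simp only: ef left_diff_distrib right_diff_distrib mult_assoc w w' slc[of y] ss)
    also have "\<dots> = s (c * p - c * inverse p') * (y * w')"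
      by (simp only: sd left_diff_distrib mult.commute[of p c]) (simp add: algebra_simps)
    also have "c * p - c * inverse p' = b 1"
      using v by (simp add: b_def algebra_simps)
    finally show ?case by (simp add: Y(1))
  next
    case (Suc m)
    let ?P = "v ^ Suc m * p" and ?Q = "inverse (v ^ Suc m * p')" and ?Y = "Y (Suc m)"
    have "Y (Suc (Suc m)) * f = e * (?Y * f) - s ?P * (?Y * (e * f))"
      by (simp only: Y(2)[of "Suc m"] left_diff_distrib mult_assoc)
    moreover have "f * Y (Suc (Suc m)) = f * (e * ?Y) - s ?P * (f * (?Y * e))"
      by (simp only: Y(2)[of "Suc m"] right_diff_distrib slc[of f])
    \<comment> \<open>A Leibniz splitting: in the first bracket \<open>f\<close> meets the newly
      added \<open>e\<close>, in the second it meets \<open>Y (Suc m)\<close>, where the induction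
      hypothesis applies.\<close>
    ultimately have "Y (Suc (Suc m)) * f - f * Y (Suc (Suc m))
        = ((e * f - f * e) * ?Y - s ?P * (?Y * (e * f - f * e)))
          + (e * (?Y * f - f * ?Y) - s ?P * ((?Y * f - f * ?Y) * e))"
      by (simp only: left_diff_distrib right_diff_distrib mult_assoc) (simp add: algebra_simps)
    also have "(e * f - f * e) * ?Y - s ?P * (?Y * (e * f - f * e))
        = s (c * ?P) * (?Y * w) - s (c * ?Q) * (?Y * w') - (s (?P * c) * (?Y * w) - s (?P * c) * (?Y * w'))"
      by (simp only: ef left_diff_distrib right_diff_distrib mult_assoc wY w'Y slc[of ?Y] ss)
    also have "\<dots> = s (c * (?P - ?Q)) * (?Y * w')"
    proof -
      have "c * (?P - ?Q) = c * ?P - c * ?Q" by (rule ring_class.right_diff_distrib)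
      then show ?thesis
        by (simp only: sd left_diff_distrib mult.commute[of ?P c]) (simp add: algebra_simps)
    qed
    also have "e * (?Y * f - f * ?Y) - s ?P * ((?Y * f - f * ?Y) * e)
        = s (b (Suc m)) * (e * (Y m * w')) - s (?P * (b (Suc m) * inverse v)) * (Y m * (e * w'))"
      by (simp only: Suc slc[of e] slc[of "Y m"] mult_assoc w'(1) ss)
    \<comment> \<open>Moving \<open>w'\<close> past \<open>e\<close> costs \<open>inverse v\<close>,
      which lowers \<open>v ^ Suc m\<close> to \<open>v ^ m\<close>; so the two terms recombine to
      \<open>Y (Suc m) * w'\<close>.\<close>
    also have "?P * (b (Suc m) * inverse v) = b (Suc m) * (v ^ m * p)"
      using v by simp
    also have "s (b (Suc m)) * (e * (Y m * w')) - s (b (Suc m) * (v ^ m * p)) * (Y m * (e * w'))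
        = s (b (Suc m)) * (?Y * w')"
      by (simp only: Y(2)[of m] left_diff_distrib right_diff_distrib ss mult_assoc)
    also have "s (c * (?P - ?Q)) * (?Y * w') + s (b (Suc m)) * (?Y * w') = s (b (Suc (Suc m))) * (?Y * w')"
      by (simp only: bSuc s(1) distrib_right add.commute)
    finally show ?case .
  qed
  moreover have "b (Suc N) = 0"
  proof -
    have "p = inverse (p' * v ^ N)" using N v p' by (simp add: field_simps)
    then show ?thesis by (simp add: b_def)
  qed
  ultimately have "Y (Suc N) * f - f * Y (Suc N) = 0"
    by (simp only: s(3) mult_zero_left)
  then show ?thesis by simp
qed

text \<open>Here \<open>f\<close> interacts with the innermost factor \<open>y\<close> only, so the
  commutator is the iterated skew commutator of \<open>w - w'\<close> with \<open>e\<close>. Each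
  step multiplies the \<open>w\<close> term by \<open>1 - v^m * p * p'\<close> and the
  \<open>w'\<close> term by \<open>1 - v^m\<close>: the former vanishes at \<open>m = N\<close> by
  hypothesis, the latter already at \<open>m = 0\<close>.\<close>

lemma skew_commutator_y:
  fixes s :: "'k::field \<Rightarrow> 'a" and Y :: "nat \<Rightarrow> 'a"
  assumes s: "\<And>c d. s (c + d) = s c + s d" "\<And>c d. s (c * d) = s c * s d" "s 0 = 0"
      "\<And>c x. x * s c = s c * x"
    and Y: "Y 0 = y" "\<And>m. Y (Suc m) = e * Y m - s (v ^ m * p) * (Y m * e)"
    and yf: "y * f - f * y = s c * (w - w')" and ef: "e * f = f * e"
    and w: "w * e = s p' * (e * w)" and w': "w' * e = s (inverse p) * (e * w')"
    and p: "p \<noteq> 0" and N: "p * p' * v ^ N = 1"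
  shows "Y (Suc N) * f = f * Y (Suc N)"
proof -
  have slc: "x * (s d * z) = s d * (x * z)" for d x z
    by (simp only: mult_assoc[symmetric] s(4))
  have ss: "s d * (s d' * x) = s (d * d') * x" for d d' x
    by (simp only: mult_assoc s(2))
  have sd: "s (d - d') = s d - s d'" for d d'
    using s(1)[of "d - d'" d'] by (simp add: algebra_simps)
  define g g' where "g m = c * (\<Prod>l<m. 1 - v ^ l * p * p')" and "g' m = c * (\<Prod>l<m. 1 - v ^ l)" for m :: nat
  have g_Suc: "g (Suc m) = g m - v ^ m * p * (g m * p')"
      "g' (Suc m) = g' m - v ^ m * p * (g' m * inverse p)" for m
    using p by (simp_all add: g_def g'_def algebra_simps)
  have main: "Y m * f - f * Y m = s (g m) * (e ^ m * w) - s (g' m) * (e ^ m * w')" for m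
  proof (induction m)
    case 0
    then show ?case by (simp add: Y yf g_def g'_def right_diff_distrib)
  next
    case (Suc m)
    have pe: "e ^ m * (e * x) = e * (e ^ m * x)" for x
      by (simp add: power_commutes flip: mult_assoc)
    have e: "f * (e * x) = e * (f * x)" for x using ef by (simp flip: mult_assoc)
    have "Y (Suc m) * f - f * Y (Suc m) = e * (Y m * f - f * Y m) - s (v ^ m * p) * ((Y m * f - f * Y m) * e)"
    proof -
      have "Y (Suc m) * f = e * (Y m * f) - s (v ^ m * p) * (Y m * f * e)"
        by (simp only: Y(2) left_diff_distrib mult_assoc ef)
      moreover have "f * Y (Suc m) = e * (f * Y m) - s (v ^ m * p) * (f * Y m * e)"
        by (simp only: Y(2) right_diff_distrib mult_assoc slc e)
      moreover have "x1 - x2 - (x3 - x4) = x1 - x3 - (x2 - x4)" for x1 x2 x3 x4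
        by (simp add: algebra_simps)
      ultimately show ?thesis
        by (simp only: left_diff_distrib right_diff_distrib mult_assoc)
    qed
    also have "\<dots> = s (g (Suc m)) * (e ^ Suc m * w) - s (g' (Suc m)) * (e ^ Suc m * w')"
    proof -
      have 1: "e * (s d * x) = s d * (e * x)" "e ^ m * (s d * x) = s d * (e ^ m * x)" for d x
        by (rule slc)+
      show ?thesis
        unfolding Suc g_Suc sd power_Suc left_diff_distrib right_diff_distrib mult_assoc w w' 1 ss pe
        by (simp add: algebra_simps)
    qed
    finally show ?case .
  qed
  have "1 - v ^ N * p * p' = 0" using N by (simp add: ac_simps)
  then have "g (Suc N) = 0" by (simp add: g_def)
  moreover have "g' (Suc N) = 0" by (simp add: g'_def prod.lessThan_Suc_shift del: prod.lessThan_Suc)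
  ultimately have "Y (Suc N) * f - f * Y (Suc N) = 0"
    by (simp only: main s(3) mult_zero_left diff_self)
  then show ?thesis by simp
qed

end

text \<open>The Serre elements in the \<open>f_i\<close> are mirror images of those in the
  \<open>e_i\<close>; read in the opposite ring, the two skew commutator lemmas cover them as
  well.\<close>

lemma ring_1_opposite: "class.ring_1 (1::'a::ring_1) (\<lambda>x y. y * x) (+) 0 (-) uminus"
  by unfold_locales (simp_all add: algebra_simps)

lemmas skew_commutator_e_opposite = ring_1.skew_commutator_e[OF ring_1_opposite]
lemmas skew_commutator_y_opposite = ring_1.skew_commutator_y[OF ring_1_opposite]

section \<open>The action on the free space of normally ordered monomials\<close>

text \<open>The scalar in \<open>g e_i = wt q g i * e_i g\<close>; its inverse governs
  \<open>f_i\<close>. The value 1 off the torus keeps \<open>wt\<close> nonzero for every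
  generator.\<close>

fun wt :: "('i \<Rightarrow> 'i \<Rightarrow> 'k::field) \<Rightarrow> 'i generator \<Rightarrow> 'i \<Rightarrow> 'k" where
  "wt q (\<Omega> j) i = q j i"
| "wt q (\<Omega>inv j) i = inverse (q j i)"
| "wt q (\<Omega>' j) i = inverse (q i j)"
| "wt q (\<Omega>'inv j) i = q i j"
| "wt q _ i = 1"

fun ginv :: "'i generator \<Rightarrow> 'i generator" where
  "ginv (\<Omega> j) = \<Omega>inv j"
| "ginv (\<Omega>inv j) = \<Omega> j"
| "ginv (\<Omega>' j) = \<Omega>'inv j"
| "ginv (\<Omega>'inv j) = \<Omega>' j"
| "ginv g = g"

lemma ginv_ginv [simp]: "ginv (ginv g) = g"
  by (cases g) simp_all

text \<open>Exponents are recorded redundantly, at \<open>g\<close> and with opposite sign at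
  \<open>ginv g\<close>, so that \<open>ginv\<close> is negation. Since \<open>ginv\<close> fixes
  \<open>E\<close> and \<open>F\<close> generators, these have degree 0.\<close>

definition delta :: "'i generator \<Rightarrow> 'i generator \<Rightarrow> int" where
  "delta g h = of_bool (h = g) - of_bool (h = ginv g)"

lemma delta_ginv: "delta (ginv g) h = - delta g h"
  by (simp add: delta_def)

definition torus_deg :: "'i generator list \<Rightarrow> 'i generator \<Rightarrow> int" where
  "torus_deg t h = (\<Sum>g\<leftarrow>t. delta g h)"

definition wts :: "('i \<Rightarrow> 'i \<Rightarrow> 'k::field) \<Rightarrow> 'i generator list \<Rightarrow> 'i \<Rightarrow> 'k" where
  "wts q t i = (\<Prod>g\<leftarrow>t. wt q g i)"

text \<open>
  A basis vector \<open>(x, d, c, z)\<close> stands for \<open>f\<^sub>x t e\<^sub>z\<close>, where \<open>t\<close> is a torus monomial with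
  exponents \<open>d\<close> and \<open>t e\<^sub>i = c i e\<^sub>i t\<close>.
\<close>

type_synonym ('i, 'k) key = "'i list \<times> ('i generator \<Rightarrow> int) \<times> ('i \<Rightarrow> 'k) \<times> 'i list"

abbreviation bas :: "'x \<Rightarrow> ('x \<Rightarrow>\<^sub>0 'k::field)" where
  "bas x \<equiv> Poly_Mapping.single x 1"

definition F_op :: "'i \<Rightarrow> (('i, 'k::field) key, 'k) lin_end" where
  "F_op i = lin_ext (\<lambda>(x, d, c, z). bas (i # x, d, c, z))"

text \<open>Moving \<open>g\<close> to the right past \<open>f_x\<close> costs one inverse weight
  per letter; then \<open>g\<close> is absorbed into the torus monomial, changing its exponents and
  its weights.\<close>

definition T_op :: "('i \<Rightarrow> 'i \<Rightarrow> 'k::field) \<Rightarrow> 'i generator \<Rightarrow> (('i, 'k) key, 'k) lin_end" where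
  "T_op q g = lin_ext (\<lambda>(x, d, c, z).
     Poly_Mapping.single (x, \<lambda>h. delta g h + d h, \<lambda>i. wt q g i * c i, z) (\<Prod>j\<leftarrow>x. inverse (wt q g j)))"

text \<open>The result of \<open>e_i\<close> applied to \<open>f_x t e_z\<close>: \<open>e_i\<close>
  moves past one \<open>f_j\<close> at a time, leaving the torus commutator when
  \<open>i = j\<close>, and finally past \<open>t\<close>, which costs \<open>inverse (c i)\<close>.
  For keys with \<open>c i = 0\<close> the convention \<open>inverse 0 = 0\<close> keeps the
  operator identities valid.\<close>

primrec e_vec :: "('i \<Rightarrow> 'i \<Rightarrow> 'k::field) \<Rightarrow> 'i \<Rightarrow> ('i generator \<Rightarrow> int) \<Rightarrow> ('i \<Rightarrow> 'k) \<Rightarrow> 'i list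
    \<Rightarrow> 'i list \<Rightarrow> ('i, 'k) key \<Rightarrow>\<^sub>0 'k" where
  "e_vec q i d c z [] = Poly_Mapping.single ([], d, c, i # z) (inverse (c i))"
| "e_vec q i d c z (j # x) = app (F_op j) (e_vec q i d c z x)
     + (if i = j then fscale (q i i / (q i i - 1))
          (app (T_op q (\<Omega> i)) (bas (x, d, c, z)) - app (T_op q (\<Omega>' i)) (bas (x, d, c, z))) else 0)"

definition E_op :: "('i \<Rightarrow> 'i \<Rightarrow> 'k::field) \<Rightarrow> 'i \<Rightarrow> (('i, 'k) key, 'k) lin_end" where
  "E_op q i = lin_ext (\<lambda>(x, d, c, z). e_vec q i d c z x)"

fun gen_op :: "('i \<Rightarrow> 'i \<Rightarrow> 'k::field) \<Rightarrow> 'i generator \<Rightarrow> (('i, 'k) key, 'k) lin_end" where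
  "gen_op q (E i) = E_op q i"
| "gen_op q (F i) = F_op i"
| "gen_op q g = T_op q g"

abbreviation rep :: "('i \<Rightarrow> 'i \<Rightarrow> 'k::field) \<Rightarrow> ('i generator, 'k) free_alg \<Rightarrow> (('i, 'k) key, 'k) lin_end" where
  "rep q \<equiv> alg_ext (gen_op q)"

lemma F_op_single: "app (F_op i) (Poly_Mapping.single (x, d, c, z) r) = Poly_Mapping.single (i # x, d, c, z) r"
  by (simp add: F_op_def)

lemma T_op_single: "app (T_op q g) (Poly_Mapping.single (x, d, c, z) r) = Poly_Mapping.single
    (x, \<lambda>h. delta g h + d h, \<lambda>i. wt q g i * c i, z) (r * (\<Prod>j\<leftarrow>x. inverse (wt q g j)))"
  by (simp add: T_op_def)

lemma E_op_single: "app (E_op q i) (Poly_Mapping.single (x, d, c, z) r) = fscale r (e_vec q i d c z x)"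
  by (simp add: E_op_def)

lemma F_word_bas: "app (prod_list (map F_op u)) (bas (x, d, c, z)) = bas (u @ x, d, c, z)"
  by (induction u) (simp_all add: F_op_single)

lemma T_op_comm: "T_op q g * T_op q h = T_op q h * T_op q g"
  by (rule lin_end_eqI) (auto simp: T_op_single ac_simps)

lemma torus_cases:
  assumes "g \<in> torus_generators"
  obtains j where "g = \<Omega> j" | j where "g = \<Omega>inv j" | j where "g = \<Omega>' j" | j where "g = \<Omega>'inv j"
  using assms by (auto simp: torus_generators_def)

lemma gen_op_torus: "g \<in> torus_generators \<Longrightarrow> gen_op q g = T_op q g"
  by (auto simp: torus_generators_def)

locale quantum_parameters =
  fixes a :: "'i \<Rightarrow> 'i \<Rightarrow> int" and q :: "'i \<Rightarrow> 'i \<Rightarrow> 'k::field"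
  assumes a_nonpos: "i \<noteq> j \<Longrightarrow> a i j \<le> 0"
    and q_nonzero [simp]: "q i j \<noteq> 0"
    and q_cartan: "q i j * q j i = q i i powi a i j"
    and q_not_root: "n > 0 \<Longrightarrow> q i i ^ n \<noteq> 1"
begin

abbreviation "c\<^sub>0 i \<equiv> q i i / (q i i - 1)"

lemma wt_nonzero [simp]: "wt q g i \<noteq> 0"
  by (cases g) simp_all

lemma wt_ginv: "g \<in> torus_generators \<Longrightarrow> wt q (ginv g) i = inverse (wt q g i)"
  by (cases g) (auto simp: torus_generators_def)

lemma T_op_ginv: "g \<in> torus_generators \<Longrightarrow> T_op q g * T_op q (ginv g) = 1"
proof (rule lin_end_eqI)
  fix k :: "('i, 'k) key"
  assume g: "g \<in> torus_generators"
  obtain x d c z where k: "k = (x, d, c, z)" by (cases k) auto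
  have "(\<Prod>j\<leftarrow>x. inverse (inverse (wt q g j))) * (\<Prod>j\<leftarrow>x. inverse (wt q g j)) = 1"
    by (induction x) (simp_all add: field_simps)
  then show "app (T_op q g * T_op q (ginv g)) (bas k) = app 1 (bas k)"
    using g by (simp add: k T_op_single delta_ginv wt_ginv flip: mult.assoc)
qed

lemma T_op_F_op: "T_op q g * F_op i = sc (inverse (wt q g i)) * (F_op i * T_op q g)"
  by (rule lin_end_eqI) (auto simp: T_op_single F_op_single)

text \<open>True by construction: the \<open>Cons\<close> equation of \<open>e_vec\<close> is this
  relation evaluated at a basis vector.\<close>

lemma E_op_F_op:
  "E_op q i * F_op j - F_op j * E_op q i = (if i = j then sc (c\<^sub>0 i) * (T_op q (\<Omega> i) - T_op q (\<Omega>' i)) else 0)"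
  by (rule lin_end_eqI) (auto simp: E_op_single F_op_single)

lemma sc_slide: "A * (sc c * B) = sc c * (A * B)"
  by (simp add: sc_central[of c A] flip: mult.assoc)

text \<open>\<open>E_op\<close> is defined by recursion on the word in the \<open>f_j\<close>, so
  this relation is proved by induction along that word, pulling each \<open>F_op j\<close> out with
  \<open>E_op_F_op\<close>.\<close>

lemma T_op_E_op: "T_op q g * E_op q i = sc (wt q g i) * (E_op q i * T_op q g)"
proof (rule lin_end_eqI)
  fix k :: "('i, 'k) key"
  obtain x d c z where k: "k = (x, d, c, z)" by (cases k) auto
  have "app (T_op q g * E_op q i) (bas (x, d, c, z))
      = app (sc (wt q g i) * (E_op q i * T_op q g)) (bas (x, d, c, z))"
  proof (induction x)
    case Nil
    show ?case by (simp add: E_op_single T_op_single flip: mult.assoc)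
  next
    case (Cons j x)
    let ?b = "bas (x, d, c, z)" and ?u = "inverse (wt q g j)" and ?w = "wt q g i"
    let ?D = "if i = j then sc (c\<^sub>0 i) * (T_op q (\<Omega> i) - T_op q (\<Omega>' i)) else 0"
    have EF: "E_op q i * F_op j = F_op j * E_op q i + ?D"
      using E_op_F_op[of i j] by (simp only: diff_eq_eq add.commute)
    have TD: "T_op q g * ?D = ?D * T_op q g"
      by (simp add: right_diff_distrib left_diff_distrib mult.assoc sc_slide[of "T_op q g"] T_op_comm[of q g])
    have "app (T_op q g * E_op q i) (app (F_op j) ?b) = app (T_op q g * (E_op q i * F_op j)) ?b"
      by simp
    also have "T_op q g * (E_op q i * F_op j) = T_op q g * F_op j * E_op q i + T_op q g * ?D"
      by (simp only: EF distrib_left mult.assoc)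
    also have "app \<dots> ?b = app (sc ?u * F_op j) (app (T_op q g * E_op q i) ?b) + app (?D * T_op q g) ?b"
      by (simp only: TD T_op_F_op) simp
    also have "\<dots> = app (sc ?u * F_op j * sc ?w * (E_op q i * T_op q g)) ?b + app (?D * T_op q g) ?b"
      by (simp only: Cons) simp
    also have "\<dots> = app (sc ?w * (E_op q i * (T_op q g * F_op j))) ?b"
    proof -
      have "sc ?w * (E_op q i * (T_op q g * F_op j)) = sc (?w * ?u) * (E_op q i * F_op j * T_op q g)"
        by (simp only: T_op_F_op sc_slide[of "E_op q i"] sc_hom mult.assoc)
      also have "\<dots> = sc (?w * ?u) * (F_op j * E_op q i * T_op q g) + sc (?w * ?u) * (?D * T_op q g)"
        by (simp only: EF distrib_left distrib_right)
      \<comment> \<open>The commutator term survives only for \<open>i = j\<close>, where the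
        weights of \<open>e_i\<close> and \<open>f_j\<close> cancel.\<close>
      also have "sc (?w * ?u) * (?D * T_op q g) = ?D * T_op q g"
      proof (cases "i = j")
        case True
        then have "?w * ?u = 1" by simp
        then show ?thesis by (simp only: sc_hom mult_1_left)
      qed simp
      also have "sc (?w * ?u) * (F_op j * E_op q i * T_op q g) = sc ?u * F_op j * sc ?w * (E_op q i * T_op q g)"
        by (simp only: mult.assoc sc_slide[of "F_op j"] sc_hom mult.commute[of ?w ?u])
      finally show ?thesis by simp
    qed
    also have "\<dots> = app (sc ?w * (E_op q i * T_op q g)) (app (F_op j) ?b)"
      by simp
    finally show ?case by (simp only: F_op_single)
  qed
  then show "app (T_op q g * E_op q i) (bas k) = app (sc (wt q g i) * (E_op q i * T_op q g)) (bas k)"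
    by (simp only: k)
qed

text \<open>This supplies the hypothesis \<open>p * p' * v ^ N = 1\<close> of the skew commutator
  lemmas, with \<open>N\<close> one less than the Serre degree
  \<open>nat (1 - a i j)\<close>.\<close>

lemma cartan_exponent: 
  assumes "i \<noteq> j"
  shows "q i j * q j i * q i i ^ nat (- a i j) = 1"
proof -
  have "a i j = - int (nat (- a i j))" using a_nonpos[OF assms] by simp
  then have "q i i powi a i j = inverse (q i i ^ nat (- a i j))"
    by (metis power_int_minus power_int_of_nat)
  then show ?thesis by (simp add: q_cartan)
qed

lemma nat_serre: "i \<noteq> j \<Longrightarrow> nat (1 - a i j) = Suc (nat (- a i j))"
  using a_nonpos[of i j] by simp

definition Ye :: "'i \<Rightarrow> 'i \<Rightarrow> nat \<Rightarrow> (('i, 'k) key, 'k) lin_end" where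
  "Ye i j n = (\<Sum>k\<le>n. sc (qserre_coeff (q i i) (q i j) n k) * (E_op q i ^ (n - k) * (E_op q j * E_op q i ^ k)))"

definition Yf :: "'i \<Rightarrow> 'i \<Rightarrow> nat \<Rightarrow> (('i, 'k) key, 'k) lin_end" where
  "Yf i j n = (\<Sum>k\<le>n. sc (qserre_coeff (q i i) (q i j) n k) * (F_op i ^ k * (F_op j * F_op i ^ (n - k))))"

lemma rep_serre_e: "rep q (serre_e a q i j) = Ye i j (nat (1 - a i j))"
  unfolding serre_e_def Ye_def atMost_atLeast0 alg_ext_sum
  by (intro sum.cong)
    (auto simp: alg_ext_mult alg_ext_scalar alg_ext_power alg_ext_gen mult.assoc serre_coeff_def qserre_coeff_def)

lemma rep_serre_f: "rep q (serre_f a q i j) = Yf i j (nat (1 - a i j))"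
  unfolding serre_f_def Yf_def atMost_atLeast0 alg_ext_sum
  by (intro sum.cong)
    (auto simp: alg_ext_mult alg_ext_scalar alg_ext_power alg_ext_gen mult.assoc serre_coeff_def qserre_coeff_def)

lemma sc_diff: "sc (c - d) = sc c - sc d"
  using sc_hom(3)[of "c - d" d] by (metis diff_add_cancel add_diff_cancel_right')

lemma Ye_rec: "Ye i j 0 = E_op q j"
    "Ye i j (Suc n) = E_op q i * Ye i j n - sc (q i i ^ n * q i j) * (Ye i j n * E_op q i)"
proof -
  show "Ye i j 0 = E_op q j"
    using q_not_root[of _ i] by (simp add: Ye_def qserre_coeff_def sc_hom)
  show "Ye i j (Suc n) = E_op q i * Ye i j n - sc (q i i ^ n * q i j) * (Ye i j n * E_op q i)"
    unfolding Ye_def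
    by (rule qserre_recursion[where L = "\<lambda>x. E_op q i * x" and R = "\<lambda>x. x * E_op q i"])
      (simp_all only: q_not_root sc_diff sc_hom sum_distrib_left sum_distrib_right Suc_diff_le mult.assoc
        sc_slide[of "E_op q i"] power_Suc power_commutes diff_Suc_Suc not_False_eq_True)
qed

lemma Yf_rec: "Yf i j 0 = F_op j"
    "Yf i j (Suc n) = Yf i j n * F_op i - sc (q i i ^ n * q i j) * (F_op i * Yf i j n)"
proof -
  show "Yf i j 0 = F_op j"
    using q_not_root[of _ i] by (simp add: Yf_def qserre_coeff_def sc_hom)
  show "Yf i j (Suc n) = Yf i j n * F_op i - sc (q i i ^ n * q i j) * (F_op i * Yf i j n)"
    unfolding Yf_def
    \<comment> \<open>In \<open>serre_f\<close> the \<open>k\<close>-th power stands on the left, so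
      left and right multiplication exchange their roles compared with \<open>Ye\<close>.\<close>
    by (rule qserre_recursion[where R = "\<lambda>x. F_op i * x" and L = "\<lambda>x. x * F_op i"])
      (simp_all only: q_not_root sc_diff sc_hom sum_distrib_left sum_distrib_right Suc_diff_le mult.assoc
        sc_slide[of "F_op i"] power_Suc power_commutes diff_Suc_Suc not_False_eq_True)
qed

text \<open>Three cases: for \<open>l = i\<close> the commutators come from the outer factors
  (\<open>skew_commutator_e\<close>), for \<open>l = j\<close> from the single inner factor
  (\<open>skew_commutator_y\<close>), and otherwise \<open>F_op l\<close> commutes with every
  factor.\<close>

lemma Ye_commute:
  assumes "i \<noteq> j"
  shows "Ye i j (Suc (nat (- a i j))) * F_op l = F_op l * Ye i j (Suc (nat (- a i j)))"
proof -
  consider "l = i" | "l = j" | "l \<noteq> i" "l \<noteq> j" by blast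
  then show ?thesis
  proof cases
    case 1
    show ?thesis unfolding 1
    proof (rule skew_commutator_e[where s = sc and Y = "Ye i j" and v = "q i i" and p = "q i j" and p' = "q j i"])
      show "E_op q i * F_op i - F_op i * E_op q i = sc (c\<^sub>0 i) * (T_op q (\<Omega> i) - T_op q (\<Omega>' i))"
        using E_op_F_op[of i i] by simp
      show "E_op q j * F_op i = F_op i * E_op q j"
        using E_op_F_op[of j i] assms by simp
    qed (rule sc_hom Ye_rec sc_central[symmetric] |
        use q_not_root[of 1 i] cartan_exponent[OF assms] in \<open>simp add: T_op_E_op\<close>)+
  next
    case 2
    show ?thesis unfolding 2
    proof (rule skew_commutator_y[where s = sc and Y = "Ye i j" and v = "q i i" and p = "q i j" and p' = "q j i"])
      show "E_op q j * F_op j - F_op j * E_op q j = sc (c\<^sub>0 j) * (T_op q (\<Omega> j) - T_op q (\<Omega>' j))"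
        using E_op_F_op[of j j] by simp
      show "E_op q i * F_op j = F_op j * E_op q i"
        using E_op_F_op[of i j] assms by simp
    qed (rule sc_hom Ye_rec sc_central[symmetric] |
        use q_not_root[of 1 i] cartan_exponent[OF assms] in \<open>simp add: T_op_E_op\<close>)+
  next
    case 3
    have 1: "E_op q i * F_op l = F_op l * E_op q i" "E_op q j * F_op l = F_op l * E_op q j"
      using E_op_F_op[of i l] E_op_F_op[of j l] 3 by simp_all
    have "Ye i j n * F_op l = F_op l * Ye i j n" for n
    proof (induction n)
      case (Suc n)
      have "E_op q i * Ye i j n * F_op l = F_op l * (E_op q i * Ye i j n)"
        by (simp only: Suc mult.assoc) (simp only: 1 mult.assoc[symmetric])
      moreover have "Ye i j n * E_op q i * F_op l = F_op l * (Ye i j n * E_op q i)"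
        by (simp only: 1 mult.assoc) (simp only: Suc mult.assoc[symmetric])
      ultimately show ?case
        by (simp only: Ye_rec left_diff_distrib right_diff_distrib sc_slide[of "F_op l"] mult.assoc)
    qed (simp add: Ye_rec 1)
    then show ?thesis .
  qed
qed

text \<open>The opposite ring reverses products and puts scalars on the right; this lemma,
  \<open>Yf_rec'\<close> and \<open>sc_mult'\<close> restate the needed facts in that shape.\<close>

lemma T_op_F_op': "F_op i * T_op q g = T_op q g * F_op i * sc (wt q g i)"
proof -
  have "F_op i * T_op q g = sc (wt q g i * inverse (wt q g i)) * (F_op i * T_op q g)"
    by (simp add: sc_hom(2))
  also have "\<dots> = sc (wt q g i) * (T_op q g * F_op i)"
    by (simp only: sc_hom(4) T_op_F_op mult.assoc)
  finally show ?thesis by (simp only: sc_central)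
qed

lemma Yf_rec': "Yf i j (Suc n) = Yf i j n * F_op i - F_op i * Yf i j n * sc (q i i ^ n * q i j)"
  by (simp only: Yf_rec sc_central)

lemma sc_mult': "sc (c * d) = sc d * sc c"
  by (simp only: sc_hom(4)[symmetric] mult.commute)

text \<open>In the opposite ring \<open>F_op\<close> plays the part of \<open>e\<close> and
  \<open>y\<close>, and \<open>E_op\<close> that of \<open>f\<close>. Exchanging the parts and
  reversing the products cancel, so the commutator keeps its sign.\<close>

lemma Yf_commute:
  assumes "i \<noteq> j"
  shows "E_op q l * Yf i j (Suc (nat (- a i j))) = Yf i j (Suc (nat (- a i j))) * E_op q l"
proof -
  consider "l = i" | "l = j" | "l \<noteq> i" "l \<noteq> j" by blast
  then show ?thesis
  proof cases
    case 1
    show ?thesis unfolding 1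
    proof (rule skew_commutator_e_opposite[where s = sc and Y = "Yf i j" and v = "q i i" and p = "q i j" and p' = "q j i"])
      show "E_op q i * F_op i - F_op i * E_op q i = (T_op q (\<Omega> i) - T_op q (\<Omega>' i)) * sc (c\<^sub>0 i)"
        using E_op_F_op[of i i] by (simp add: sc_central)
      show "E_op q i * F_op j = F_op j * E_op q i"
        using E_op_F_op[of i j] assms by simp
    qed (rule sc_hom Yf_rec(1) Yf_rec' sc_central sc_mult' |
        use q_not_root[of 1 i] cartan_exponent[OF assms] in \<open>simp add: T_op_F_op'\<close>)+
  next
    case 2
    show ?thesis unfolding 2
    proof (rule skew_commutator_y_opposite[where s = sc and Y = "Yf i j" and v = "q i i" and p = "q i j" and p' = "q j i"])
      show "E_op q j * F_op j - F_op j * E_op q j = (T_op q (\<Omega> j) - T_op q (\<Omega>' j)) * sc (c\<^sub>0 j)"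
        using E_op_F_op[of j j] by (simp add: sc_central)
      show "E_op q j * F_op i = F_op i * E_op q j"
        using E_op_F_op[of j i] assms by simp
    qed (rule sc_hom Yf_rec(1) Yf_rec' sc_central sc_mult' |
        use q_not_root[of 1 i] cartan_exponent[OF assms] in \<open>simp add: T_op_F_op'\<close>)+
  next
    case 3
    have 1: "E_op q l * F_op i = F_op i * E_op q l" "E_op q l * F_op j = F_op j * E_op q l"
      using E_op_F_op[of l i] E_op_F_op[of l j] 3 by simp_all
    have "E_op q l * Yf i j n = Yf i j n * E_op q l" for n
    proof (induction n)
      case (Suc n)
      have "E_op q l * (Yf i j n * F_op i) = Yf i j n * F_op i * E_op q l"
        by (simp only: 1 mult.assoc[symmetric] Suc) (simp only: 1 mult.assoc)
      moreover have "E_op q l * (F_op i * Yf i j n) = F_op i * Yf i j n * E_op q l"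
        by (simp only: 1 mult.assoc[symmetric]) (simp only: Suc mult.assoc)
      ultimately show ?case
        by (simp only: Yf_rec left_diff_distrib right_diff_distrib sc_slide[of "E_op q l"] mult.assoc)
    qed (simp add: Yf_rec 1)
    then show ?thesis .
  qed
qed

section \<open>The Serre submodule\<close>

text \<open>The two clauses differ because words in \<open>E_op\<close> act simply only on vectors
  without \<open>f\<close>-letters, where they prepend letters up to a scalar. Starting from
  \<open>([], d, c, z)\<close> thus yields multiples of \<open>f_x t e_u S e_z\<close> and no
  commutator terms.\<close>

inductive_set serre_gens :: "(('i, 'k) key \<Rightarrow>\<^sub>0 'k) set" where
  serre_f: "i \<noteq> j \<Longrightarrow> app (prod_list (map F_op u)) (app (rep q (serre_f a q i j)) (bas k)) \<in> serre_gens"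
| serre_e: "i \<noteq> j \<Longrightarrow> app (prod_list (map F_op x)) (app (prod_list (map (E_op q) u))
     (app (rep q (serre_e a q i j)) (bas ([], d, c, z)))) \<in> serre_gens"

definition serre_sub :: "(('i, 'k) key \<Rightarrow>\<^sub>0 'k) set" where
  "serre_sub = pm.span serre_gens"

lemma serre_sub_subspace: "pm.subspace serre_sub"
  by (simp add: serre_sub_def)

lemma serre_sub_zero [simp]: "0 \<in> serre_sub"
  by (simp add: serre_sub_def pm.span_zero)

lemma serre_sub_scale: "w \<in> serre_sub \<Longrightarrow> fscale r w \<in> serre_sub"
  by (simp add: serre_sub_def pm.span_scale)

lemma serre_sub_add: "w \<in> serre_sub \<Longrightarrow> w' \<in> serre_sub \<Longrightarrow> w + w' \<in> serre_sub"
  by (simp add: serre_sub_def pm.span_add)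

lemma serre_sub_diff: "w \<in> serre_sub \<Longrightarrow> w' \<in> serre_sub \<Longrightarrow> w - w' \<in> serre_sub"
  by (simp add: serre_sub_def pm.span_diff)

lemma serre_sub_closedI:
  assumes "\<And>w. w \<in> serre_gens \<Longrightarrow> app A w \<in> serre_sub" "w \<in> serre_sub"
  shows "app A w \<in> serre_sub"
  by (rule lin_span_mem[where f = "app A" and G = serre_gens and S = serre_sub and p = w,
        OF lin_app serre_sub_subspace assms(1) assms(2)[unfolded serre_sub_def]])

lemma serre_f_gen:
  assumes "i \<noteq> j"
  shows "app (prod_list (map F_op u)) (app (rep q (serre_f a q i j)) w) \<in> serre_sub"
proof (rule lin_mem[where f = "\<lambda>w. app (prod_list (map F_op u)) (app (rep q (serre_f a q i j)) w)",
      OF lin_comp[OF lin_app lin_app] serre_sub_subspace])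
  fix k
  show "app (prod_list (map F_op u)) (app (rep q (serre_f a q i j)) (bas k)) \<in> serre_sub"
    unfolding serre_sub_def by (rule pm.span_base, rule serre_gens.serre_f, fact)
qed

lemma serre_e_gen:
  "i \<noteq> j \<Longrightarrow> app (prod_list (map F_op x)) (app (prod_list (map (E_op q) u))
     (app (rep q (serre_e a q i j)) (bas ([], d, c, z)))) \<in> serre_sub"
  unfolding serre_sub_def by (rule pm.span_base, rule serre_gens.serre_e)

lemma F_op_serre_sub: "w \<in> serre_sub \<Longrightarrow> app (F_op l) w \<in> serre_sub"
proof (erule serre_sub_closedI[rotated])
  fix w assume "w \<in> serre_gens"
  then show "app (F_op l) w \<in> serre_sub"
  proof cases
    case (serre_f i j u k)
    then show ?thesis using serre_f_gen[of i j "l # u" "bas k"] by simp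
  next
    case (serre_e i j x u d c z)
    then show ?thesis using serre_e_gen[of i j "l # x" u d c z] by simp
  qed
qed

lemma F_word_serre_sub: "w \<in> serre_sub \<Longrightarrow> app (prod_list (map F_op u)) w \<in> serre_sub"
  by (induction u) (simp_all add: F_op_serre_sub)

text \<open>Homogeneity of weight \<open>r\<close> under the torus. All operators in
  \<open>serre_gens\<close> are homogeneous, so \<open>T_op\<close> can be moved through them onto
  the basis vector at the cost of a scalar.\<close>

definition skew :: "'i generator \<Rightarrow> 'k \<Rightarrow> (('i, 'k) key, 'k) lin_end \<Rightarrow> bool" where
  "skew g r A \<longleftrightarrow> T_op q g * A = sc r * (A * T_op q g)"

lemma skew_mult:
  assumes "skew g r A" "skew g s B"
  shows "skew g (r * s) (A * B)"
proof -
  have "T_op q g * (A * B) = sc r * (A * (T_op q g * B))"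
    using assms(1) by (simp only: skew_def mult.assoc[symmetric])
  also have "\<dots> = sc (r * s) * (A * B * T_op q g)"
    using assms(2) by (simp only: skew_def sc_slide[of A] mult.assoc sc_hom)
  finally show ?thesis by (simp only: skew_def)
qed

lemma skew_scale:
  assumes "skew g r A"
  shows "skew g r (sc c * A)"
proof -
  have "T_op q g * (sc c * A) = sc c * (sc r * (A * T_op q g))"
    using assms by (simp only: skew_def sc_slide[of "T_op q g"])
  also have "\<dots> = sc r * (sc c * A * T_op q g)"
    by (simp only: mult.assoc[symmetric] sc_hom(4)[symmetric] mult.commute[of c r])
  finally show ?thesis by (simp only: skew_def)
qed

lemma skew_diff: "skew g r A \<Longrightarrow> skew g r B \<Longrightarrow> skew g r (A - B)"
  by (simp add: skew_def left_diff_distrib right_diff_distrib)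

lemma skew_ops: "skew g (inverse (wt q g i)) (F_op i)" "skew g (wt q g i) (E_op q i)"
  unfolding skew_def by (rule T_op_F_op T_op_E_op)+

lemma skew_words: "\<exists>r. skew g r (prod_list (map F_op u))" "\<exists>r. skew g r (prod_list (map (E_op q) u))"
proof -
  have 1: "skew g 1 1" by (simp add: skew_def sc_hom)
  show "\<exists>r. skew g r (prod_list (map F_op u))"
  proof (induction u)
    case (Cons i u)
    then obtain r where "skew g r (prod_list (map F_op u))" ..
    from skew_mult[OF skew_ops(1)[of g i] this] show ?case by auto
  qed (use 1 in auto)
  show "\<exists>r. skew g r (prod_list (map (E_op q) u))"
  proof (induction u)
    case (Cons i u)
    then obtain r where "skew g r (prod_list (map (E_op q) u))" ..
    from skew_mult[OF skew_ops(2)[of g i] this] show ?case by auto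
  qed (use 1 in auto)
qed

lemma skew_Ye: "skew g (wt q g i ^ n * wt q g j) (Ye i j n)"
proof (induction n)
  case (Suc n)
  show ?case
    unfolding Ye_rec
    using skew_mult[OF skew_ops(2) Suc, of i] skew_mult[OF Suc skew_ops(2), of i]
    by (intro skew_diff skew_scale) (simp_all only: power_Suc ac_simps)
qed (simp add: Ye_rec skew_ops)

lemma skew_Yf: "skew g (inverse (wt q g i) ^ n * inverse (wt q g j)) (Yf i j n)"
proof (induction n)
  case (Suc n)
  show ?case
    unfolding Yf_rec
    using skew_mult[OF skew_ops(1) Suc, of i] skew_mult[OF Suc skew_ops(1), of i]
    by (intro skew_diff skew_scale) (simp_all only: power_Suc ac_simps)
qed (simp add: Yf_rec skew_ops)

lemma skew_app:
  assumes "skew g r A"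
  shows "app (T_op q g) (app A w) = fscale r (app A (app (T_op q g) w))"
  using arg_cong[OF assms[unfolded skew_def], of "\<lambda>B. app B w"] by simp

lemma T_op_bas: "\<exists>r d' c'. app (T_op q g) (bas (x, d, c, z)) = fscale r (bas (x, d', c', z))"
proof -
  have "app (T_op q g) (bas (x, d, c, z)) = fscale (\<Prod>j\<leftarrow>x. inverse (wt q g j))
      (bas (x, \<lambda>h. delta g h + d h, \<lambda>i. wt q g i * c i, z))"
    by (simp add: T_op_single)
  then show ?thesis by blast
qed

lemma T_op_serre_sub: "w \<in> serre_sub \<Longrightarrow> app (T_op q g) w \<in> serre_sub"
proof (erule serre_sub_closedI[rotated])
  fix w assume "w \<in> serre_gens"
  then show "app (T_op q g) w \<in> serre_sub"
  proof cases
    case (serre_f i j u k)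
    obtain r where "skew g r (prod_list (map F_op u))" using skew_words by blast
    moreover obtain s where "skew g s (rep q (serre_f a q i j))"
      using skew_Yf[of g i "nat (1 - a i j)" j] by (auto simp: rep_serre_f)
    ultimately show ?thesis
      using serre_f by (simp add: skew_app serre_sub_scale serre_f_gen)
  next
    case (serre_e i j x u d c z)
    obtain r where "skew g r (prod_list (map F_op x))" using skew_words by blast
    moreover obtain r' where "skew g r' (prod_list (map (E_op q) u))" using skew_words by blast
    moreover obtain s where "skew g s (rep q (serre_e a q i j))"
      using skew_Ye[of g i "nat (1 - a i j)" j] by (auto simp: rep_serre_e)
    moreover obtain t d' c' where "app (T_op q g) (bas ([], d, c, z)) = fscale t (bas ([], d', c', z))"
      using T_op_bas by blast
    ultimately show ?thesis
      using serre_e by (simp add: skew_app serre_sub_scale serre_e_gen del: fscale_single)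
  qed
qed

text \<open>Moving \<open>E_op l\<close> through the word leaves torus operators acting on shorter
  words applied to \<open>w\<close>; this is why \<open>w\<close> itself must lie in
  \<open>serre_sub\<close>, and why stability under \<open>T_op\<close> comes first.\<close>

lemma E_op_F_word_serre_sub:
  assumes "app (E_op q l) w \<in> serre_sub" "w \<in> serre_sub"
  shows "app (E_op q l) (app (prod_list (map F_op u)) w) \<in> serre_sub"
proof (induction u)
  case (Cons j u)
  let ?w = "app (prod_list (map F_op u)) w"
  define D where "D = (if l = j then sc (c\<^sub>0 l) * (T_op q (\<Omega> l) - T_op q (\<Omega>' l)) else 0)"
  have w: "?w \<in> serre_sub" by (rule F_word_serre_sub[OF assms(2)])
  have "E_op q l * F_op j = F_op j * E_op q l + D"
    using E_op_F_op[of l j] unfolding D_def by (simp only: diff_eq_eq add.commute)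
  from arg_cong[OF this, of "\<lambda>A. app A ?w"]
  have "app (E_op q l) (app (F_op j) ?w) = app (F_op j) (app (E_op q l) ?w) + app D ?w"
    by simp
  moreover have "app D ?w \<in> serre_sub"
    using w by (simp add: D_def serre_sub_scale serre_sub_diff T_op_serre_sub del: pm.scale_right_diff_distrib)
  ultimately show ?case
    using Cons by (simp add: serre_sub_add F_op_serre_sub)
qed (simp add: assms)

text \<open>Past the \<open>f\<close>-word, \<open>E_op l\<close> commutes with an
  \<open>f\<close>-Serre operator by \<open>Yf_commute\<close>, so that operator is merely applied
  to another vector; in front of an \<open>e\<close>-generator it just lengthens the word
  \<open>u\<close>.\<close>

lemma E_op_serre_sub: "w \<in> serre_sub \<Longrightarrow> app (E_op q l) w \<in> serre_sub"
proof (erule serre_sub_closedI[rotated])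
  fix w assume "w \<in> serre_gens"
  then show "app (E_op q l) w \<in> serre_sub"
  proof cases
    case (serre_f i j u k)
    have "app (E_op q l) (app (rep q (serre_f a q i j)) (bas k))
        = app (rep q (serre_f a q i j)) (app (E_op q l) (bas k))"
      using arg_cong[OF Yf_commute[OF serre_f(2), of l], of "\<lambda>A. app A (bas k)"]
      by (simp add: rep_serre_f nat_serre[OF serre_f(2)])
    then show ?thesis
      unfolding serre_f(1) using serre_f_gen[OF serre_f(2), of "[]"]
      by (intro E_op_F_word_serre_sub) simp_all
  next
    case (serre_e i j x u d c z)
    then show ?thesis
      unfolding serre_e(1) using serre_e_gen[OF serre_e(2), of "[]" u] serre_e_gen[OF serre_e(2), of "[]" "l # u"]
      by (intro E_op_F_word_serre_sub) simp_all
  qed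
qed

lemma gen_op_serre_sub: "w \<in> serre_sub \<Longrightarrow> app (gen_op q g) w \<in> serre_sub"
  by (cases g) (simp_all add: F_op_serre_sub E_op_serre_sub T_op_serre_sub)

lemma rep_serre_sub:
  assumes "w \<in> serre_sub"
  shows "app (rep q p) w \<in> serre_sub"
proof (rule lin_mem[where f = "\<lambda>p. app (rep q p) w", OF lin_alg_ext serre_sub_subspace])
  fix u :: "'i generator word"
  obtain xs where u: "u = Word xs" by (cases u)
  have "app (prod_list (map (gen_op q) xs)) w \<in> serre_sub"
    using assms by (induction xs) (simp_all add: gen_op_serre_sub)
  then show "app (rep q (bas u)) w \<in> serre_sub"
    unfolding u wd_def[symmetric] alg_ext_wd .
qed

text \<open>\<open>Ye_commute\<close> carries the Serre operator through the whole
  \<open>f\<close>-word to a vector without \<open>f\<close>-letters, as the second clause of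
  \<open>serre_gens\<close> requires.\<close>

lemma serre_e_annihilates:
  assumes "i \<noteq> j"
  shows "app (rep q (serre_e a q i j)) w \<in> serre_sub"
proof (rule lin_mem[OF lin_app serre_sub_subspace])
  fix k :: "('i, 'k) key"
  obtain x d c z where k: "k = (x, d, c, z)" by (cases k) auto
  have comm: "rep q (serre_e a q i j) * F_op l = F_op l * rep q (serre_e a q i j)" for l
    using Ye_commute[OF assms, of l] by (simp only: rep_serre_e nat_serre[OF assms])
  have "rep q (serre_e a q i j) * prod_list (map F_op x) = prod_list (map F_op x) * rep q (serre_e a q i j)"
  proof (induction x)
    case (Cons l x)
    have "rep q (serre_e a q i j) * prod_list (map F_op (l # x))
        = F_op l * (rep q (serre_e a q i j) * prod_list (map F_op x))"
      by (simp only: list.map prod_list.Cons mult.assoc[symmetric] comm)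
    then show ?case by (simp only: Cons list.map prod_list.Cons mult.assoc)
  qed simp
  from arg_cong[OF this, of "\<lambda>A. app A (bas ([], d, c, z))"]
  have "app (rep q (serre_e a q i j)) (bas k)
      = app (prod_list (map F_op x)) (app (rep q (serre_e a q i j)) (bas ([], d, c, z)))"
    by (simp add: F_word_bas k)
  then show "app (rep q (serre_e a q i j)) (bas k) \<in> serre_sub"
    using serre_e_gen[OF assms, of x "[]"] by simp
qed

lemma T_op_conj:
  assumes "g \<in> torus_generators"
  shows "T_op q g * E_op q i * T_op q (ginv g) = sc (wt q g i) * E_op q i"
    "T_op q g * F_op i * T_op q (ginv g) = sc (inverse (wt q g i)) * F_op i"
  by (simp_all only: T_op_E_op T_op_F_op mult.assoc T_op_ginv[OF assms] mult_1_right)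

lemma rep_relator:
  assumes "p \<in> Uq_relators a q"
  shows "app (rep q p) w \<in> serre_sub"
proof -
  note rep_simps = alg_ext_mult alg_ext_diff alg_ext_gen alg_ext_scalar alg_ext_1 alg_ext_0
  have torus: "\<Omega> i \<in> torus_generators" "\<Omega>' i \<in> torus_generators" for i :: 'i
    by (simp_all add: torus_generators_def)
  note conj = T_op_conj[OF torus(1), unfolded ginv.simps wt.simps] T_op_conj[OF torus(2), unfolded ginv.simps wt.simps]
  have T_inv: "T_op q (\<Omega> i) * T_op q (\<Omega>inv i) = 1" "T_op q (\<Omega>' i) * T_op q (\<Omega>'inv i) = 1" for i
    using T_op_ginv[OF torus(1)] T_op_ginv[OF torus(2)] by simp_all
  consider (torus) g h where "p = gen g * gen h - gen h * gen g" "g \<in> torus_generators" "h \<in> torus_generators"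
    | (inv) i where "p = \<omega> i * \<omega>inv i - 1 \<or> p = \<omega>' i * \<omega>'inv i - 1"
    | (we) i j where "p = \<omega> i * ee j * \<omega>inv i - scalar (q i j) * ee j
        \<or> p = \<omega>' i * ee j * \<omega>'inv i - scalar (inverse (q j i)) * ee j"
    | (wf) i j where "p = \<omega> i * ff j * \<omega>inv i - scalar (inverse (q i j)) * ff j
        \<or> p = \<omega>' i * ff j * \<omega>'inv i - scalar (q j i) * ff j"
    | (ef) i j where "p = ee i * ff j - ff j * ee i
        - (if i = j then scalar (c\<^sub>0 i) * (\<omega> i - \<omega>' i) else 0)"
    | (serre) i j where "p = serre_e a q i j \<or> p = serre_f a q i j" "i \<noteq> j"
    using assms unfolding Uq_relators_def by blast
  then show ?thesis
  proof cases
    case torus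
    have "rep q p = 0"
      unfolding torus(1) rep_simps by (simp add: gen_op_torus torus T_op_comm[of q g h])
    then show ?thesis by simp
  next
    case inv
    then have "rep q p = 0" by (auto simp: rep_simps T_inv)
    then show ?thesis by simp
  next
    case we
    then have "rep q p = 0" by (auto simp: rep_simps conj)
    then show ?thesis by simp
  next
    case wf
    then have "rep q p = 0" by (auto simp: rep_simps conj)
    then show ?thesis by simp
  next
    case ef
    then have "rep q p = 0" by (auto simp: rep_simps E_op_F_op)
    then show ?thesis by simp
  next
    case serre
    then show ?thesis using serre_e_annihilates serre_f_gen[of i j "[]"] by auto
  qed
qed

section \<open>The defining ideal and its action\<close>

lemma ring_of_type_algebra_simps:
  "carrier ring_of_type_algebra = UNIV" "x \<otimes>\<^bsub>ring_of_type_algebra\<^esub> y = x * y"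
  "x \<oplus>\<^bsub>ring_of_type_algebra\<^esub> y = x + y" "\<zero>\<^bsub>ring_of_type_algebra\<^esub> = 0" "\<one>\<^bsub>ring_of_type_algebra\<^esub> = 1"
  by (simp_all add: ring_of_type_algebra_def)

lemma ring_ring_of_type_algebra: "ring (ring_of_type_algebra :: 'r::ring_1 ring)"
proof -
  have "\<exists>y. x + y = 0" for x :: 'r
    using add.right_inverse by blast
  then show ?thesis
    unfolding ring_of_type_algebra_def using add.right_inverse
    by unfold_locales (auto simp: algebra_simps Units_def)
qed

lemma idealI_type_algebra:
  assumes "0 \<in> I" "\<And>x y. x \<in> I \<Longrightarrow> y \<in> I \<Longrightarrow> x + y \<in> I"
    "\<And>x y. x \<in> I \<Longrightarrow> x * y \<in> I" "\<And>x y. x \<in> I \<Longrightarrow> y * x \<in> I"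
  shows "ideal (I :: 'r::ring_1 set) ring_of_type_algebra"
proof (rule idealI)
  interpret R: ring "ring_of_type_algebra :: 'r ring" by (rule ring_ring_of_type_algebra)
  show "ring (ring_of_type_algebra :: 'r ring)" by (rule ring_ring_of_type_algebra)
  have "\<ominus>\<^bsub>ring_of_type_algebra\<^esub> x \<in> I" if "x \<in> I" for x
  proof -
    have "\<ominus>\<^bsub>ring_of_type_algebra\<^esub> x = - x"
      using R.minus_equality[of "- x" x] by (simp add: ring_of_type_algebra_simps)
    then show ?thesis using assms(3)[OF that, of "- 1"] by simp
  qed
  then show "subgroup I (add_monoid ring_of_type_algebra)"
    using assms(1,2) by (intro R.add.subgroupI)
      (auto simp: ring_of_type_algebra_simps a_inv_def)
qed (use assms in \<open>auto simp: ring_of_type_algebra_simps\<close>)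

text \<open>The elements that map every vector into \<open>serre_sub\<close> form a two-sided ideal:
  right multiples only change the argument, and left multiples are covered by the stability of
  \<open>serre_sub\<close>.\<close>

lemma rep_Uq_ideal:
  assumes "p \<in> Uq_ideal a q"
  shows "app (rep q p) w \<in> serre_sub"
proof -
  interpret R: ring "ring_of_type_algebra :: ('i generator, 'k) free_alg ring"
    by (rule ring_ring_of_type_algebra)
  let ?I = "{p. \<forall>w. app (rep q p) w \<in> serre_sub}"
  have "ideal ?I ring_of_type_algebra"
    by (rule idealI_type_algebra)
      (auto simp: alg_ext_0 alg_ext_add alg_ext_mult serre_sub_add rep_serre_sub)
  moreover have "Uq_relators a q \<subseteq> ?I" using rep_relator by blast
  ultimately show ?thesis
    using R.genideal_minimal[of ?I "Uq_relators a q"] assms by (auto simp: Uq_ideal_def)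
qed

lemma torus_deg_simps [simp]: "torus_deg [] = (\<lambda>_. 0)" "torus_deg (g # t) = (\<lambda>h. delta g h + torus_deg t h)"
  by (auto simp: torus_deg_def)

lemma wts_simps [simp]: "wts q [] = (\<lambda>_. 1)" "wts q (g # t) = (\<lambda>i. wt q g i * wts q t i)"
  by (auto simp: wts_def)

text \<open>The cyclic vector stands for 1. A normally ordered word builds its key from the right
  without any reordering: \<open>E_op\<close> acts where \<open>c\<close> is constantly 1, and
  \<open>T_op\<close> before any \<open>f\<close>-letter is present. So no scalar appears.\<close>

lemma rep_normal_word:
  assumes "set t \<subseteq> torus_generators"
  shows "app (rep q (wd (map F x @ t @ map E z))) (bas ([], \<lambda>_. 0, \<lambda>_. 1, [])) = bas (x, torus_deg t, wts q t, z)"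
proof -
  have E: "app (prod_list (map (gen_op q \<circ> E) z)) (bas ([], \<lambda>_. 0, \<lambda>_. 1, []))
      = bas ([], \<lambda>_. 0, \<lambda>_. 1, z)"
    by (induction z) (simp_all add: E_op_single)
  have T: "app (prod_list (map (gen_op q) t)) (bas ([], \<lambda>_. 0, \<lambda>_. 1, z)) = bas ([], torus_deg t, wts q t, z)"
    using assms by (induction t) (simp_all add: T_op_single gen_op_torus)
  have F: "gen_op q \<circ> F = F_op" by auto
  show ?thesis by (simp add: alg_ext_wd F E T F_word_bas)
qed

end

text \<open>Turns span membership into an explicit coefficient family, which can then be fed to both
  \<open>normal_word\<close> and \<open>triple_word\<close>.\<close>

lemma span_image_ext:
  assumes "p \<in> pm.span (f ` A)"
  shows "\<exists>w. Poly_Mapping.keys w \<subseteq> A \<and> p = pm_ext f w"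
  using assms
proof (induction rule: pm.span_induct_alt)
  case base
  show ?case by (intro exI[of _ 0]) simp
next
  case (step c x y)
  from step(1) obtain k where k: "x = f k" "k \<in> A" by blast
  from step(2) obtain w where w: "Poly_Mapping.keys w \<subseteq> A" "y = pm_ext f w" by blast
  have "Poly_Mapping.keys (Poly_Mapping.single k c + w) \<subseteq> insert k (Poly_Mapping.keys w)"
    using Poly_Mapping.keys_add[of "Poly_Mapping.single k c" w] by (auto split: if_splits)
  then have "Poly_Mapping.keys (Poly_Mapping.single k c + w) \<subseteq> A"
    using k w by blast
  moreover have "fscale c x + y = pm_ext f (Poly_Mapping.single k c + w)"
    by (simp add: k w)
  ultimately show ?case by blast
qed

context quantum_parameters begin

section \<open>Normally ordered words span\<close>

abbreviation "J \<equiv> Uq_ideal a q"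

lemma J_ideal: "ideal J ring_of_type_algebra"
proof -
  interpret R: ring "ring_of_type_algebra :: ('i generator, 'k) free_alg ring"
    by (rule ring_ring_of_type_algebra)
  show ?thesis
    unfolding Uq_ideal_def by (rule R.genideal_ideal) (simp add: ring_of_type_algebra_simps)
qed

lemma J_relator: "p \<in> Uq_relators a q \<Longrightarrow> p \<in> J"
proof -
  interpret R: ring "ring_of_type_algebra :: ('i generator, 'k) free_alg ring"
    by (rule ring_ring_of_type_algebra)
  show "p \<in> Uq_relators a q \<Longrightarrow> p \<in> J"
    unfolding Uq_ideal_def using R.genideal_self[of "Uq_relators a q"]
    unfolding ring_of_type_algebra_simps by blast
qed

lemma J_mult: "p \<in> J \<Longrightarrow> p * r \<in> J" "p \<in> J \<Longrightarrow> r * p \<in> J"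
  using ideal.I_r_closed[OF J_ideal, of p r] ideal.I_l_closed[OF J_ideal, of p r]
  by (simp_all add: ring_of_type_algebra_simps)

lemma J_subspace: "pm.subspace J"
proof (rule pm.subspaceI)
  show "0 \<in> J"
    using additive_subgroup.zero_closed[OF ideal.axioms(1)[OF J_ideal]]
    by (simp add: ring_of_type_algebra_simps)
  show "x + y \<in> J" if "x \<in> J" "y \<in> J" for x y
    using additive_subgroup.a_closed[OF ideal.axioms(1)[OF J_ideal] that]
    by (simp add: ring_of_type_algebra_simps)
  show "fscale c x \<in> J" if "x \<in> J" for c x
    using J_mult(2)[OF that, of "scalar c"] by (simp add: scalar_mult)
qed

lemmas J_closed = pm.subspace_add[OF J_subspace] pm.subspace_diff[OF J_subspace]
  pm.subspace_neg[OF J_subspace] pm.subspace_scale[OF J_subspace] pm.subspace_0[OF J_subspace]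

lemma J_trans: "x - y \<in> J \<Longrightarrow> y - z \<in> J \<Longrightarrow> x - z \<in> J"
  using J_closed(1)[of "x - y" "y - z"] by simp

lemma J_comm:
  "g \<in> torus_generators \<Longrightarrow> h \<in> torus_generators \<Longrightarrow> gen g * gen h - gen h * gen g \<in> J"
  by (rule J_relator, unfold Uq_relators_def, blast)

lemma torus_ginv: "g \<in> torus_generators \<Longrightarrow> ginv g \<in> torus_generators"
  by (auto simp: torus_generators_def)

lemma J_ginv:
  assumes "g \<in> torus_generators"
  shows "gen g * gen (ginv g) - 1 \<in> J"
proof -
  have 1: "\<omega> i * \<omega>inv i - 1 \<in> J" "\<omega>' i * \<omega>'inv i - 1 \<in> J" for i
    by (rule J_relator, unfold Uq_relators_def, blast)+
  have 2: "\<omega>inv i * \<omega> i - 1 \<in> J" for i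
    by (rule J_trans[OF J_comm 1(1)]) (simp_all add: torus_generators_def)
  have 3: "\<omega>'inv i * \<omega>' i - 1 \<in> J" for i
    by (rule J_trans[OF J_comm 1(2)]) (simp_all add: torus_generators_def)
  from assms show ?thesis
    by (cases rule: torus_cases) (simp_all only: 1 2 3 ginv.simps)
qed

lemma J_skew_conj:
  assumes "h * g - 1 \<in> J" "g * y * h - fscale r y \<in> J"
  shows "g * y - fscale r (y * g) \<in> J"
proof -
  have "g * y - fscale r (y * g) = (g * y * h - fscale r y) * g - g * y * (h * g - 1)"
    by (simp add: algebra_simps fscale_mult)
  then show ?thesis using assms by (simp add: J_closed J_mult)
qed

text \<open>The relators state the commutation for \<open>\<omega>\<close> and
  \<open>\<omega>'\<close> only; this transfers it to their inverses.\<close>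

lemma J_skew_inverse:
  assumes "g * h - 1 \<in> J" "h * g - 1 \<in> J" "g * y - fscale r (y * g) \<in> J" "r \<noteq> 0"
  shows "h * y - fscale (inverse r) (y * h) \<in> J"
proof -
  have "h * y - fscale (inverse r) (y * h) = fscale (inverse r) ((h * g - 1) * (y * h))
      - h * y * (g * h - 1) - fscale (inverse r) (h * (g * y - fscale r (y * g)) * h)"
    using assms(4) by (simp add: algebra_simps fscale_mult)
  then show ?thesis using assms by (simp add: J_closed J_mult)
qed

lemma J_torus_F: "g \<in> torus_generators \<Longrightarrow> gen g * ff j - fscale (inverse (wt q g j)) (ff j * gen g) \<in> J"
  and J_torus_E: "g \<in> torus_generators \<Longrightarrow> gen g * ee j - fscale (wt q g j) (ee j * gen g) \<in> J"
proof -
  have rel: "\<omega> i * ee j * \<omega>inv i - fscale (q i j) (ee j) \<in> J"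
    "\<omega>' i * ee j * \<omega>'inv i - fscale (inverse (q j i)) (ee j) \<in> J"
    "\<omega> i * ff j * \<omega>inv i - fscale (inverse (q i j)) (ff j) \<in> J"
    "\<omega>' i * ff j * \<omega>'inv i - fscale (q j i) (ff j) \<in> J" for i
    unfolding scalar_mult[symmetric] by (rule J_relator, unfold Uq_relators_def, blast)+
  have inv: "\<omega> i * \<omega>inv i - 1 \<in> J" "\<omega>' i * \<omega>'inv i - 1 \<in> J"
    "\<omega>inv i * \<omega> i - 1 \<in> J" "\<omega>'inv i * \<omega>' i - 1 \<in> J" for i
    using J_ginv[of "\<Omega> i"] J_ginv[of "\<Omega>' i"] J_ginv[of "\<Omega>inv i"] J_ginv[of "\<Omega>'inv i"]
    by (simp_all add: torus_generators_def)
  note c = J_skew_conj[OF inv(3) rel(1)] J_skew_conj[OF inv(4) rel(2)]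
    J_skew_conj[OF inv(3) rel(3)] J_skew_conj[OF inv(4) rel(4)]
  note q' = nonzero_imp_inverse_nonzero[OF q_nonzero]
  note d = J_skew_inverse[OF inv(1,3) c(1) q_nonzero] J_skew_inverse[OF inv(2,4) c(2) q']
    J_skew_inverse[OF inv(1,3) c(3) q'] J_skew_inverse[OF inv(2,4) c(4) q_nonzero]
  show "gen g * ff j - fscale (inverse (wt q g j)) (ff j * gen g) \<in> J"
    if "g \<in> torus_generators"
    using that by (cases rule: torus_cases) (simp_all only: c d[unfolded inverse_inverse_eq] wt.simps inverse_inverse_eq)
  show "gen g * ee j - fscale (wt q g j) (ee j * gen g) \<in> J"
    if "g \<in> torus_generators"
    using that by (cases rule: torus_cases) (simp_all only: c d[unfolded inverse_inverse_eq] wt.simps)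
qed

lemma J_E_torus:
  assumes "g \<in> torus_generators"
  shows "ee j * gen g - fscale (inverse (wt q g j)) (gen g * ee j) \<in> J"
  using J_closed(4)[OF J_torus_E[OF assms, of j], of "- inverse (wt q g j)"]
  by (simp add: pm.scale_right_diff_distrib algebra_simps)

lemma J_E_F: "ee i * ff j - ff j * ee i - (if i = j then fscale (c\<^sub>0 i) (\<omega> i - \<omega>' i) else 0) \<in> J"
  unfolding scalar_mult[symmetric] by (rule J_relator, unfold Uq_relators_def, blast)

definition normal_word :: "'i list \<times> 'i generator list \<times> 'i list \<Rightarrow> ('i generator, 'k) free_alg" where
  "normal_word = (\<lambda>(x, t, z). wd (map F x @ t @ map E z))"

text \<open>The torus part is an arbitrary unreduced word, so distinct keys may give the same class;
  \<open>J_torus_deg_eq\<close> settles when torus words agree modulo \<open>J\<close>.\<close>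

definition normal_keys :: "('i list \<times> 'i generator list \<times> 'i list) set" where
  "normal_keys = {(x, t, z). set t \<subseteq> torus_generators}"

text \<open>Including \<open>J\<close> in the span lets every rewriting modulo \<open>J\<close> stay
  inside one subspace of the free algebra.\<close>

definition normal_span :: "('i generator, 'k) free_alg set" where
  "normal_span = pm.span (normal_word ` normal_keys \<union> J)"

lemma normal_span_subspace: "pm.subspace normal_span"
  by (simp add: normal_span_def)

lemma J_normal_span: "p \<in> J \<Longrightarrow> p \<in> normal_span"
  by (simp add: normal_span_def pm.span_base)

lemma normal_word_normal_span:
  "set t \<subseteq> torus_generators \<Longrightarrow> wd (map F x @ t @ map E z) \<in> normal_span"
  unfolding normal_span_def
  by (rule pm.span_base, rule UnI1, rule image_eqI[of _ _ "(x, t, z)"])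
    (auto simp: normal_word_def normal_keys_def)

lemma normal_span_cong: "p - r \<in> J \<Longrightarrow> r \<in> normal_span \<Longrightarrow> p \<in> normal_span"
  using pm.subspace_add[OF normal_span_subspace, OF J_normal_span, of "p - r" r] by simp

lemma normal_span_closedI:
  assumes "\<And>x t z. set t \<subseteq> torus_generators \<Longrightarrow> r * wd (map F x @ t @ map E z) \<in> normal_span"
    and "p \<in> normal_span"
  shows "r * p \<in> normal_span"
proof (rule lin_span_mem[where f = "\<lambda>p. r * p" and S = normal_span, OF lin_times_left normal_span_subspace])
  show "p \<in> pm.span (normal_word ` normal_keys \<union> J)"
    using assms(2) by (simp only: normal_span_def)
  show "r * y \<in> normal_span" if "y \<in> normal_word ` normal_keys \<union> J" for y
    using that by (auto simp: normal_word_def normal_keys_def intro: assms(1) J_normal_span J_mult)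
qed

lemma normal_span_F: "p \<in> normal_span \<Longrightarrow> ff j * p \<in> normal_span"
proof (erule normal_span_closedI[rotated])
  fix x z :: "'i list" and t :: "'i generator list"
  assume "set t \<subseteq> torus_generators"
  then show "ff j * wd (map F x @ t @ map E z) \<in> normal_span"
    using normal_word_normal_span[of t "j # x" z] by (simp add: wd_Cons)
qed

lemma normal_span_torus:
  assumes g: "g \<in> torus_generators" and "p \<in> normal_span"
  shows "gen g * p \<in> normal_span"
  using assms(2)
proof (rule normal_span_closedI[rotated])
  fix x z :: "'i list" and t :: "'i generator list"
  assume t: "set t \<subseteq> torus_generators"
  show "gen g * wd (map F x @ t @ map E z) \<in> normal_span"
  proof (induction x)
    case Nil
    show ?case using normal_word_normal_span[of "g # t" "[]" z] g t by (simp add: wd_Cons)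
  next
    case (Cons j x)
    let ?r = "inverse (wt q g j)" and ?w = "wd (map F x @ t @ map E z)"
    have "gen g * (ff j * ?w) - fscale ?r (ff j * (gen g * ?w)) \<in> J"
      using J_mult(1)[OF J_torus_F[OF g, of j], of ?w]
      by (simp add: left_diff_distrib fscale_mult mult.assoc)
    moreover have "fscale ?r (ff j * (gen g * ?w)) \<in> normal_span"
      by (intro pm.subspace_scale[OF normal_span_subspace] normal_span_F Cons)
    ultimately show ?case by (simp add: wd_Cons normal_span_cong)
  qed
qed

lemma normal_span_E:
  assumes "p \<in> normal_span"
  shows "ee i * p \<in> normal_span"
  using assms
proof (rule normal_span_closedI[rotated])
  fix x z :: "'i list" and t :: "'i generator list"
  assume t: "set t \<subseteq> torus_generators"
  show "ee i * wd (map F x @ t @ map E z) \<in> normal_span"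
  proof (induction x)
    case Nil
    show ?case using t
    proof (induction t)
      case Nil
      show ?case using normal_word_normal_span[of "[]" "[]" "i # z"] by (simp add: wd_Cons)
    next
      case (Cons g t)
      let ?r = "inverse (wt q g i)" and ?w = "wd (t @ map E z)"
      have "ee i * (gen g * ?w) - fscale ?r (gen g * (ee i * ?w)) \<in> J"
        using J_mult(1)[OF J_E_torus[of g i], of ?w] Cons.prems
        by (simp add: left_diff_distrib fscale_mult mult.assoc)
      moreover have "fscale ?r (gen g * (ee i * ?w)) \<in> normal_span"
        by (rule pm.subspace_scale[OF normal_span_subspace], rule normal_span_torus) (use Cons in auto)
      ultimately show ?case by (simp add: wd_Cons normal_span_cong)
    qed
  next
    case (Cons j x)
    let ?w = "wd (map F x @ t @ map E z)"
    let ?D = "if i = j then fscale (c\<^sub>0 i) (\<omega> i - \<omega>' i) else 0"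
    have "ee i * (ff j * ?w) - (ff j * (ee i * ?w) + ?D * ?w) \<in> J"
      using J_mult(1)[OF J_E_F[of i j], of ?w]
      by (simp only: left_diff_distrib distrib_right mult.assoc diff_diff_add)
    \<comment> \<open>The commutator leaves torus generators in front of a normal word, which
      \<open>normal_span_torus\<close> absorbs.\<close>
    moreover have "?D * ?w \<in> normal_span"
      using normal_word_normal_span[OF t, of x z]
      by (auto simp: fscale_mult left_diff_distrib torus_generators_def pm.subspace_0[OF normal_span_subspace]
          simp del: pm.scale_right_diff_distrib
          intro!: pm.subspace_scale[OF normal_span_subspace] pm.subspace_diff[OF normal_span_subspace] normal_span_torus)
    then have "ff j * (ee i * ?w) + ?D * ?w \<in> normal_span"
      by (intro pm.subspace_add[OF normal_span_subspace] normal_span_F Cons)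
    ultimately have "ee i * (ff j * ?w) \<in> normal_span" by (rule normal_span_cong)
    then show ?case by (simp add: wd_Cons)
  qed
qed

lemma normal_span_UNIV: "p \<in> normal_span"
proof (rule pm_subspace_mem[OF normal_span_subspace])
  fix u :: "'i generator word"
  obtain xs where u: "u = Word xs" by (cases u)
  have "wd xs \<in> normal_span"
  proof (induction xs)
    case Nil
    show ?case using normal_word_normal_span[of "[]" "[]" "[]"] by simp
  next
    case (Cons g xs)
    then show ?case
      by (cases g) (auto simp: wd_Cons torus_generators_def intro: normal_span_F normal_span_E normal_span_torus)
  qed
  then show "bas u \<in> normal_span" by (simp only: u wd_def)
qed

lemma normal_form:
  obtains w where "Poly_Mapping.keys w \<subseteq> normal_keys" "p - pm_ext normal_word w \<in> J"
proof -
  have "p \<in> pm.span (normal_word ` normal_keys \<union> J)"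
    using normal_span_UNIV[of p] by (simp only: normal_span_def)
  moreover have "pm.span J = J" by (simp add: J_subspace)
  ultimately obtain x y where "p = x + y" "x \<in> pm.span (normal_word ` normal_keys)" "y \<in> J"
    unfolding pm.span_Un by auto
  with span_image_ext[of x normal_word normal_keys] show ?thesis
    using that by auto
qed

section \<open>Torus words of equal degree\<close>

lemma torus_deg_append: "torus_deg (t @ u) h = torus_deg t h + torus_deg u h"
  by (simp add: torus_deg_def)

lemma torus_deg_map_ginv: "torus_deg (map ginv t) h = - torus_deg t h"
  by (induction t) (simp_all add: delta_ginv)

lemma J_torus_move:
  assumes "g \<in> torus_generators" "set u \<subseteq> torus_generators"
  shows "gen g * wd u - wd u * gen g \<in> J"
  using assms(2)
proof (induction u)
  case Nil
  show ?case by (simp add: wd_Nil J_closed)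
next
  case (Cons h u)
  have "gen g * wd (h # u) - wd (h # u) * gen g
      = (gen g * gen h - gen h * gen g) * wd u + gen h * (gen g * wd u - wd u * gen g)"
    by (simp add: wd_Cons algebra_simps)
  also have "\<dots> \<in> J"
    by (rule J_closed(1); rule J_mult) (use Cons assms(1) in \<open>simp_all add: J_comm\<close>)
  finally show ?case .
qed

text \<open>The first letter \<open>g\<close> contributes 1 to the exponent at \<open>g\<close>, so
  total degree 0 forces \<open>ginv g\<close> to occur later; move it next to \<open>g\<close>,
  cancel the pair, and use induction on the length.\<close>

lemma J_torus_deg_0:
  assumes "set t \<subseteq> torus_generators" "\<And>h. torus_deg t h = 0"
  shows "wd t - 1 \<in> J"
  using assms
proof (induction t rule: length_induct)
  case (1 t)
  show ?case
  proof (cases t)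
    case Nil
    then show ?thesis by (simp add: wd_Nil J_closed)
  next
    case (Cons g t')
    have g: "g \<in> torus_generators" using 1(2) Cons by simp
    have "delta g g = 1" using g by (auto simp: delta_def elim!: torus_cases)
    then have neg: "torus_deg t' g = -1" using 1(3)[of g] Cons by simp
    have "\<exists>h\<in>set t'. delta h g < 0"
    proof (rule ccontr)
      assume "\<not> (\<exists>h\<in>set t'. delta h g < 0)"
      then have "0 \<le> torus_deg t' g"
        unfolding torus_deg_def by (intro sum_list_nonneg) force
      then show False using neg by simp
    qed
    then obtain h where h: "h \<in> set t'" "g = ginv h" by (auto simp: delta_def split: if_splits)
    then obtain u v where uv: "t' = u @ ginv g # v" by (metis ginv_ginv split_list)
    have "wd t - wd (u @ v) = gen g * (wd u * gen (ginv g)) * wd v - wd u * wd v"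
      by (simp add: Cons uv wd_Cons wd_mult[symmetric] mult.assoc)
    also have "\<dots> = (gen g * gen (ginv g) - 1) * wd u * wd v
        - gen g * (gen (ginv g) * wd u - wd u * gen (ginv g)) * wd v"
      by (simp add: algebra_simps)
    also have "\<dots> \<in> J"
      using g 1(2) Cons uv by (intro J_closed J_mult J_ginv J_torus_move torus_ginv) auto
    finally have "wd t - wd (u @ v) \<in> J" .
    moreover have "torus_deg (u @ v) h = 0" for h
      using 1(3)[of h] by (simp add: Cons uv torus_deg_append delta_ginv)
    then have "wd (u @ v) - 1 \<in> J" using 1(1,2) by (auto simp: Cons uv)
    ultimately show ?thesis by (rule J_trans)
  qed
qed

lemma J_torus_deg_eq:
  assumes "set t \<subseteq> torus_generators" "set t' \<subseteq> torus_generators" "torus_deg t = torus_deg t'"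
  shows "wd t - wd t' \<in> J"
proof -
  \<comment> \<open>An inverse of \<open>t\<close> modulo \<open>J\<close>; the order of letters
    need not be reversed, because only degrees enter \<open>J_torus_deg_0\<close>.\<close>
  let ?s = "map ginv t"
  have s: "set ?s \<subseteq> torus_generators" using assms(1) torus_ginv by auto
  have "wd (t @ ?s) - 1 \<in> J" "wd (?s @ t') - 1 \<in> J"
    by (rule J_torus_deg_0; use assms s in \<open>simp add: torus_deg_append torus_deg_map_ginv\<close>)+
  then have mem: "(wd (t @ ?s) - 1) * wd t' - wd t * (wd (?s @ t') - 1) \<in> J"
    using J_closed(2)[OF J_mult(1) J_mult(2)] by blast
  have "wd t - wd t' = (wd (t @ ?s) - 1) * wd t' - wd t * (wd (?s @ t') - 1)"
    by (simp add: algebra_simps wd_mult)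
  with mem show ?thesis by metis
qed

end

section \<open>Maps out of tensor products\<close>

text \<open>Maps such as \<open>p\<close> to \<open>bas (tensor_class M N p, z)\<close> are not
  linear into the free vector space, but become so modulo the tensor relators.\<close>

definition lin_mod ::
  "('x \<Rightarrow>\<^sub>0 'k::field) set \<Rightarrow> ('y \<Rightarrow>\<^sub>0 'k) set \<Rightarrow> (('x \<Rightarrow>\<^sub>0 'k) \<Rightarrow> ('y \<Rightarrow>\<^sub>0 'k)) \<Rightarrow> bool" where
  "lin_mod V S h \<longleftrightarrow> (\<forall>x\<in>V. \<forall>y\<in>V. h (x + y) - (h x + h y) \<in> S) \<and>
     (\<forall>c. \<forall>x\<in>V. h (fscale c x) - fscale c (h x) \<in> S)"

lemma lin_mod_zero:
  assumes "lin_mod V S h" "pm.subspace V"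
  shows "h 0 \<in> S"
proof -
  have "0 \<in> V" using assms(2) by (rule pm.subspace_0)
  then have "h (fscale 0 0) - fscale 0 (h 0) \<in> S" using assms(1) unfolding lin_mod_def by blast
  then show ?thesis by simp
qed

lemma lin_mod_mem:
  assumes h: "lin_mod V S h" and V: "pm.subspace V" and T: "pm.subspace T" "S \<subseteq> T"
    and G: "G \<subseteq> V" "\<And>g. g \<in> G \<Longrightarrow> h g \<in> T" and p: "p \<in> pm.span G"
  shows "h p \<in> T"
proof -
  have "p \<in> V \<and> h p \<in> T"
    using p
  proof (induction rule: pm.span_induct_alt)
    case base
    show ?case using lin_mod_zero[OF h V] V T by (auto intro: pm.subspace_0)
  next
    case (step c x y)
    have xV: "x \<in> V" and hx: "h x \<in> T" using step(1) G by auto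
    have cV: "fscale c x \<in> V" by (rule pm.subspace_scale[OF V xV])
    have "h (fscale c x) - fscale c (h x) \<in> T"
      using h xV T unfolding lin_mod_def by blast
    from pm.subspace_add[OF T(1) this pm.subspace_scale[OF T(1) hx, of c]]
    have 1: "h (fscale c x) \<in> T" by simp
    have "h (fscale c x + y) - (h (fscale c x) + h y) \<in> T"
      using h cV step T unfolding lin_mod_def by blast
    moreover have "h (fscale c x) + h y \<in> T"
      using pm.subspace_add[OF T(1) 1] step by blast
    ultimately have "h (fscale c x + y) \<in> T"
      using pm.subspace_add[OF T(1)] by fastforce
    then show ?case using pm.subspace_add[OF V cV] step by blast
  qed
  then show ?thesis ..
qed

lemma tensor_class_eq:
  "tensor_class M N p = tensor_class M N r \<longleftrightarrow> p - r \<in> pm.span (tensor_relators M N)"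
proof
  assume "tensor_class M N p = tensor_class M N r"
  moreover have "p \<in> tensor_class M N p"
    unfolding tensor_class_def by (rule image_eqI[of _ _ 0]) (simp_all add: pm.span_zero)
  ultimately obtain s where "p = r + s" "s \<in> pm.span (tensor_relators M N)"
    unfolding tensor_class_def by auto
  then show "p - r \<in> pm.span (tensor_relators M N)" by simp
next
  have *: "tensor_class M N p \<subseteq> tensor_class M N r" if "p - r \<in> pm.span (tensor_relators M N)" for p r
  proof
    fix v assume "v \<in> tensor_class M N p"
    then obtain s where "v = p + s" "s \<in> pm.span (tensor_relators M N)"
      unfolding tensor_class_def by auto
    with pm.span_add[OF that this(2)] show "v \<in> tensor_class M N r"
      unfolding tensor_class_def by (intro image_eqI[of _ _ "p - r + s"]) simp_all
  qed
  assume a: "p - r \<in> pm.span (tensor_relators M N)"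
  from pm.span_neg[OF this] have "r - p \<in> pm.span (tensor_relators M N)" by simp
  with a show "tensor_class M N p = tensor_class M N r" using * by blast
qed

lemma tensor_class_mem: "x \<in> tensor_class M N p \<Longrightarrow> x - p \<in> pm.span (tensor_relators M N)"
  by (auto simp: tensor_class_def)

lemma tensor_class_self: "p \<in> tensor_class M N p"
  unfolding tensor_class_def by (rule image_eqI[of _ _ 0]) (simp_all add: pm.span_zero)

lemma tensor_product_ops:
  "u \<oplus>\<^bsub>tensor_product M N\<^esub> v = (\<Union>x\<in>u. \<Union>y\<in>v. tensor_class M N (x + y))"
  "c \<odot>\<^bsub>tensor_product M N\<^esub> u = (\<Union>x\<in>u. tensor_class M N (fscale c x))"
  by (simp_all only: tensor_product_def ring.simps module.simps)

lemma tensor_product_add: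
  "tensor_class M N p \<oplus>\<^bsub>tensor_product M N\<^esub> tensor_class M N r = tensor_class M N (p + r)"
  unfolding tensor_product_ops
proof (intro SUP_eq_const)
  show "tensor_class M N p \<noteq> {}" "tensor_class M N r \<noteq> {}"
    using tensor_class_self by blast+
  fix x y assume xy: "x \<in> tensor_class M N p" "y \<in> tensor_class M N r"
  have "x + y - (p + r) = (x - p) + (y - r)" by simp
  also have "\<dots> \<in> pm.span (tensor_relators M N)"
    by (rule pm.span_add[OF tensor_class_mem[OF xy(1)] tensor_class_mem[OF xy(2)]])
  finally show "tensor_class M N (x + y) = tensor_class M N (p + r)" unfolding tensor_class_eq .
qed

lemma tensor_product_smult:
  "c \<odot>\<^bsub>tensor_product M N\<^esub> tensor_class M N p = tensor_class M N (fscale c p)"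
  unfolding tensor_product_ops
proof (intro SUP_eq_const)
  show "tensor_class M N p \<noteq> {}" using tensor_class_self by blast
  show "tensor_class M N (fscale c x) = tensor_class M N (fscale c p)"
    if "x \<in> tensor_class M N p" for x
    using pm.span_scale[OF tensor_class_mem[OF that], of c]
    unfolding tensor_class_eq pm.scale_right_diff_distrib .
qed

lemma tensor_product_carrier:
  "carrier (tensor_product M N) = tensor_class M N ` {p. Poly_Mapping.keys p \<subseteq> carrier M \<times> carrier N}"
  by (simp add: tensor_product_def)

lemma tensor_relations:
  shows "x \<in> carrier M \<Longrightarrow> x' \<in> carrier M \<Longrightarrow> y \<in> carrier N \<Longrightarrow>
      bas (x \<oplus>\<^bsub>M\<^esub> x', y) - (bas (x, y) + bas (x', y)) \<in> pm.span (tensor_relators M N)"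
    and "x \<in> carrier M \<Longrightarrow> y \<in> carrier N \<Longrightarrow> y' \<in> carrier N \<Longrightarrow>
      bas (x, y \<oplus>\<^bsub>N\<^esub> y') - (bas (x, y) + bas (x, y')) \<in> pm.span (tensor_relators M N)"
    and "x \<in> carrier M \<Longrightarrow> y \<in> carrier N \<Longrightarrow>
      bas (c \<odot>\<^bsub>M\<^esub> x, y) - fscale c (bas (x, y)) \<in> pm.span (tensor_relators M N)"
    and "x \<in> carrier M \<Longrightarrow> y \<in> carrier N \<Longrightarrow>
      bas (x, c \<odot>\<^bsub>N\<^esub> y) - fscale c (bas (x, y)) \<in> pm.span (tensor_relators M N)"
  by (rule pm.span_base, simp only: tensor_relators_def Let_def, blast)+

lemma pure_tensor_carrier:
  "x \<in> carrier M \<Longrightarrow> y \<in> carrier N \<Longrightarrow> pure_tensor M N x y \<in> carrier (tensor_product M N)"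
  unfolding tensor_product_carrier pure_tensor_def by (rule imageI) simp

lemma pure_tensor_bilinear:
  shows "x \<in> carrier M \<Longrightarrow> x' \<in> carrier M \<Longrightarrow> y \<in> carrier N \<Longrightarrow>
      pure_tensor M N (x \<oplus>\<^bsub>M\<^esub> x') y = pure_tensor M N x y \<oplus>\<^bsub>tensor_product M N\<^esub> pure_tensor M N x' y"
    and "x \<in> carrier M \<Longrightarrow> y \<in> carrier N \<Longrightarrow> y' \<in> carrier N \<Longrightarrow>
      pure_tensor M N x (y \<oplus>\<^bsub>N\<^esub> y') = pure_tensor M N x y \<oplus>\<^bsub>tensor_product M N\<^esub> pure_tensor M N x y'"
    and "x \<in> carrier M \<Longrightarrow> y \<in> carrier N \<Longrightarrow>
      pure_tensor M N (c \<odot>\<^bsub>M\<^esub> x) y = c \<odot>\<^bsub>tensor_product M N\<^esub> pure_tensor M N x y"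
    and "x \<in> carrier M \<Longrightarrow> y \<in> carrier N \<Longrightarrow>
      pure_tensor M N x (c \<odot>\<^bsub>N\<^esub> y) = c \<odot>\<^bsub>tensor_product M N\<^esub> pure_tensor M N x y"
  unfolding pure_tensor_def tensor_product_add tensor_product_smult tensor_class_eq
  by (rule tensor_relations; assumption)+

definition bilin_mod ::
  "('k::field, 'a, 'm) module_scheme \<Rightarrow> ('k, 'b, 'n) module_scheme \<Rightarrow> ('y \<Rightarrow>\<^sub>0 'k) set
    \<Rightarrow> ('a \<times> 'b \<Rightarrow> ('y \<Rightarrow>\<^sub>0 'k)) \<Rightarrow> bool" where
  "bilin_mod M N S b \<longleftrightarrow>
     (\<forall>x\<in>carrier M. \<forall>x'\<in>carrier M. \<forall>y\<in>carrier N. b (x \<oplus>\<^bsub>M\<^esub> x', y) - (b (x, y) + b (x', y)) \<in> S) \<and>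
     (\<forall>x\<in>carrier M. \<forall>y\<in>carrier N. \<forall>y'\<in>carrier N. b (x, y \<oplus>\<^bsub>N\<^esub> y') - (b (x, y) + b (x, y')) \<in> S) \<and>
     (\<forall>c. \<forall>x\<in>carrier M. \<forall>y\<in>carrier N. b (c \<odot>\<^bsub>M\<^esub> x, y) - fscale c (b (x, y)) \<in> S) \<and>
     (\<forall>c. \<forall>x\<in>carrier M. \<forall>y\<in>carrier N. b (x, c \<odot>\<^bsub>N\<^esub> y) - fscale c (b (x, y)) \<in> S)"

text \<open>The universal property of the tensor product at the level of representatives: a map
  bilinear modulo \<open>S\<close> kills all relators modulo \<open>S\<close>.\<close>

lemma tensor_lift:
  assumes "bilin_mod M N S b" "pm.subspace S" "tensor_class M N p = tensor_class M N r"
  shows "pm_ext b p - pm_ext b r \<in> S"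
proof -
  have "pm_ext b v \<in> S" if "v \<in> tensor_relators M N" for v
  proof -
    have b: "pm_ext b (bas u) = b u" for u by simp
    have B: "\<And>x x' y. x \<in> carrier M \<Longrightarrow> x' \<in> carrier M \<Longrightarrow> y \<in> carrier N \<Longrightarrow>
        b (x \<oplus>\<^bsub>M\<^esub> x', y) - (b (x, y) + b (x', y)) \<in> S"
      "\<And>x y y'. x \<in> carrier M \<Longrightarrow> y \<in> carrier N \<Longrightarrow> y' \<in> carrier N \<Longrightarrow>
        b (x, y \<oplus>\<^bsub>N\<^esub> y') - (b (x, y) + b (x, y')) \<in> S"
      "\<And>c x y. x \<in> carrier M \<Longrightarrow> y \<in> carrier N \<Longrightarrow> b (c \<odot>\<^bsub>M\<^esub> x, y) - fscale c (b (x, y)) \<in> S"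
      "\<And>c x y. x \<in> carrier M \<Longrightarrow> y \<in> carrier N \<Longrightarrow> b (x, c \<odot>\<^bsub>N\<^esub> y) - fscale c (b (x, y)) \<in> S"
      using assms(1) unfolding bilin_mod_def by simp_all
    from that show ?thesis
      unfolding tensor_relators_def Let_def
    proof (elim UnE CollectE exE conjE, goal_cases)
      case (1 x x' y)
      then show ?case using B(1)[of x x' y] by (simp only: pm_ext_simps b)
    next
      case (2 x y y')
      then show ?case using B(2)[of x y y'] by (simp only: pm_ext_simps b)
    next
      case (3 c x y)
      then show ?case using B(3)[of x y c] by (simp only: pm_ext_simps b)
    next
      case (4 c x y)
      then show ?case using B(4)[of x y c] by (simp only: pm_ext_simps b)
    qed
  qed
  from lin_span_mem[where f = "pm_ext b" and S = S, OF lin_pm_ext assms(2) this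
      assms(3)[unfolded tensor_class_eq]]
  show ?thesis by (simp only: pm_ext_simps)
qed

context quantum_parameters begin

section \<open>The quantum group and its subalgebras\<close>

abbreviation "cl \<equiv> Uq_class a q"

lemma cl_def: "cl x = {h + x | h. h \<in> J}"
  by (auto simp: Uq_class_def a_r_coset_def' ring_of_type_algebra_simps)

lemma cl_eq: "cl x = cl y \<longleftrightarrow> x - y \<in> J"
proof
  assume "cl x = cl y"
  moreover have "x \<in> cl x" unfolding cl_def using J_closed(5) by force
  ultimately obtain h where "x = h + y" "h \<in> J" unfolding cl_def by blast
  then show "x - y \<in> J" by simp
next
  have *: "cl x \<subseteq> cl y" if "x - y \<in> J" for x y
  proof
    fix v assume "v \<in> cl x"
    then obtain h where h: "v = h + x" "h \<in> J" unfolding cl_def by blast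
    have "v = (h + (x - y)) + y" "h + (x - y) \<in> J"
      using h J_closed(1)[OF h(2) that] by simp_all
    then show "v \<in> cl y" unfolding cl_def by blast
  qed
  assume a: "x - y \<in> J"
  from J_closed(3)[OF this] have "y - x \<in> J" by simp
  with a show "cl x = cl y" using * by blast
qed

lemma Uq_record:
  "carrier (Uq a q) = carrier (ring_of_type_algebra Quot J)"
  "u \<oplus>\<^bsub>Uq a q\<^esub> v = u \<oplus>\<^bsub>ring_of_type_algebra Quot J\<^esub> v"
  "u \<otimes>\<^bsub>Uq a q\<^esub> v = u \<otimes>\<^bsub>ring_of_type_algebra Quot J\<^esub> v"
  "\<one>\<^bsub>Uq a q\<^esub> = \<one>\<^bsub>ring_of_type_algebra Quot J\<^esub>"
  "\<zero>\<^bsub>Uq a q\<^esub> = \<zero>\<^bsub>ring_of_type_algebra Quot J\<^esub>"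
  "c \<odot>\<^bsub>Uq a q\<^esub> u = cl (scalar c) \<otimes>\<^bsub>ring_of_type_algebra Quot J\<^esub> u"
  by (simp_all add: Uq_def Let_def ring.extend_def module.fields_def)

lemma Uq_carrier: "carrier (Uq a q) = range cl"
  unfolding Uq_record FactRing_def A_RCOSETS_def' Uq_class_def
  by (auto simp: a_r_coset_def' ring_of_type_algebra_simps)

lemma Uq_add: "cl x \<oplus>\<^bsub>Uq a q\<^esub> cl y = cl (x + y)"
  unfolding Uq_record FactRing_def Uq_class_def
  using abelian_subgroup.a_rcos_sum[OF abelian_subgroupI3[OF ideal.axioms(1)[OF J_ideal]
        ring.is_abelian_group[OF ring_ring_of_type_algebra]], of x y]
  by (simp add: ring_of_type_algebra_simps)

lemma Uq_mult: "cl x \<otimes>\<^bsub>Uq a q\<^esub> cl y = cl (x * y)"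
  unfolding Uq_record FactRing_def Uq_class_def
  using ideal.rcoset_mult_add[OF J_ideal, of x y]
  by (simp add: ring_of_type_algebra_simps)

lemma Uq_smult: "c \<odot>\<^bsub>Uq a q\<^esub> cl x = cl (fscale c x)"
  using Uq_mult[of "scalar c" x] by (simp only: Uq_record scalar_mult)

lemma Uq_one: "\<one>\<^bsub>Uq a q\<^esub> = cl 1"
  by (simp add: Uq_record FactRing_def Uq_class_def ring_of_type_algebra_simps)

lemma Uq_zero: "\<zero>\<^bsub>Uq a q\<^esub> = cl 0"
  unfolding Uq_record FactRing_def cl_def by simp

lemma Uq_ring: "ring (Uq a q)"
proof (rule ringI)
  show "abelian_group (Uq a q)"
  proof (rule abelian_groupI)
    fix x assume "x \<in> carrier (Uq a q)"
    then obtain x' where "x = cl x'" by (auto simp: Uq_carrier)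
    then have "cl (- x') \<oplus>\<^bsub>Uq a q\<^esub> x = \<zero>\<^bsub>Uq a q\<^esub>"
      by (simp add: Uq_add Uq_zero)
    then show "\<exists>y\<in>carrier (Uq a q). y \<oplus>\<^bsub>Uq a q\<^esub> x = \<zero>\<^bsub>Uq a q\<^esub>"
      unfolding Uq_carrier by blast
  qed (auto simp: Uq_carrier Uq_add Uq_zero ac_simps)
  show "Group.monoid (Uq a q)"
    by (rule monoidI) (auto simp: Uq_carrier Uq_mult Uq_one mult.assoc)
qed (auto simp: Uq_carrier Uq_mult Uq_add algebra_simps)

lemma Uq_subalgebra_ops:
  "u \<oplus>\<^bsub>Uq_subalgebra a q G\<^esub> v = u \<oplus>\<^bsub>Uq a q\<^esub> v"
  "c \<odot>\<^bsub>Uq_subalgebra a q G\<^esub> u = c \<odot>\<^bsub>Uq a q\<^esub> u"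
  by (simp_all add: Uq_subalgebra_def)

lemma words_span_subring: "subring (cl ` words_span G) (Uq a q)"
proof -
  interpret U: ring "Uq a q" by (rule Uq_ring)
  have minus: "\<ominus>\<^bsub>Uq a q\<^esub> cl x = cl (- x)" for x
    by (rule U.minus_equality) (auto simp: Uq_carrier Uq_add Uq_zero)
  show ?thesis
  proof (rule U.subringI)
    show "cl ` words_span G \<subseteq> carrier (Uq a q)" by (auto simp: Uq_carrier)
    show "\<one>\<^bsub>Uq a q\<^esub> \<in> cl ` words_span G"
      unfolding Uq_one wd_Nil[symmetric] by (intro imageI wd_in_words_span) simp
    fix u v assume "u \<in> cl ` words_span G" "v \<in> cl ` words_span G"
    then obtain x y where xy: "u = cl x" "v = cl y" "x \<in> words_span G" "y \<in> words_span G" by blast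
    show "u \<otimes>\<^bsub>Uq a q\<^esub> v \<in> cl ` words_span G"
      unfolding xy Uq_mult by (intro imageI words_span_mult xy)
    show "u \<oplus>\<^bsub>Uq a q\<^esub> v \<in> cl ` words_span G"
      unfolding xy Uq_add by (intro imageI pm.subspace_add[OF words_span_subspace] xy)
  next
    fix u assume "u \<in> cl ` words_span G"
    then obtain x where x: "u = cl x" "x \<in> words_span G" by blast
    show "\<ominus>\<^bsub>Uq a q\<^esub> u \<in> cl ` words_span G"
      unfolding x minus by (intro imageI pm.subspace_neg[OF words_span_subspace] x)
  qed
qed

text \<open>Classes of combinations of words form a subalgebra containing the generators, and every
  such subalgebra contains them. Elements of the three subalgebras can thus be represented by
  words.\<close>

lemma Uq_subalgebra_carrier: "carrier (Uq_subalgebra a q G) = cl ` words_span G"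
proof -
  have "generated_subalgebra (Uq a q) ((\<lambda>x. cl (gen x)) ` G) = cl ` words_span G"
    unfolding generated_subalgebra_def
  proof (rule antisym)
    have "c \<odot>\<^bsub>Uq a q\<^esub> u \<in> cl ` words_span G" if u: "u \<in> cl ` words_span G" for c u
    proof -
      obtain x where x: "u = cl x" "x \<in> words_span G" using u by blast
      show ?thesis
        unfolding x Uq_smult by (intro imageI pm.subspace_scale[OF words_span_subspace] x)
    qed
    moreover have "cl (gen x) \<in> cl ` words_span G" if "x \<in> G" for x
      unfolding gen_eq_wd using that by (intro imageI wd_in_words_span) simp
    ultimately show "\<Inter> {V. subring V (Uq a q) \<and> (\<forall>c. \<forall>x\<in>V. c \<odot>\<^bsub>Uq a q\<^esub> x \<in> V) \<and>
        (\<lambda>x. cl (gen x)) ` G \<subseteq> V} \<subseteq> cl ` words_span G"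
      by (intro Inter_lower CollectI conjI words_span_subring) blast+
  next
    show "cl ` words_span G \<subseteq> \<Inter> {V. subring V (Uq a q) \<and> (\<forall>c. \<forall>x\<in>V. c \<odot>\<^bsub>Uq a q\<^esub> x \<in> V) \<and>
        (\<lambda>x. cl (gen x)) ` G \<subseteq> V}"
    proof (intro Inter_greatest subsetI, elim CollectE conjE)
      fix V u
      assume V: "subring V (Uq a q)" and smult: "\<forall>c. \<forall>x\<in>V. c \<odot>\<^bsub>Uq a q\<^esub> x \<in> V"
        and G: "(\<lambda>x. cl (gen x)) ` G \<subseteq> V" and "u \<in> cl ` words_span G"
      then obtain p where p: "u = cl p" "p \<in> words_span G" by blast
      have "pm.subspace {p. cl p \<in> V}"
      proof (rule pm.subspaceI)
        show "0 \<in> {p. cl p \<in> V}" using subringE(2)[OF V] by (simp add: Uq_zero)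
        show "x + y \<in> {p. cl p \<in> V}" if "x \<in> {p. cl p \<in> V}" "y \<in> {p. cl p \<in> V}" for x y
          using subringE(7)[OF V, of "cl x" "cl y"] that by (simp add: Uq_add)
        show "fscale c x \<in> {p. cl p \<in> V}" if "x \<in> {p. cl p \<in> V}" for c x
          using smult that by (simp flip: Uq_smult)
      qed
      moreover have "wd xs \<in> {p. cl p \<in> V}" if "xs \<in> lists G" for xs
        using that
      proof induction
        case Nil
        show ?case using subringE(3)[OF V] by (simp add: wd_Nil Uq_one)
      next
        case (Cons x xs)
        then show ?case using subringE(6)[OF V, of "cl (gen x)" "cl (wd xs)"] G
          by (auto simp: wd_Cons Uq_mult)
      qed
      ultimately show "u \<in> V"
        using pm.span_minimal[of "wd ` lists G" "{p. cl p \<in> V}"] p unfolding words_span_def by blast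
    qed
  qed
  then show ?thesis by (simp add: Uq_subalgebra_def)
qed

section \<open>The decomposition\<close>

abbreviation "Um \<equiv> Uq_minus a q"
abbreviation "U0 \<equiv> Uq_zero a q"
abbreviation "Up \<equiv> Uq_plus a q"
abbreviation "Tm0 \<equiv> tensor_product Um U0"

definition triple_relations where
  "triple_relations = pm.span (tensor_relators Tm0 Up)"

text \<open>A representative of the pure threefold tensor, kept in the free space of the outer
  tensor product so that linear algebra with \<open>fscale\<close> and \<open>pm_ext\<close> remains
  available.\<close>

definition triple where
  "triple x y z = bas (pure_tensor Um U0 (cl x) (cl y), cl z)"

abbreviation "VF \<equiv> words_span (range F) :: ('i generator, 'k) free_alg set"
abbreviation "V0 \<equiv> words_span torus_generators :: ('i generator, 'k) free_alg set"
abbreviation "VE \<equiv> words_span (range E) :: ('i generator, 'k) free_alg set"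

lemma triple_relations_subspace: "pm.subspace triple_relations"
  by (simp add: triple_relations_def)

lemma carriers: "carrier Um = cl ` VF" "carrier U0 = cl ` V0" "carrier Up = cl ` VE"
  by (simp_all only: Uq_minus_def Uq_zero_def Uq_plus_def Uq_subalgebra_carrier)

lemma carrier_mem:
  "x \<in> VF \<Longrightarrow> cl x \<in> carrier Um" "y \<in> V0 \<Longrightarrow> cl y \<in> carrier U0" "z \<in> VE \<Longrightarrow> cl z \<in> carrier Up"
  by (simp_all only: carriers imageI)

lemma sub_ops:
  "cl x \<oplus>\<^bsub>Um\<^esub> cl y = cl (x + y)" "cl x \<oplus>\<^bsub>U0\<^esub> cl y = cl (x + y)" "cl x \<oplus>\<^bsub>Up\<^esub> cl y = cl (x + y)"
  "c \<odot>\<^bsub>Um\<^esub> cl x = cl (fscale c x)" "c \<odot>\<^bsub>U0\<^esub> cl x = cl (fscale c x)" "c \<odot>\<^bsub>Up\<^esub> cl x = cl (fscale c x)"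
  by (simp_all only: Uq_minus_def Uq_zero_def Uq_plus_def Uq_subalgebra_ops Uq_add Uq_smult)

text \<open>In the first two arguments \<open>pure_tensor_bilinear\<close> gives exact equations
  inside the inner product and one outer relator finishes; the third argument uses outer relators
  alone.\<close>

lemma triple_lin_mod:
  shows "y \<in> V0 \<Longrightarrow> z \<in> VE \<Longrightarrow> lin_mod VF triple_relations (\<lambda>x. triple x y z)"
    and "x \<in> VF \<Longrightarrow> z \<in> VE \<Longrightarrow> lin_mod V0 triple_relations (\<lambda>y. triple x y z)"
    and "x \<in> VF \<Longrightarrow> y \<in> V0 \<Longrightarrow> lin_mod VE triple_relations (\<lambda>z. triple x y z)"
proof -
  note rel = tensor_relations[where M = Tm0 and N = Up, folded triple_relations_def]
  note pure = pure_tensor_carrier[where M = Um and N = U0, OF carrier_mem(1,2)]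
  show "lin_mod VF triple_relations (\<lambda>x. triple x y z)" if "y \<in> V0" "z \<in> VE"
    unfolding lin_mod_def triple_def
  proof (intro conjI ballI allI)
    fix x x' c assume x: "x \<in> VF" "x' \<in> VF"
    note bil = pure_tensor_bilinear(1)[OF carrier_mem(1)[OF x(1)] carrier_mem(1)[OF x(2)] carrier_mem(2)[OF that(1)]]
    show "bas (pure_tensor Um U0 (cl (x + x')) (cl y), cl z)
        - (bas (pure_tensor Um U0 (cl x) (cl y), cl z) + bas (pure_tensor Um U0 (cl x') (cl y), cl z))
        \<in> triple_relations"
      unfolding bil[unfolded sub_ops] by (intro rel pure carrier_mem x that)
  next
    fix x c assume x: "x \<in> VF"
    note bil = pure_tensor_bilinear(3)[OF carrier_mem(1)[OF x] carrier_mem(2)[OF that(1)]]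
    show "bas (pure_tensor Um U0 (cl (fscale c x)) (cl y), cl z)
        - fscale c (bas (pure_tensor Um U0 (cl x) (cl y), cl z)) \<in> triple_relations"
      unfolding bil[unfolded sub_ops] by (intro rel pure carrier_mem x that)
  qed
  show "lin_mod V0 triple_relations (\<lambda>y. triple x y z)" if "x \<in> VF" "z \<in> VE"
    unfolding lin_mod_def triple_def
  proof (intro conjI ballI allI)
    fix y y' c assume y: "y \<in> V0" "y' \<in> V0"
    note bil = pure_tensor_bilinear(2)[OF carrier_mem(1)[OF that(1)] carrier_mem(2)[OF y(1)] carrier_mem(2)[OF y(2)]]
    show "bas (pure_tensor Um U0 (cl x) (cl (y + y')), cl z)
        - (bas (pure_tensor Um U0 (cl x) (cl y), cl z) + bas (pure_tensor Um U0 (cl x) (cl y'), cl z))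
        \<in> triple_relations"
      unfolding bil[unfolded sub_ops] by (intro rel pure carrier_mem y that)
  next
    fix y c assume y: "y \<in> V0"
    note bil = pure_tensor_bilinear(4)[OF carrier_mem(1)[OF that(1)] carrier_mem(2)[OF y]]
    show "bas (pure_tensor Um U0 (cl x) (cl (fscale c y)), cl z)
        - fscale c (bas (pure_tensor Um U0 (cl x) (cl y), cl z)) \<in> triple_relations"
      unfolding bil[unfolded sub_ops] by (intro rel pure carrier_mem y that)
  qed
  show "lin_mod VE triple_relations (\<lambda>z. triple x y z)" if "x \<in> VF" "y \<in> V0"
    unfolding lin_mod_def triple_def sub_ops(3,6)[symmetric]
    by (intro conjI ballI allI rel pure carrier_mem that)
qed

end

lemma lists_range: "xs \<in> lists (range f) \<Longrightarrow> \<exists>ys. xs = map f ys"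
  by (metis ex_map_conv in_listsD rangeE)

lemma lin_mod_words:
  assumes lin: "lin_mod (words_span G) S h" and T: "pm.subspace T" "S \<subseteq> T"
    and wds: "\<And>xs. xs \<in> lists G \<Longrightarrow> h (wd xs) \<in> T" and p: "p \<in> words_span G"
  shows "h p \<in> T"
proof (rule lin_mod_mem[where V = "words_span G" and S = S and G = "wd ` lists G"])
  show "wd ` lists G \<subseteq> words_span G" unfolding words_span_def by (rule pm.span_superset)
  show "p \<in> pm.span (wd ` lists G)" using p unfolding words_span_def .
  show "h g \<in> T" if g: "g \<in> wd ` lists G" for g
  proof -
    obtain xs where "g = wd xs" "xs \<in> lists G" using g by blast
    then show ?thesis by (simp only: wds)
  qed
qed (fact lin T words_span_subspace)+

section \<open>Spanning triples and the image of the Serre submodule\<close>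

context quantum_parameters begin

lemma serre_J: "i \<noteq> j \<Longrightarrow> serre_e a q i j \<in> J" "i \<noteq> j \<Longrightarrow> serre_f a q i j \<in> J"
  by (rule J_relator, simp only: Uq_relators_def, blast)+

definition serre_word :: "'i \<Rightarrow> 'i \<Rightarrow> nat \<Rightarrow> nat \<Rightarrow> 'i list" where
  "serre_word i j m k = replicate m i @ j # replicate k i"

lemma serre_e_words: "serre_e a q i j = (\<Sum>k = 0..nat (1 - a i j).
    fscale (serre_coeff a q i j k) (wd (map E (serre_word i j (nat (1 - a i j) - k) k))))"
  unfolding serre_e_def serre_word_def
  by (intro sum.cong refl)
    (simp add: gen_power scalar_mult fscale_mult wd_Cons mult.assoc flip: wd_mult)

lemma serre_f_words: "serre_f a q i j = (\<Sum>k = 0..nat (1 - a i j).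
    fscale (serre_coeff a q i j k) (wd (map F (serre_word i j k (nat (1 - a i j) - k)))))"
  unfolding serre_f_def serre_word_def
  by (intro sum.cong refl)
    (simp add: gen_power scalar_mult fscale_mult wd_Cons mult.assoc flip: wd_mult)

lemma word_mem: "wd (map F x) \<in> VF" "set t \<subseteq> torus_generators \<Longrightarrow> wd t \<in> V0" "wd (map E z) \<in> VE"
  by (rule wd_in_words_span; auto)+

lemma serre_mem: "serre_e a q i j \<in> VE" "serre_f a q i j \<in> VF"
  unfolding serre_e_words serre_f_words
  by (intro pm.subspace_sum[OF words_span_subspace] pm.subspace_scale[OF words_span_subspace] word_mem)+

lemma triple_mem:
  assumes T: "pm.subspace T" "triple_relations \<subseteq> T"
    and words: "\<And>x t z. set t \<subseteq> torus_generators \<Longrightarrow> triple (wd (map F x)) (wd t) (wd (map E z)) \<in> T"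
    and "x \<in> VF" "y \<in> V0" "z \<in> VE"
  shows "triple x y z \<in> T"
proof -
  have 1: "triple (wd (map F x)) (wd t) z \<in> T" if z: "z \<in> VE" and t: "set t \<subseteq> torus_generators" for x t z
  proof -
    have lin: "lin_mod VE triple_relations (\<lambda>z. triple (wd (map F x)) (wd t) z)"
      by (rule triple_lin_mod(3)[OF word_mem(1) word_mem(2)[OF t]])
    have wds: "triple (wd (map F x)) (wd t) (wd xs) \<in> T" if xs: "xs \<in> lists (range E)" for xs
    proof -
      obtain z' where "xs = map E z'" using lists_range[OF xs] ..
      then show ?thesis by (simp only: words[OF t])
    qed
    show ?thesis by (rule lin_mod_words[OF lin T wds z])
  qed
  have 2: "triple (wd (map F x)) y z \<in> T" if y: "y \<in> V0" and z: "z \<in> VE" for x y z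
  proof -
    have lin: "lin_mod V0 triple_relations (\<lambda>y. triple (wd (map F x)) y z)"
      by (rule triple_lin_mod(2)[OF word_mem(1) z])
    have wds: "triple (wd (map F x)) (wd t) z \<in> T" if t: "t \<in> lists torus_generators" for t
      using t by (intro 1 z) (simp add: in_lists_conv_set subset_iff)
    show ?thesis by (rule lin_mod_words[OF lin T wds y])
  qed
  have lin: "lin_mod VF triple_relations (\<lambda>x. triple x y z)"
    by (rule triple_lin_mod(1)[OF assms(5,6)])
  have wds: "triple (wd xs) y z \<in> T" if xs: "xs \<in> lists (range F)" for xs
  proof -
    obtain x' where "xs = map F x'" using lists_range[OF xs] ..
    then show ?thesis by (simp only: 2[OF assms(5,6)])
  qed
  show ?thesis by (rule lin_mod_words[OF lin T wds assms(4)])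
qed

definition triple_word where
  "triple_word = (\<lambda>(x, t, z). triple (wd (map F x)) (wd t) (wd (map E z)))"

text \<open>The first component of an outer basis element is itself a coset. It is expanded through
  a representative supported on the inner carriers, then into pure tensors, and finally into
  words.\<close>

lemma triple_spanning:
  assumes "v \<in> carrier (tensor_product Tm0 Up)"
  obtains w where "Poly_Mapping.keys w \<subseteq> normal_keys" "v = tensor_class Tm0 Up (pm_ext triple_word w)"
proof -
  define T where "T = pm.span (triple_word ` normal_keys \<union> triple_relations)"
  have T: "pm.subspace T" "triple_relations \<subseteq> T"
    unfolding T_def using pm.span_superset[of "triple_word ` normal_keys \<union> triple_relations"] by simp_all
  have words: "triple (wd (map F x)) (wd t) (wd (map E z)) \<in> T" if "set t \<subseteq> torus_generators" for x t z
    unfolding T_def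
    by (rule pm.span_base, rule UnI1, rule image_eqI[of _ _ "(x, t, z)"])
      (use that in \<open>auto simp: triple_word_def normal_keys_def\<close>)
  have gen: "bas (u, z) \<in> T" if u: "u \<in> carrier Tm0" and z: "z \<in> carrier Up" for u z
  proof -
    obtain p where p: "u = tensor_class Um U0 p" "Poly_Mapping.keys p \<subseteq> carrier Um \<times> carrier U0"
      using u unfolding tensor_product_carrier by blast
    define V :: "(('i generator, 'k) free_alg set \<times> ('i generator, 'k) free_alg set \<Rightarrow>\<^sub>0 'k) set"
      where "V = {p. Poly_Mapping.keys p \<subseteq> carrier Um \<times> carrier U0}"
    have V: "pm.subspace V"
    proof (rule pm.subspaceI)
      show "x + y \<in> V" if "x \<in> V" "y \<in> V" for x y
        using that Poly_Mapping.keys_add[of x y] unfolding V_def by blast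
      show "fscale c x \<in> V" if "x \<in> V" for c x
      proof -
        have "Poly_Mapping.keys (fscale c x) \<subseteq> Poly_Mapping.keys x" by (auto simp: in_keys_iff)
        then show ?thesis using that unfolding V_def by blast
      qed
    qed (simp add: V_def)
    have carr: "tensor_class Um U0 x \<in> carrier Tm0" if "x \<in> V" for x
      using that unfolding tensor_product_carrier V_def by blast
    have lin: "lin_mod V triple_relations (\<lambda>p. bas (tensor_class Um U0 p, z))"
      unfolding lin_mod_def tensor_product_add[symmetric] tensor_product_smult[symmetric] triple_relations_def
      by (intro conjI ballI allI tensor_relations carr z)
    let ?G = "bas ` (carrier Um \<times> carrier U0)
      :: (('i generator, 'k) free_alg set \<times> ('i generator, 'k) free_alg set \<Rightarrow>\<^sub>0 'k) set"
    have pG: "p \<in> pm.span ?G"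
    proof (rule pm_subspace_mem[OF pm.subspace_span])
      fix k assume "k \<in> Poly_Mapping.keys p"
      with p(2) have "k \<in> carrier Um \<times> carrier U0" ..
      then show "bas k \<in> pm.span ?G" by (intro pm.span_base imageI)
    qed
    have GV: "?G \<subseteq> V" by (auto simp: V_def)
    have hG: "bas (tensor_class Um U0 g, z) \<in> T" if g: "g \<in> ?G" for g
    proof -
      obtain x y where xy: "g = bas (x, y)" "x \<in> carrier Um" "y \<in> carrier U0" using g by blast
      obtain x' y' z' where "x = cl x'" "y = cl y'" "z = cl z'" "x' \<in> VF" "y' \<in> V0" "z' \<in> VE"
        using xy z unfolding carriers by blast
      then show ?thesis using triple_mem[OF T words, of x' y' z']
        by (simp add: xy(1) triple_def pure_tensor_def)
    qed
    show ?thesis unfolding p(1) by (rule lin_mod_mem[OF lin V T GV hG pG])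
  qed
  obtain r where r: "v = tensor_class Tm0 Up r" "Poly_Mapping.keys r \<subseteq> carrier Tm0 \<times> carrier Up"
    using assms unfolding tensor_product_carrier by blast
  have "r \<in> T"
  proof (rule pm_subspace_mem[OF T(1)])
    fix k assume "k \<in> Poly_Mapping.keys r"
    with r(2) have "k \<in> carrier Tm0 \<times> carrier Up" ..
    then show "bas k \<in> T" using gen by (cases k) simp
  qed
  moreover have "pm.span triple_relations = triple_relations" by (simp add: triple_relations_subspace)
  ultimately obtain x y where xy: "r = x + y" "x \<in> pm.span (triple_word ` normal_keys)" "y \<in> triple_relations"
    unfolding T_def pm.span_Un by auto
  obtain w where w: "Poly_Mapping.keys w \<subseteq> normal_keys" "x = pm_ext triple_word w"
    using span_image_ext[OF xy(2)] by blast
  have "r - pm_ext triple_word w \<in> triple_relations" using xy w by simp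
  then have "v = tensor_class Tm0 Up (pm_ext triple_word w)"
    unfolding r(1) tensor_class_eq triple_relations_def .
  then show ?thesis using that w(1) by blast
qed

text \<open>
  The default \<open>[]\<close> for functions that are no degrees keeps \<open>key_triple\<close> below inside the tensor product
  for all basis vectors, not only for those reached from torus words.
\<close>

definition torus_word :: "('i generator \<Rightarrow> int) \<Rightarrow> 'i generator list" where
  "torus_word d = (if \<exists>t. set t \<subseteq> torus_generators \<and> torus_deg t = d
     then SOME t. set t \<subseteq> torus_generators \<and> torus_deg t = d else [])"

lemma torus_word_set: "set (torus_word d) \<subseteq> torus_generators"
  unfolding torus_word_def using someI_ex[of "\<lambda>t. set t \<subseteq> torus_generators \<and> torus_deg t = d"]
  by auto

lemma torus_word_deg:
  assumes "set t \<subseteq> torus_generators"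
  shows "cl (wd (torus_word (torus_deg t))) = cl (wd t)"
proof -
  have "\<exists>u. set u \<subseteq> torus_generators \<and> torus_deg u = torus_deg t" using assms by blast
  from someI_ex[OF this] this have "torus_deg (torus_word (torus_deg t)) = torus_deg t"
    unfolding torus_word_def by simp
  then show ?thesis
    unfolding cl_eq by (intro J_torus_deg_eq torus_word_set assms)
qed

text \<open>Translates basis vectors of the action back into tensors. The weights \<open>c\<close>
  are forgotten, as the class of a torus word depends on its degree alone
  (\<open>torus_word_deg\<close>).\<close>

definition key_triple where
  "key_triple = (\<lambda>(x, d, c :: 'i \<Rightarrow> 'k, z). triple (wd (map F x)) (wd (torus_word d)) (wd (map E z)))"

lemma triple_ideal:
  shows "x \<in> J \<Longrightarrow> x \<in> VF \<Longrightarrow> y \<in> V0 \<Longrightarrow> z \<in> VE \<Longrightarrow> triple x y z \<in> triple_relations"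
    and "x \<in> VF \<Longrightarrow> y \<in> V0 \<Longrightarrow> z \<in> VE \<Longrightarrow> z \<in> J \<Longrightarrow> triple x y z \<in> triple_relations"
proof -
  have cl0: "cl u = cl 0" if "u \<in> J" for u using that by (simp add: cl_eq)
  show "triple x y z \<in> triple_relations" if "x \<in> J" "x \<in> VF" "y \<in> V0" "z \<in> VE"
    using lin_mod_zero[OF triple_lin_mod(1)[OF that(3,4)] words_span_subspace]
    unfolding triple_def cl0[OF that(1)] .
  show "triple x y z \<in> triple_relations" if "x \<in> VF" "y \<in> V0" "z \<in> VE" "z \<in> J"
    using lin_mod_zero[OF triple_lin_mod(3)[OF that(1,2)] words_span_subspace]
    unfolding triple_def cl0[OF that(4)] .
qed

lemma lin_mod_sum:
  assumes h: "lin_mod V S h" and V: "pm.subspace V" and S: "pm.subspace S"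
    and p: "\<And>k. k \<in> K \<Longrightarrow> p k \<in> V" and K: "finite K"
  shows "h (\<Sum>k\<in>K. fscale (r k) (p k)) - (\<Sum>k\<in>K. fscale (r k) (h (p k))) \<in> S"
  using K p
proof (induction K)
  case empty
  show ?case using lin_mod_zero[OF h V] by simp
next
  case (insert l K)
  let ?s = "\<Sum>k\<in>K. fscale (r k) (p k)" and ?t = "\<Sum>k\<in>K. fscale (r k) (h (p k))"
  let ?l = "fscale (r l) (p l)" and ?m = "fscale (r l) (h (p l))"
  have pl: "p l \<in> V" and pK: "\<And>k. k \<in> K \<Longrightarrow> p k \<in> V"
    using insert.prems by simp_all
  have l: "?l \<in> V" by (rule pm.subspace_scale[OF V pl])
  have s: "?s \<in> V" by (rule pm.subspace_sum[OF V], rule pm.subspace_scale[OF V pK])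
  have 1: "h (?l + ?s) - (h ?l + h ?s) \<in> S" using h l s unfolding lin_mod_def by simp
  have 2: "h ?l - ?m \<in> S" using h pl unfolding lin_mod_def by simp
  have 3: "h ?s - ?t \<in> S" by (rule insert.IH[OF pK])
  have "h (?l + ?s) - (?m + ?t) = (h (?l + ?s) - (h ?l + h ?s)) + ((h ?l - ?m) + (h ?s - ?t))"
    by simp
  also have "\<dots> \<in> S" by (rule pm.subspace_add[OF S 1 pm.subspace_add[OF S 2 3]])
  finally show ?case by (simp only: sum.insert[OF insert.hyps])
qed

lemma E_word_bas: "app (prod_list (map (E_op q) y)) (bas ([], d, c, z))
    = fscale (\<Prod>i\<leftarrow>y. inverse (c i)) (bas ([], d, c, y @ z))"
  by (induction y) (simp_all add: E_op_single mult.commute)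

lemma triple_relations_diffD:
  assumes "p - r \<in> triple_relations" "p \<in> triple_relations"
  shows "r \<in> triple_relations"
  using pm.subspace_diff[OF triple_relations_subspace assms(2,1)] by simp

text \<open>Modulo relations the image is a multiple of a triple in which one slot is a Serre
  element between two words. That slot lies in \<open>J\<close>, so its class is 0 and the triple is
  a relation.\<close>

lemma key_triple_serre_gens:
  assumes "w \<in> serre_gens"
  shows "pm_ext key_triple w \<in> triple_relations"
  using assms
proof cases
  case (serre_f i j u k)
  obtain x d c z where k: "k = (x, d, c, z)" by (cases k)
  let ?n = "nat (1 - a i j)" and ?s = "serre_coeff a q i j"
  let ?w = "\<lambda>l. serre_word i j l (?n - l)"
  let ?h = "\<lambda>p. triple p (wd (torus_word d)) (wd (map E z))"
  have F: "map (gen_op q \<circ> F) v = map F_op v" for v :: "'i list" by (induction v) simp_all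
  have w: "pm_ext key_triple w = (\<Sum>l = 0..?n. fscale (?s l) (?h (wd (map F (u @ ?w l @ x)))))"
    unfolding serre_f(1) k serre_f_words alg_ext_sum alg_ext_fscale alg_ext_wd app_sum
    by (simp add: F F_word_bas key_triple_def del: fscale_single map_append)
  have lin: "lin_mod VF triple_relations ?h"
    by (intro triple_lin_mod word_mem torus_word_set)
  let ?X = "wd (map F u) * serre_f a q i j * wd (map F x)"
  have X: "?X = (\<Sum>l = 0..?n. fscale (?s l) (wd (map F (u @ ?w l @ x))))"
    unfolding serre_f_words
    by (simp add: sum_distrib_left sum_distrib_right fscale_mult wd_mult)
  have "?h ?X - pm_ext key_triple w \<in> triple_relations"
    unfolding X w
    by (rule lin_mod_sum[OF lin words_span_subspace triple_relations_subspace word_mem(1)]) simp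
  moreover have "?h ?X \<in> triple_relations"
    by (intro triple_ideal(1) J_mult serre_J serre_f words_span_mult word_mem serre_mem torus_word_set)
  ultimately show ?thesis by (rule triple_relations_diffD)
next
  case (serre_e i j x u d c z)
  let ?n = "nat (1 - a i j)" and ?s = "serre_coeff a q i j"
  let ?w = "\<lambda>l. serre_word i j (?n - l) l"
  let ?h = "\<lambda>Z. triple (wd (map F x)) (wd (torus_word d)) Z"
  \<comment> \<open>The cost of moving \<open>e_u\<close> and a Serre word past the torus part. All
    words of one Serre element have the same letters, \<open>?n\<close> times \<open>i\<close> and
    once \<open>j\<close>, so the scalar is common to all summands.\<close>
  define r where "r = (\<Prod>i\<leftarrow>u. inverse (c i)) * (inverse (c i) ^ ?n * inverse (c j))"
  have E: "map (gen_op q \<circ> E) v = map (E_op q) v" for v :: "'i list" by (induction v) simp_all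
  have r: "(\<Prod>i\<leftarrow>u @ ?w l. inverse (c i)) = r" if "l \<le> ?n" for l
    using that by (simp add: r_def serre_word_def prod_list_replicate ac_simps flip: power_add)
  have vals: "app (prod_list (map F_op x)) (app (prod_list (map (E_op q) u))
      (app (prod_list (map (E_op q) (?w l))) (bas ([], d, c, z)))) = fscale r (bas (x, d, c, u @ ?w l @ z))"
    if "l \<le> ?n" for l
    using E_word_bas[of "u @ ?w l" d c z] r[OF that] by (simp add: F_word_bas del: fscale_single)
  have w: "pm_ext key_triple w = fscale r (\<Sum>l = 0..?n. fscale (?s l) (?h (wd (map E (u @ ?w l @ z)))))"
  proof -
    have "w = (\<Sum>l = 0..?n. fscale (?s l) (fscale r (bas (x, d, c, u @ ?w l @ z))))"
      unfolding serre_e(1) serre_e_words alg_ext_sum alg_ext_fscale alg_ext_wd app_sum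
      by (simp add: E vals del: fscale_single map_append)
    then show ?thesis
      by (simp add: key_triple_def pm.scale_sum_right mult.commute del: fscale_single map_append)
  qed
  have lin: "lin_mod VE triple_relations ?h"
    by (intro triple_lin_mod word_mem torus_word_set)
  let ?Z = "wd (map E u) * serre_e a q i j * wd (map E z)"
  have Z: "?Z = (\<Sum>l = 0..?n. fscale (?s l) (wd (map E (u @ ?w l @ z))))"
    unfolding serre_e_words
    by (simp add: sum_distrib_left sum_distrib_right fscale_mult wd_mult)
  let ?k = "\<Sum>l = 0..?n. fscale (?s l) (?h (wd (map E (u @ ?w l @ z))))"
  have "?h ?Z - ?k \<in> triple_relations"
    unfolding Z
    by (rule lin_mod_sum[OF lin words_span_subspace triple_relations_subspace word_mem(3)]) simp
  moreover have "?h ?Z \<in> triple_relations"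
    by (intro triple_ideal(2) J_mult serre_J serre_e words_span_mult word_mem serre_mem torus_word_set)
  ultimately have "?k \<in> triple_relations" by (rule triple_relations_diffD)
  then show ?thesis unfolding w by (rule pm.subspace_scale[OF triple_relations_subspace])
qed

lemma key_triple_serre_sub: "w \<in> serre_sub \<Longrightarrow> pm_ext key_triple w \<in> triple_relations"
  unfolding serre_sub_def
  by (rule lin_span_mem[where f = "pm_ext key_triple", OF lin_pm_ext triple_relations_subspace key_triple_serre_gens])

text \<open>On normal words, acting on the vector for 1 and translating back by
  \<open>key_triple\<close> recovers the triple. On \<open>J\<close> the same composite lands in the
  relations, by \<open>rep_Uq_ideal\<close> and \<open>key_triple_serre_sub\<close>.\<close>

lemma triple_word_kernel:
  assumes w: "Poly_Mapping.keys w \<subseteq> normal_keys" and J: "pm_ext normal_word w \<in> J"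
  shows "pm_ext triple_word w \<in> triple_relations"
proof -
  let ?v = "bas ([], \<lambda>_. 0, \<lambda>_. 1, []) :: ('i, 'k) key \<Rightarrow>\<^sub>0 'k"
  have "pm_ext key_triple (app (rep q (pm_ext normal_word w)) ?v) = pm_ext triple_word w"
  proof (rule lin_eqI[where p = w and f = "\<lambda>w. pm_ext key_triple (app (rep q (pm_ext normal_word w)) ?v)"
        and g = "pm_ext triple_word"])
    show "lin (\<lambda>w. pm_ext key_triple (app (rep q (pm_ext normal_word w)) ?v))"
      by (rule lin_comp[where f = "pm_ext key_triple", OF lin_pm_ext],
          rule lin_comp[where g = "pm_ext normal_word", OF lin_alg_ext lin_pm_ext])
    show "lin (pm_ext triple_word)" by (rule lin_pm_ext)
    fix k assume "k \<in> Poly_Mapping.keys w"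
    then obtain x t z where k: "k = (x, t, z)" "set t \<subseteq> torus_generators"
      using w unfolding normal_keys_def by blast
    have "pm_ext normal_word (bas k) = wd (map F x @ t @ map E z)"
      by (simp add: k(1) normal_word_def)
    then have "pm_ext key_triple (app (rep q (pm_ext normal_word (bas k))) ?v)
        = key_triple (x, torus_deg t, wts q t, z)"
      using rep_normal_word[OF k(2), of x z] by simp
    also have "\<dots> = pm_ext triple_word (bas k)"
      using torus_word_deg[OF k(2)] by (simp add: key_triple_def triple_word_def k(1) triple_def)
    finally show "pm_ext key_triple (app (rep q (pm_ext normal_word (bas k))) ?v) = pm_ext triple_word (bas k)" .
  qed
  then show ?thesis
    using key_triple_serre_sub[OF rep_Uq_ideal[OF J, of ?v]] by simp
qed

section \<open>The multiplication map\<close>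

definition lift :: "('i generator, 'k) free_alg set \<Rightarrow> ('i generator, 'k) free_alg" where
  "lift u = (SOME p. cl p = u)"

lemma lift_cl: "lift (cl x) - x \<in> J"
proof -
  have "cl (lift (cl x)) = cl x" unfolding lift_def by (rule someI[of _ x]) (rule refl)
  then show ?thesis by (simp only: cl_eq)
qed

lemma lift_add: "lift (cl (x + y)) - (lift (cl x) + lift (cl y)) \<in> J"
proof -
  have "lift (cl (x + y)) - (lift (cl x) + lift (cl y))
      = (lift (cl (x + y)) - (x + y)) - ((lift (cl x) - x) + (lift (cl y) - y))" by simp
  also have "\<dots> \<in> J" by (rule J_closed(2)[OF lift_cl J_closed(1)[OF lift_cl lift_cl]])
  finally show ?thesis .
qed

lemma lift_scale: "lift (cl (fscale c x)) - fscale c (lift (cl x)) \<in> J"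
proof -
  have "lift (cl (fscale c x)) - fscale c (lift (cl x))
      = (lift (cl (fscale c x)) - fscale c x) - fscale c (lift (cl x) - x)"
    by (simp add: pm.scale_right_diff_distrib)
  also have "\<dots> \<in> J" by (rule J_closed(2)[OF lift_cl J_closed(4)[OF lift_cl]])
  finally show ?thesis .
qed

lemma lift_mult_relations:
  "lift (cl (x + x')) * r - (lift (cl x) * r + lift (cl x') * r) \<in> J"
  "r * lift (cl (x + x')) - (r * lift (cl x) + r * lift (cl x')) \<in> J"
  "lift (cl (fscale c x)) * r - fscale c (lift (cl x) * r) \<in> J"
  "r * lift (cl (fscale c x)) - fscale c (r * lift (cl x)) \<in> J"
  using J_mult(1)[OF lift_add, of x x' r] J_mult(2)[OF lift_add, of r x x']
    J_mult(1)[OF lift_scale, of c x r] J_mult(2)[OF lift_scale, of r c x]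
  by (simp_all only: left_diff_distrib right_diff_distrib distrib_left distrib_right fscale_mult)

text \<open>Products are formed from chosen representatives because \<open>pm_ext\<close> needs
  values in the free algebra; bilinearity then holds only modulo \<open>J\<close>, which is what
  \<open>tensor_lift\<close> accepts.\<close>

definition mult2 where
  "mult2 = (\<lambda>(x, y). lift x * lift y)"

lemma mult2_bilin: "bilin_mod Um U0 J mult2"
proof -
  have "mult2 (x \<oplus>\<^bsub>Um\<^esub> x', y) - (mult2 (x, y) + mult2 (x', y)) \<in> J"
    if asm: "x \<in> carrier Um" "x' \<in> carrier Um" for x x' y
  proof -
    obtain u u' where "x = cl u" "x' = cl u'" using asm unfolding carriers by blast
    then show ?thesis by (simp only: mult2_def prod.case sub_ops lift_mult_relations)
  qed
  moreover have "mult2 (x, y \<oplus>\<^bsub>U0\<^esub> y') - (mult2 (x, y) + mult2 (x, y')) \<in> J"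
    if asm: "y \<in> carrier U0" "y' \<in> carrier U0" for x y y'
  proof -
    obtain u u' where "y = cl u" "y' = cl u'" using asm unfolding carriers by blast
    then show ?thesis by (simp only: mult2_def prod.case sub_ops lift_mult_relations)
  qed
  moreover have "mult2 (c \<odot>\<^bsub>Um\<^esub> x, y) - fscale c (mult2 (x, y)) \<in> J"
    if asm: "x \<in> carrier Um" for c x y
  proof -
    obtain u where "x = cl u" using asm unfolding carriers by blast
    then show ?thesis by (simp only: mult2_def prod.case sub_ops lift_mult_relations)
  qed
  moreover have "mult2 (x, c \<odot>\<^bsub>U0\<^esub> y) - fscale c (mult2 (x, y)) \<in> J"
    if asm: "y \<in> carrier U0" for c x y
  proof -
    obtain u where "y = cl u" using asm unfolding carriers by blast
    then show ?thesis by (simp only: mult2_def prod.case sub_ops lift_mult_relations)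
  qed
  ultimately show ?thesis unfolding bilin_mod_def by (intro conjI ballI allI)
qed

definition mult2_map where
  "mult2_map u = cl (pm_ext mult2 (SOME p. u = tensor_class Um U0 p))"

lemma mult2_map_class: "mult2_map (tensor_class Um U0 p) = cl (pm_ext mult2 p)"
proof -
  have "tensor_class Um U0 p = tensor_class Um U0 (SOME r. tensor_class Um U0 p = tensor_class Um U0 r)"
    by (rule someI[of _ p]) (rule refl)
  from tensor_lift[OF mult2_bilin J_subspace this[symmetric]]
  show ?thesis unfolding mult2_map_def cl_eq .
qed

definition mult3 where
  "mult3 = (\<lambda>(u, z). lift (mult2_map u) * lift z)"

lemma mult3_bilin: "bilin_mod Tm0 Up J mult3"
proof -
  have T: "\<exists>p. u = tensor_class Um U0 p" if "u \<in> carrier Tm0" for u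
    using that unfolding tensor_product_carrier by blast
  note map_simps = mult3_def prod.case tensor_product_add tensor_product_smult mult2_map_class
    pm_ext_simps sub_ops lift_mult_relations
  have "mult3 (x \<oplus>\<^bsub>Tm0\<^esub> x', y) - (mult3 (x, y) + mult3 (x', y)) \<in> J"
    if asm: "x \<in> carrier Tm0" "x' \<in> carrier Tm0" for x x' y
  proof -
    obtain u u' where "x = tensor_class Um U0 u" "x' = tensor_class Um U0 u'" using T asm by blast
    then show ?thesis by (simp only: map_simps)
  qed
  moreover have "mult3 (x, y \<oplus>\<^bsub>Up\<^esub> y') - (mult3 (x, y) + mult3 (x, y')) \<in> J"
    if asm: "y \<in> carrier Up" "y' \<in> carrier Up" for x y y'
  proof -
    obtain u u' where "y = cl u" "y' = cl u'" using asm unfolding carriers by blast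
    then show ?thesis by (simp only: map_simps)
  qed
  moreover have "mult3 (c \<odot>\<^bsub>Tm0\<^esub> x, y) - fscale c (mult3 (x, y)) \<in> J"
    if asm: "x \<in> carrier Tm0" for c x y
  proof -
    obtain u where "x = tensor_class Um U0 u" using T asm by blast
    then show ?thesis by (simp only: map_simps)
  qed
  moreover have "mult3 (x, c \<odot>\<^bsub>Up\<^esub> y) - fscale c (mult3 (x, y)) \<in> J"
    if asm: "y \<in> carrier Up" for c x y
  proof -
    obtain u where "y = cl u" using asm unfolding carriers by blast
    then show ?thesis by (simp only: map_simps)
  qed
  ultimately show ?thesis unfolding bilin_mod_def by (intro conjI ballI allI)
qed

definition mult_map where
  "mult_map v = cl (pm_ext mult3 (SOME p. v = tensor_class Tm0 Up p))"

lemma mult_map_class: "mult_map (tensor_class Tm0 Up p) = cl (pm_ext mult3 p)"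
proof -
  have "tensor_class Tm0 Up p = tensor_class Tm0 Up (SOME r. tensor_class Tm0 Up p = tensor_class Tm0 Up r)"
    by (rule someI[of _ p]) (rule refl)
  from tensor_lift[OF mult3_bilin J_subspace this[symmetric]]
  show ?thesis unfolding mult_map_def cl_eq .
qed

lemma cl_lift_mult: "cl (lift (cl x) * lift (cl y)) = cl (x * y)"
proof -
  have "cl (lift (cl x)) = cl x" "cl (lift (cl y)) = cl y"
    unfolding cl_eq by (rule lift_cl)+
  then show ?thesis by (simp only: Uq_mult[symmetric])
qed

lemma mult3_triple: "cl (pm_ext mult3 (triple x y z)) = cl (x * y * z)"
proof -
  have "mult2_map (pure_tensor Um U0 (cl x) (cl y)) = cl (x * y)"
    unfolding pure_tensor_def mult2_map_class by (simp add: mult2_def cl_lift_mult)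
  then show ?thesis by (simp add: triple_def mult3_def cl_lift_mult)
qed

text \<open>In terms of coefficient families, multiplication sends triples to normal words;
  injectivity and surjectivity can both be read off from this.\<close>

lemma mult_map_triple_word:
  "mult_map (tensor_class Tm0 Up (pm_ext triple_word w)) = cl (pm_ext normal_word w)"
proof -
  have "pm_ext mult3 (pm_ext triple_word w) - pm_ext normal_word w \<in> J"
  proof (rule lin_mem[where p = w and f = "\<lambda>w. pm_ext mult3 (pm_ext triple_word w) - pm_ext normal_word w",
        OF lin_diff[OF lin_comp[where f = "pm_ext mult3", OF lin_pm_ext lin_pm_ext] lin_pm_ext] J_subspace])
    fix k :: "'i list \<times> 'i generator list \<times> 'i list"
    obtain x t z where k: "k = (x, t, z)" by (cases k)
    have words: "pm_ext triple_word (bas k) = triple (wd (map F x)) (wd t) (wd (map E z))"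
      "pm_ext normal_word (bas k) = wd (map F x) * wd t * wd (map E z)"
      by (simp_all add: k triple_word_def normal_word_def wd_mult)
    show "pm_ext mult3 (pm_ext triple_word (bas k)) - pm_ext normal_word (bas k) \<in> J"
      unfolding words by (rule mult3_triple[unfolded cl_eq])
  qed
  then show ?thesis unfolding mult_map_class cl_eq .
qed

lemma triple_word_carrier:
  assumes "Poly_Mapping.keys w \<subseteq> normal_keys"
  shows "tensor_class Tm0 Up (pm_ext triple_word w) \<in> carrier (tensor_product Tm0 Up)"
proof -
  have "Poly_Mapping.keys (pm_ext triple_word w)
      \<subseteq> (\<Union>k\<in>Poly_Mapping.keys w. Poly_Mapping.keys (fscale (Poly_Mapping.lookup w k) (triple_word k)))"
    unfolding pm_ext_def by (rule keys_sum)
  also have "\<dots> \<subseteq> carrier Tm0 \<times> carrier Up"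
  proof (rule UN_least)
    fix k assume "k \<in> Poly_Mapping.keys w"
    then obtain x t z where k: "k = (x, t, z)" "set t \<subseteq> torus_generators"
      using assms unfolding normal_keys_def by blast
    have "(pure_tensor Um U0 (cl (wd (map F x))) (cl (wd t)), cl (wd (map E z))) \<in> carrier Tm0 \<times> carrier Up"
      by (intro SigmaI pure_tensor_carrier carrier_mem word_mem k)
    then show "Poly_Mapping.keys (fscale (Poly_Mapping.lookup w k) (triple_word k)) \<subseteq> carrier Tm0 \<times> carrier Up"
      by (simp add: k(1) triple_word_def triple_def)
  qed
  finally show ?thesis unfolding tensor_product_carrier by blast
qed

lemma mult_map_linear: "mult_map \<in> linear_maps (tensor_product Tm0 Up) (Uq a q)"
proof -
  have T: "\<exists>p. v = tensor_class Tm0 Up p" if "v \<in> carrier (tensor_product Tm0 Up)" for v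
    using that unfolding tensor_product_carrier by blast
  have "mult_map v \<in> carrier (Uq a q)" for v
    unfolding Uq_carrier mult_map_def by blast
  moreover have "mult_map (u \<oplus>\<^bsub>tensor_product Tm0 Up\<^esub> v) = mult_map u \<oplus>\<^bsub>Uq a q\<^esub> mult_map v"
    if u: "u \<in> carrier (tensor_product Tm0 Up)" and v: "v \<in> carrier (tensor_product Tm0 Up)" for u v
  proof -
    obtain p r where "u = tensor_class Tm0 Up p" "v = tensor_class Tm0 Up r" using T[OF u] T[OF v] by blast
    then show ?thesis by (simp only: tensor_product_add mult_map_class Uq_add pm_ext_simps)
  qed
  moreover have "mult_map (c \<odot>\<^bsub>tensor_product Tm0 Up\<^esub> u) = c \<odot>\<^bsub>Uq a q\<^esub> mult_map u"
    if u: "u \<in> carrier (tensor_product Tm0 Up)" for c u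
  proof -
    obtain p where "u = tensor_class Tm0 Up p" using T[OF u] by blast
    then show ?thesis by (simp only: tensor_product_smult mult_map_class Uq_smult pm_ext_simps)
  qed
  ultimately show ?thesis unfolding linear_maps_def by blast
qed

lemma mult_map_is_multiplication_map: "is_multiplication_map (Uq a q) Um U0 Up mult_map"
proof -
  have "mult_map (pure_tensor Tm0 Up (pure_tensor Um U0 x y) z) = x \<otimes>\<^bsub>Uq a q\<^esub> y \<otimes>\<^bsub>Uq a q\<^esub> z"
    if asm: "x \<in> carrier Um" "y \<in> carrier U0" "z \<in> carrier Up" for x y z
  proof -
    obtain x' y' z' where xyz: "x = cl x'" "y = cl y'" "z = cl z'"
      using asm unfolding carriers by blast
    have "mult_map (tensor_class Tm0 Up (triple x' y' z')) = cl (x' * y' * z')"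
      unfolding mult_map_class by (rule mult3_triple)
    then show ?thesis by (simp only: xyz Uq_mult triple_def pure_tensor_def)
  qed
  then show ?thesis
    unfolding is_multiplication_map_def using mult_map_linear by blast
qed

lemma mult_map_bij: "bij_betw mult_map (carrier (tensor_product Tm0 Up)) (carrier (Uq a q))"
proof (rule bij_betw_imageI)
  show "inj_on mult_map (carrier (tensor_product Tm0 Up))"
  proof (rule inj_onI)
    fix u v
    assume u: "u \<in> carrier (tensor_product Tm0 Up)" and v: "v \<in> carrier (tensor_product Tm0 Up)"
      and eq: "mult_map u = mult_map v"
    obtain r where r: "Poly_Mapping.keys r \<subseteq> normal_keys" "u = tensor_class Tm0 Up (pm_ext triple_word r)"
      using triple_spanning[OF u] .
    obtain s where s: "Poly_Mapping.keys s \<subseteq> normal_keys" "v = tensor_class Tm0 Up (pm_ext triple_word s)"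
      using triple_spanning[OF v] .
    have keys: "Poly_Mapping.keys (r - s) \<subseteq> normal_keys"
      using r(1) s(1) Poly_Mapping.keys_diff[of r s] by blast
    \<comment> \<open>Equal images make the difference of the two coefficient families a normally
      ordered element of the ideal, to which the kernel lemma applies.\<close>
    have "pm_ext normal_word (r - s) \<in> J"
      using eq unfolding r(2) s(2) mult_map_triple_word cl_eq by (simp only: pm_ext_simps)
    from triple_word_kernel[OF keys this] show "u = v"
      unfolding r(2) s(2) tensor_class_eq triple_relations_def by (simp only: pm_ext_simps)
  qed
  show "mult_map ` carrier (tensor_product Tm0 Up) = carrier (Uq a q)"
  proof
    show "mult_map ` carrier (tensor_product Tm0 Up) \<subseteq> carrier (Uq a q)"
      unfolding Uq_carrier mult_map_def by blast
    show "carrier (Uq a q) \<subseteq> mult_map ` carrier (tensor_product Tm0 Up)"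
    proof
      fix u assume "u \<in> carrier (Uq a q)"
      then obtain p where p: "u = cl p" unfolding Uq_carrier by blast
      obtain w where w: "Poly_Mapping.keys w \<subseteq> normal_keys" "p - pm_ext normal_word w \<in> J"
        by (rule normal_form[of p])
      have "u = mult_map (tensor_class Tm0 Up (pm_ext triple_word w))"
        unfolding mult_map_triple_word p cl_eq by (rule w(2))
      then show "u \<in> mult_map ` carrier (tensor_product Tm0 Up)"
        using triple_word_carrier[OF w(1)] by (rule image_eqI)
    qed
  qed
qed

lemma triangular_decomposition:
  "\<exists>\<phi>. is_multiplication_map (Uq a q) Um U0 Up \<phi> \<and> \<phi> \<in> vector_space_isos (tensor_product Tm0 Up) (Uq a q)"
  using mult_map_is_multiplication_map mult_map_linear mult_map_bij
  unfolding vector_space_isos_def by blast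

end

theorem corollary22:
  fixes a :: "'i::finite \<Rightarrow> 'i \<Rightarrow> int"
    and q :: "'i \<Rightarrow> 'i \<Rightarrow> 'k::field_char_0"
  assumes "gen_cartan_matrix a"
    and "symmetrizable a"
    and "indeterminates_subject_to_cartan a q"
    and "\<And>i m. m > 0 \<Longrightarrow> \<exists>r. r ^ m = q i i"
    and "\<And>i n. n > 0 \<Longrightarrow> q i i ^ n \<noteq> 1"
  shows "\<exists>\<phi>. is_multiplication_map (Uq a q) (Uq_minus a q) (Uq_zero a q) (Uq_plus a q) \<phi> \<and>
             \<phi> \<in> vector_space_isos
                   (tensor_product (tensor_product (Uq_minus a q) (Uq_zero a q)) (Uq_plus a q))
                   (Uq a q)"
proof -
  interpret quantum_parameters a q
    using assms(1,3,5) unfolding gen_cartan_matrix_def indeterminates_subject_to_cartan_def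
    by unfold_locales auto
  show ?thesis by (rule triangular_decomposition)
qed

end
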